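(* Suppose $f_1,\dots,f_N$ satisfy the Hessian Lipschitz, gradient Lipschitz / strong convexity, and bounded Hessian assumptions (A1), (A2), (A3) stated in the context. Consider any iteration $t$ of the SPAN algorithm described in the context, with current iterate $x_t$, sample batch $B$, standard Gaussian matrix $\Omega\in\mathbb{R}^{d\times l}$, and approximate Hessian $\hat H_B(x_t)$. Suppose the parameters satisfy $m\le l-4$, $0<\lambda\le\min\{\sigma_{m+1,t},\ \tfrac12\sigma_{\min}(Z^TU)\}$ and $$q\ \ge\ \left\lceil \frac12\log_{3/2}\left(34\sqrt{\frac{l}{l-m}}+\frac{16\sqrt{l}}{l-m+1}\cdot\sqrt{d-m}\right)\right\rceil$$ (the right-hand side grows like $\log d$). Then with probability at least $1-6e^{m-l}$, $$\left\|\hat H_B(x_t)-H_B(x_t)\right\|\le 3\sigma_{m+1,t}.$$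
   Context: Setting. $F(x)=\frac1N\sum_{i=1}^N f_i(x)$ with $x\in\mathbb{R}^d$, each $f_i$ twice differentiable. For $B\subseteq[N]=\{1,\dots,N\}$ with $|B|=b$, let $f_B(x)=\frac1b\sum_{i\in B}f_i(x)$ and $H_B(x)=\nabla^2 f_B(x)$. $\mathcal{D}\subseteq\mathbb{R}^d$ is the domain of the problem (it contains the iterates). $\|\cdot\|$ is the Euclidean norm of a vector and the spectral norm of a matrix. $\sigma_i(A)$ is the $i$-th largest singular value of $A$, $\sigma_{\min}(A)$ the smallest one, and $\sigma_{i,t}=\sigma_i(H_B(x_t))$. Assumptions. (A1) For every $B\subseteq[N]$ of size $b$ there is a constant $M_b$ depending on $b$ such that $\|H_B(x)-H_B(\hat x)\|\le M_b\|x-\hat x\|$ for all $x,\hat x\in\mathcal{D}$. (A2) (Gradient Lipschitz continuity and strong convexity) For every $B\subseteq[N]$ of size $b$, $f_B$ is strongly convex with Lipschitz gradient: there are positive constants $\mu_b,L_b$ depending on $b$ such that $\mu_b\|x-\hat x\|\le\|\nabla f_B(x)-\nabla f_B(\hat x)\|\le L_b\|x-\hat x\|$ for all $x,\hat x\in\mathcal{D}$; in particular $H_B(x)$ is positive definite. (A3) There is an absolute constant $K$ with $\max_{i\le N}\|\nabla^2 f_i(x)\|\le K$. SPAN algorithm, iteration $t$, with integer parameters $m,l,q$ ($l\ll d$) and step size $\eta_t$: select a uniformly random batch $B\subseteq[N]$; draw $\Omega\in\mathbb{R}^{d\times l}$ with i.i.d. standard Gaussian entries; set $Y_0=\Omega$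 and $Y_j=H_B(x_t)Y_{j-1}$ for $j=1,\dots,2q+1$ (so $Y_{2q+1}=H_B(x_t)^{2q+1}\Omega$; Hessian-vector products are taken to be exact); compute the QR decomposition $Y_{2q+1}=UR$ with $U\in\mathbb{R}^{d\times l}$, $U^TU=I$; set $Z=H_B(x_t)U$; choose $\lambda>0$; the approximate Hessian is $$\hat H_B(x_t)=UU^TH_B(x_t)UU^T+\lambda(I-UU^T),$$ with inverse $\hat H_B^{-1}(x_t)=U(Z^TU)^{-1}U^T+\lambda^{-1}(I-UU^T)$; update $x_{t+1}=x_t-\eta_t\hat H_B^{-1}(x_t)\nabla F(x_t)$. The probability is over the Gaussian matrix $\Omega$. *)

theory Defs
  imports "HOL-Probability.Probability" "HOL-Computational_Algebra.Polynomial"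
begin

text \<open>The dimension \<open>d\<close> is \<open>CARD('d)\<close> and the sketch size \<open>l\<close> is \<open>CARD('l)\<close>.\<close>

section \<open>Spectral norm and singular values\<close>

text \<open>The library's \<open>norm\<close> on matrices is the Frobenius norm, hence the explicit operator norm.\<close>

definition spectral_norm :: "real^'n^'m \<Rightarrow> real" where
  "spectral_norm A = onorm ((*v) A)"

definition charpoly :: "real^'n^'n \<Rightarrow> real poly" where
  "charpoly A = det (mat [:0, 1:] - (\<chi> i j. [:A $ i $ j:]))"

text \<open>Square roots of the eigenvalues of \<open>A\<^sup>T A\<close>, with multiplicity, in decreasing order.\<close>

definition singular_values :: "real^'n^'n \<Rightarrow> real list" where
  "singular_values A =
     rev (sorted_list_of_multiset (image_mset sqrt (proots (charpoly (transpose A ** A)))))"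

text \<open>The index is 1-based: \<open>sigma 1 A\<close> is the largest singular value.\<close>

definition sigma :: "nat \<Rightarrow> real^'n^'n \<Rightarrow> real" where
  "sigma i A = singular_values A ! (i - 1)"

definition sigma_min :: "real^'n^'n \<Rightarrow> real" where
  "sigma_min A = last (singular_values A)"

section \<open>Gradients, Hessians and the assumptions on the objective\<close>

definition grad :: "(real^'d \<Rightarrow> real) \<Rightarrow> real^'d \<Rightarrow> real^'d" where
  "grad f x = (\<chi> i. frechet_derivative f (at x) (axis i 1))"

definition hessian :: "(real^'d \<Rightarrow> real) \<Rightarrow> real^'d \<Rightarrow> real^'d^'d" where
  "hessian f x = jacobian (grad f) (at x)"

definition twice_differentiable :: "(real^'d \<Rightarrow> real) \<Rightarrow> bool" where
  "twice_differentiable f \<longleftrightarrow>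
     (\<forall>x. f differentiable (at x)) \<and> (\<forall>x. grad f differentiable (at x))"

definition batch_fun :: "(nat \<Rightarrow> real^'d \<Rightarrow> real) \<Rightarrow> nat set \<Rightarrow> real^'d \<Rightarrow> real" where
  "batch_fun f B x = (1 / real (card B)) * (\<Sum>i\<in>B. f i x)"

definition batches :: "nat \<Rightarrow> nat \<Rightarrow> nat set set" where
  "batches N b = {B. B \<subseteq> {1..N} \<and> card B = b}"

definition hessian_lipschitz ::
    "(nat \<Rightarrow> real^'d \<Rightarrow> real) \<Rightarrow> nat \<Rightarrow> nat \<Rightarrow> (real^'d) set \<Rightarrow> bool" where
  "hessian_lipschitz f N b D \<longleftrightarrow>
     (\<exists>M. \<forall>B\<in>batches N b. \<forall>x\<in>D. \<forall>y\<in>D.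
        spectral_norm (hessian (batch_fun f B) x - hessian (batch_fun f B) y) \<le> M * norm (x - y))"

text \<open>
  First-order form of strong convexity, so that \<open>D\<close> need not be convex.
\<close>

definition strongly_convex_on :: "(real^'d) set \<Rightarrow> real \<Rightarrow> (real^'d \<Rightarrow> real) \<Rightarrow> bool" where
  "strongly_convex_on D \<mu> f \<longleftrightarrow>
     (\<forall>x\<in>D. \<forall>y\<in>D. f y \<ge> f x + grad f x \<bullet> (y - x) + \<mu> / 2 * (norm (y - x))\<^sup>2)"

text \<open>
  Positive definiteness of the Hessian is listed explicitly: it does not follow from inequalities
  on \<open>D\<close> alone when \<open>D\<close> has empty interior. Symmetry is automatic for twice
  differentiable functions and is not assumed.
\<close>

definition strongly_convex_gradient_lipschitz ::
    "(nat \<Rightarrow> real^'d \<Rightarrow> real) \<Rightarrow> nat \<Rightarrow> nat \<Rightarrow> (real^'d) set \<Rightarrow> bool" where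
  "strongly_convex_gradient_lipschitz f N b D \<longleftrightarrow>
     (\<exists>\<mu>>0. \<exists>L>0. \<forall>B\<in>batches N b.
        strongly_convex_on D \<mu> (batch_fun f B) \<and>
        (\<forall>x\<in>D. \<forall>y\<in>D.
           \<mu> * norm (x - y) \<le> norm (grad (batch_fun f B) x - grad (batch_fun f B) y) \<and>
           norm (grad (batch_fun f B) x - grad (batch_fun f B) y) \<le> L * norm (x - y)) \<and>
        (\<forall>x\<in>D. \<forall>v. v \<noteq> 0 \<longrightarrow> 0 < v \<bullet> (hessian (batch_fun f B) x *v v)))"

definition bounded_hessian ::
    "(nat \<Rightarrow> real^'d \<Rightarrow> real) \<Rightarrow> nat \<Rightarrow> (real^'d) set \<Rightarrow> bool" where
  "bounded_hessian f N D \<longleftrightarrow>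
     (\<exists>K. \<forall>i\<in>{1..N}. \<forall>x\<in>D. spectral_norm (hessian (f i) x) \<le> K)"

section \<open>The SPAN iteration\<close>

definition std_gaussian_matrix :: "'w measure \<Rightarrow> ('w \<Rightarrow> real^'l^'d) \<Rightarrow> bool" where
  "std_gaussian_matrix M \<Omega> \<longleftrightarrow>
     prob_space.indep_vars M (\<lambda>_. borel) (\<lambda>(i, j) \<omega>. \<Omega> \<omega> $ i $ j) UNIV \<and>
     (\<forall>i j. distributed M lborel (\<lambda>\<omega>. \<Omega> \<omega> $ i $ j) std_normal_density)"

primrec power_iterate :: "real^'d^'d \<Rightarrow> real^'l^'d \<Rightarrow> nat \<Rightarrow> real^'l^'d" where
  "power_iterate H \<Omega> 0 = \<Omega>"
| "power_iterate H \<Omega> (Suc j) = H ** power_iterate H \<Omega> j"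

definition is_QR ::
    "real^('l::{finite,linorder})^'d \<Rightarrow> real^('l::{finite,linorder})^'d
      \<Rightarrow> real^('l::{finite,linorder})^('l::{finite,linorder}) \<Rightarrow> bool" where
  "is_QR Y U R \<longleftrightarrow>
     Y = U ** R \<and> transpose U ** U = mat 1 \<and> (\<forall>i j. j < i \<longrightarrow> R $ i $ j = 0)"

definition approx_hessian :: "real^'d^'d \<Rightarrow> real^'l^'d \<Rightarrow> real \<Rightarrow> real^'d^'d" where
  "approx_hessian H U lam =
     U ** transpose U ** H ** U ** transpose U + lam *\<^sub>R (mat 1 - U ** transpose U)"

end

(*
The rows of the sketch in an orthonormal eigenbasis of H split into m leading rows, with Gram matrix
G1 G1^T, and the remaining rows G2.  If every y in R^m has a preimage c, G1 c = y, with |G2 c| <= a |y|,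
then the range of H^(2q+1) Omega misses at most (1 + a) sigma_(m+1)^(2q+1) of H^(2q+1); log-convexity of
k |-> |H^k w| takes the (2q+1)-st root, and a 2x2 block argument gives the bound for the compression.

For the size of a, Halko, Martinsson and Tropp combine Gaussian concentration, Chevet's inequality and
the density of Wishart matrices.  Here a single moment computation suffices: for an extra Gaussian
vector w, independent of the sketch, the vector G2 G1^+ w has moments that factor into those of three
chi variables, since |G1^+ w| = |w| / dist(row, span of the other rows) after a rotation.  Averaging over
w recovers the operator norm up to the factor E|g|^(2k), because |X w| >= <b, X w> for every unit b.
Markov's inequality with 2k in {p - 1, p}, p = l - m, is strong enough for the failure probability 6 e^-p.
*)
theory Submission
  imports Defs
begin

section \<open>Symmetry of the Hessian\<close>

text \<open>The constants fit together as follows. The bound 3 sigma is twice 3/2 sigma: the block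
  argument doubles a bound for \<open>H\<close> on the complement of the sketched range, and 3/2 is
  what the (2q+1)-st root leaves of the amplification \<open>1 + a\<close>. With K the argument of
  the logarithm in the hypothesis on \<open>q\<close>, the choice is \<open>a = 14 / 10 * K\<close>.
  That hypothesis gives K <= (3/2)^(2q), and the one remaining factor 3/2 of the odd power pays for
  1 + 1.4 K <= 1.5 K, as K >= 34. No net over y is required: Markov's inequality is applied to the
  average over w, a function of the sketch alone that dominates every y at once. The order of the
  moment is limited by the inverse chi factor. A leading row has p + 1 = l - (m - 1) dimensions
  orthogonal to the other leading rows, and an inverse chi-square moment of order k is finite only
  if 2k is less than the number of degrees of freedom. Hence 2k is the largest even number not
  exceeding p. Symmetry of the Hessian has to come from pointwise twofold differentiability, since
  the second derivatives may be discontinuous.\<close>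

lemma second_difference_approx:
  fixes f :: "'a::real_inner \<Rightarrow> real"
  assumes f: "\<And>y. (f has_derivative (\<lambda>h. g y \<bullet> h)) (at y)"
    and g': "linear g'"
    and r: "\<And>h. norm h < \<delta> \<Longrightarrow> norm (g (x + h) - g x - g' h) \<le> e * norm h"
    and t: "0 < t" "t * (norm u + norm v) < \<delta>"
    and e: "0 \<le> e"
  shows "\<bar>f (x + t *\<^sub>R u + t *\<^sub>R v) - f (x + t *\<^sub>R u) - f (x + t *\<^sub>R v) + f x - t\<^sup>2 * (g' v \<bullet> u)\<bar>
      \<le> t\<^sup>2 * (e * (2 * norm u + norm v) * norm u)"
proof -
  interpret g': linear g' by fact
  \<comment> \<open>The increment of this function over [0, t] is the four-point difference, so the
    mean value theorem is applied in the direction \<open>u\<close> only.\<close>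
  define \<phi> where "\<phi> s = f (x + s *\<^sub>R u + t *\<^sub>R v) - f (x + s *\<^sub>R u)" for s
  have der: "(\<phi> has_derivative (*) ((g (x + s *\<^sub>R u + t *\<^sub>R v) - g (x + s *\<^sub>R u)) \<bullet> u)) (at s)" for s
    unfolding \<phi>_def
    by (rule derivative_eq_intros has_derivative_compose[OF _ f] refl
          | simp add: inner_diff_left algebra_simps fun_eq_iff)+
  have "\<exists>s>0. s < t \<and> \<phi> t - \<phi> 0 = (t - 0) * ((g (x + s *\<^sub>R u + t *\<^sub>R v) - g (x + s *\<^sub>R u)) \<bullet> u)"
    using MVT2[of 0 t \<phi> "\<lambda>s. (g (x + s *\<^sub>R u + t *\<^sub>R v) - g (x + s *\<^sub>R u)) \<bullet> u"] t der
    by (simp add: has_field_derivative_def)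
  then obtain s where s: "0 < s" "s < t"
    and eq: "\<phi> t - \<phi> 0 = t * ((g (x + s *\<^sub>R u + t *\<^sub>R v) - g (x + s *\<^sub>R u)) \<bullet> u)" by auto
  define h1 h2 where "h1 = s *\<^sub>R u + t *\<^sub>R v" and "h2 = s *\<^sub>R u"
  have su: "s * norm u \<le> t * norm u" using s by (intro mult_right_mono) auto
  have n1: "norm h1 \<le> t * (norm u + norm v)"
    unfolding h1_def using norm_triangle_ineq[of "s *\<^sub>R u" "t *\<^sub>R v"] s su by (simp add: algebra_simps)
  have n2: "norm h2 \<le> t * norm u" unfolding h2_def using s su by simp
  have n2': "norm h2 < \<delta>" 
  proof -
    have "0 \<le> t * norm v" using t(1) by simp
    with n2 t(2) show ?thesis unfolding distrib_left by linarith
  qed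
  have "norm (g (x + h1) - g x - g' h1) \<le> e * norm h1" using r n1 t by simp
  also have "\<dots> \<le> e * (t * (norm u + norm v))" using n1 e by (rule mult_left_mono)
  finally have r1: "norm (g (x + h1) - g x - g' h1) \<le> e * (t * (norm u + norm v))" .
  have "norm (g (x + h2) - g x - g' h2) \<le> e * norm h2" using r n2' by simp
  also have "\<dots> \<le> e * (t * norm u)" using n2 e by (rule mult_left_mono)
  finally have r2: "norm (g (x + h2) - g x - g' h2) \<le> e * (t * norm u)" .
  \<comment> \<open>\<open>g\<close> is differentiable at \<open>x\<close> only, so both gradients
    are compared with \<open>g x\<close>. Up to the factor \<open>e * t\<close> the errors are
    \<open>norm u + norm v\<close> and \<open>norm u\<close>, which add up to the
    \<open>2 * norm u + norm v\<close> of the claim.\<close>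
  have "g' h1 - g' h2 = t *\<^sub>R g' v" by (simp add: h1_def h2_def g'.add g'.scaleR)
  then have "g (x + h1) - g (x + h2) - t *\<^sub>R g' v
      = (g (x + h1) - g x - g' h1) - (g (x + h2) - g x - g' h2)" by (simp add: algebra_simps)
  then have d: "norm (g (x + h1) - g (x + h2) - t *\<^sub>R g' v) \<le> t * (e * (2 * norm u + norm v))"
    using norm_triangle_ineq4[of "g (x + h1) - g x - g' h1" "g (x + h2) - g x - g' h2"] r1 r2
    by (simp add: algebra_simps)
  have "f (x + t *\<^sub>R u + t *\<^sub>R v) - f (x + t *\<^sub>R u) - f (x + t *\<^sub>R v) + f x - t\<^sup>2 * (g' v \<bullet> u)
     = \<phi> t - \<phi> 0 - t\<^sup>2 * (g' v \<bullet> u)" by (simp add: \<phi>_def)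
  also have "\<dots> = t * ((g (x + h1) - g (x + h2) - t *\<^sub>R g' v) \<bullet> u)"
    unfolding eq by (simp add: h1_def h2_def algebra_simps power2_eq_square inner_diff_left)
  finally have "\<bar>f (x + t *\<^sub>R u + t *\<^sub>R v) - f (x + t *\<^sub>R u) - f (x + t *\<^sub>R v) + f x - t\<^sup>2 * (g' v \<bullet> u)\<bar>
     \<le> t * (norm (g (x + h1) - g (x + h2) - t *\<^sub>R g' v) * norm u)"
    using t(1) Cauchy_Schwarz_ineq2[of "g (x + h1) - g (x + h2) - t *\<^sub>R g' v" u]
    by (simp add: abs_mult mult_left_mono)
  also have "\<dots> \<le> t * (t * (e * (2 * norm u + norm v)) * norm u)"
    using d t(1) by (intro mult_left_mono mult_right_mono) auto
  finally show ?thesis by (simp add: power2_eq_square algebra_simps)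
qed

text \<open>The four-point difference is unchanged when \<open>u\<close> and \<open>v\<close> are
  exchanged, whereas the exchange turns its approximation \<open>g' v \<bullet> u\<close> into
  \<open>g' u \<bullet> v\<close>.\<close>

lemma gradient_derivative_symmetric:
  fixes f :: "'a::real_inner \<Rightarrow> real"
  assumes f: "\<And>y. (f has_derivative (\<lambda>h. g y \<bullet> h)) (at y)"
    and g: "(g has_derivative g') (at x)"
  shows "g' u \<bullet> v = g' v \<bullet> u"
proof -
  have lin: "linear g'" using g has_derivative_linear by blast
  define C where "C = (2 * norm u + norm v) * norm u + (2 * norm v + norm u) * norm v"
  have bound: "\<bar>g' u \<bullet> v - g' v \<bullet> u\<bar> \<le> e * C" if e: "e > 0" for e
  proof -
    obtain \<delta> where \<delta>: "\<delta> > 0" and r0: "\<And>y. norm (y - x) < \<delta> \<Longrightarrow> norm (g y - g x - g' (y - x)) \<le> e * norm (y - x)"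
      using g e unfolding has_derivative_at_alt by blast
    have r: "norm (g (x + h) - g x - g' h) \<le> e * norm h" if "norm h < \<delta>" for h
      using r0[of "x + h"] that by simp
    \<comment> \<open>The summand 1 keeps the denominator positive when both vectors vanish; the
      factor 2 makes the later inequality strict.\<close>
    define t where "t = \<delta> / (2 * (norm u + norm v + 1))"
    have pos: "norm u + norm v + 1 > 0" using norm_ge_zero[of u] norm_ge_zero[of v] by linarith
    have t0: "t > 0" unfolding t_def using \<delta> pos by simp
    have "t * (norm u + norm v) \<le> t * (norm u + norm v + 1)" using t0 by simp
    also have "\<dots> = \<delta> / 2" unfolding t_def using pos by (simp add: field_simps)
    also have "\<dots> < \<delta>" using \<delta> by simp
    finally have t1: "t * (norm u + norm v) < \<delta>" .
    note A = second_difference_approx[OF f lin r t0 t1]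
    have t2: "t * (norm v + norm u) < \<delta>" using t1 by (simp add: add.commute)
    note B = second_difference_approx[OF f lin r t0 t2]
    have sw: "x + t *\<^sub>R v + t *\<^sub>R u = x + t *\<^sub>R u + t *\<^sub>R v" by (simp add: algebra_simps)
    have "\<bar>t\<^sup>2 * (g' u \<bullet> v) - t\<^sup>2 * (g' v \<bullet> u)\<bar> \<le> t\<^sup>2 * (e * (2 * norm u + norm v) * norm u) + t\<^sup>2 * (e * (2 * norm v + norm u) * norm v)"
      using A B e unfolding sw by linarith
    also have "\<dots> = t\<^sup>2 * (e * C)" unfolding C_def by (simp add: algebra_simps)
    finally have "t\<^sup>2 * \<bar>g' u \<bullet> v - g' v \<bullet> u\<bar> \<le> t\<^sup>2 * (e * C)"
      by (metis abs_mult abs_power2 right_diff_distrib)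
    then show ?thesis using t0 by simp
  qed
  have "C \<ge> 0" unfolding C_def by simp
  have "\<bar>g' u \<bullet> v - g' v \<bullet> u\<bar> \<le> 0"
  proof (rule field_le_epsilon)
    fix e :: real assume "e > 0"
    then have "\<bar>g' u \<bullet> v - g' v \<bullet> u\<bar> \<le> e / (C + 1) * C" using \<open>C \<ge> 0\<close> by (intro bound) simp
    also have "\<dots> \<le> e" using \<open>C \<ge> 0\<close> \<open>e > 0\<close> by (simp add: field_simps)
    finally show "\<bar>g' u \<bullet> v - g' v \<bullet> u\<bar> \<le> 0 + e" by simp
  qed
  then show ?thesis by simp
qed

lemma has_derivative_grad:
  fixes f :: "real^'d \<Rightarrow> real"
  assumes "f differentiable (at y)"
  shows "(f has_derivative (\<lambda>h. grad f y \<bullet> h)) (at y)"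
proof -
  let ?f' = "frechet_derivative f (at y)"
  have d: "(f has_derivative ?f') (at y)" using assms frechet_derivative_works by blast
  interpret linear ?f' using d has_derivative_linear by blast
  have "?f' h = grad f y \<bullet> h" for h
  proof -
    have "?f' h = ?f' (\<Sum>i\<in>UNIV. h $ i *\<^sub>R axis i 1)"
      using basis_expansion[of h] by (simp add: scalar_mult_eq_scaleR)
    also have "\<dots> = (\<Sum>i\<in>UNIV. h $ i * ?f' (axis i 1))" by (simp add: sum scaleR)
    finally show ?thesis by (simp add: grad_def inner_vec_def mult.commute)
  qed
  then show ?thesis using d by presburger
qed

lemma symmetric_hessian:
  fixes f :: "real^'d \<Rightarrow> real"
  assumes "twice_differentiable f"
  shows "transpose (hessian f x) = hessian f x"
proof -
  let ?g' = "frechet_derivative (grad f) (at x)"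
  have g: "(grad f has_derivative ?g') (at x)"
    using assms frechet_derivative_works unfolding twice_differentiable_def by blast
  have f: "\<And>y. (f has_derivative (\<lambda>h. grad f y \<bullet> h)) (at y)"
    using assms unfolding twice_differentiable_def by (blast intro: has_derivative_grad)
  have "?g' (axis i 1) \<bullet> axis j 1 = ?g' (axis j 1) \<bullet> axis i 1" for i j
    using gradient_derivative_symmetric[OF f g] .
  then show ?thesis
    by (simp add: hessian_def jacobian_def matrix_def transpose_def vec_eq_iff inner_axis)
qed

lemma twice_differentiable_batch_fun:
  fixes f :: "nat \<Rightarrow> real^'d \<Rightarrow> real"
  assumes "\<And>i. i \<in> B \<Longrightarrow> twice_differentiable (f i)"
  shows "twice_differentiable (batch_fun f B)"
proof -
  have f: "i \<in> B \<Longrightarrow> (f i has_derivative (\<lambda>h. grad (f i) y \<bullet> h)) (at y)" for i y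
    using assms unfolding twice_differentiable_def by (blast intro: has_derivative_grad)
  have d: "(batch_fun f B has_derivative (\<lambda>h. ((1 / real (card B)) *\<^sub>R (\<Sum>i\<in>B. grad (f i) y)) \<bullet> h)) (at y)" for y
    unfolding batch_fun_def
    by (rule derivative_eq_intros f refl | simp add: inner_sum_left sum_distrib_left)+
  have "grad (batch_fun f B) y = (1 / real (card B)) *\<^sub>R (\<Sum>i\<in>B. grad (f i) y)" for y
    using frechet_derivative_at[OF d[of y], symmetric] by (simp add: grad_def vec_eq_iff inner_axis)
  then have "grad (batch_fun f B) = (\<lambda>y. (1 / real (card B)) *\<^sub>R (\<Sum>i\<in>B. grad (f i) y))" by blast
  moreover have "(\<lambda>y. (1 / real (card B)) *\<^sub>R (\<Sum>i\<in>B. grad (f i) y)) differentiable (at x)" for x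
    by (cases "finite B") (use assms in \<open>auto simp: twice_differentiable_def intro!: derivative_intros\<close>)
  ultimately show ?thesis
    using d unfolding twice_differentiable_def differentiable_def by metis
qed

section \<open>Spectral decomposition and singular values\<close>

text \<open>A maximiser \<open>x\<close> of the Rayleigh quotient on the unit sphere of
  \<open>S\<close> is an eigenvector: if the residual \<open>z\<close> of the eigenvalue equation
  were nonzero, moving from \<open>x\<close> towards \<open>z\<close> would increase the quotient to
  first order.\<close>

lemma selfadjoint_eigenvector_exists:
  fixes f :: "'a::euclidean_space \<Rightarrow> 'a"
  assumes lin: "linear f" and sym: "\<And>x y. f x \<bullet> y = x \<bullet> f y"
    and S: "subspace S" and inv: "\<And>x. x \<in> S \<Longrightarrow> f x \<in> S" and nz: "S \<noteq> {0}"
  shows "\<exists>x\<in>S. \<exists>\<mu>. norm x = 1 \<and> f x = \<mu> *\<^sub>R x"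
proof -
  interpret linear f by fact
  have contf: "continuous_on X f" for X
    using lin linear_continuous_on linear_linear by blast
  obtain y0 where y0: "y0 \<in> S" "y0 \<noteq> 0" using nz subspace_0[OF S] by blast
  have "compact (sphere 0 1 \<inter> S)" using closed_subspace[OF S] by (simp add: compact_Int_closed)
  moreover have "y0 /\<^sub>R norm y0 \<in> sphere 0 1 \<inter> S" using y0 S by (simp add: subspace_scale)
  moreover have "continuous_on (sphere 0 1 \<inter> S) (\<lambda>x. x \<bullet> f x)" by (intro continuous_intros contf)
  ultimately obtain x where x: "x \<in> sphere 0 1 \<inter> S"
    and max: "\<And>y. y \<in> sphere 0 1 \<inter> S \<Longrightarrow> y \<bullet> f y \<le> x \<bullet> f x"
    using continuous_attains_sup[of "sphere 0 1 \<inter> S" "\<lambda>x. x \<bullet> f x"] by blast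
  have xx: "x \<bullet> x = 1" using x by (simp add: norm_eq_1)
  define \<mu> where "\<mu> = x \<bullet> f x"
  have ub: "y \<bullet> f y \<le> \<mu> * (y \<bullet> y)" if y: "y \<in> S" for y
  proof (cases "y = 0")
    case False
    have "(y /\<^sub>R norm y) \<bullet> f (y /\<^sub>R norm y) \<le> \<mu>"
      unfolding \<mu>_def using y False S by (intro max) (simp add: subspace_scale)
    then have "(y \<bullet> f y) / (norm y)\<^sup>2 \<le> \<mu>" by (simp add: scaleR power2_eq_square divide_inverse mult_ac)
    then show ?thesis using False by (simp add: divide_le_eq power2_norm_eq_inner)
  qed (simp add: zero)
  define z where "z = f x - \<mu> *\<^sub>R x"
  have zS: "z \<in> S" unfolding z_def using x inv S by (simp add: subspace_diff subspace_scale)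
  \<comment> \<open>The first-order gain at \<open>x + t *\<^sub>R z\<close> against the
    second-order terms; small \<open>t\<close> will force \<open>z \<bullet> z\<close> to be
    0.\<close>
  have ineq: "2 * (z \<bullet> z) \<le> t * (\<mu> * (z \<bullet> z) - z \<bullet> f z)" if t: "t > 0" for t
  proof -
    have "x + t *\<^sub>R z \<in> S" using x zS S by (simp add: subspace_add subspace_scale)
    from ub[OF this] have "(x + t *\<^sub>R z) \<bullet> f (x + t *\<^sub>R z) \<le> \<mu> * ((x + t *\<^sub>R z) \<bullet> (x + t *\<^sub>R z))" .
    moreover have "x \<bullet> f z = f x \<bullet> z" by (simp add: sym)
    ultimately have "2 * t * (z \<bullet> f x) + t * t * (z \<bullet> f z) \<le> \<mu> * (2 * t * (z \<bullet> x) + t * t * (z \<bullet> z))"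
      by (simp add: add scaleR inner_add_left inner_add_right \<mu>_def[symmetric] xx inner_commute algebra_simps)
    moreover have eq: "z \<bullet> f x = z \<bullet> z + \<mu> * (z \<bullet> x)" by (simp add: z_def inner_diff_right)
    ultimately have "t * (2 * (z \<bullet> z)) \<le> t * (t * (\<mu> * (z \<bullet> z) - z \<bullet> f z))" unfolding eq by (simp add: algebra_simps)
    then show ?thesis using t by simp
  qed
  have "z \<bullet> z \<le> 0"
  proof (rule field_le_epsilon)
    fix e :: real assume e: "e > 0"
    define c where "c = \<bar>\<mu> * (z \<bullet> z) - z \<bullet> f z\<bar> + 1"
    have "2 * (z \<bullet> z) \<le> e / c * (\<mu> * (z \<bullet> z) - z \<bullet> f z)" by (rule ineq) (simp add: c_def e)
    also have "\<dots> \<le> e / c * c" using e by (intro mult_left_mono) (auto simp: c_def)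
    also have "\<dots> = e" by (simp add: c_def)
    finally have "2 * (z \<bullet> z) \<le> e" .
    then show "z \<bullet> z \<le> 0 + e" using e by linarith
  qed
  then have "z = 0" by (metis inner_ge_zero inner_eq_zero_iff order_antisym)
  then show ?thesis using x unfolding z_def by auto
qed

lemma selfadjoint_orthonormal_eigenbasis:
  fixes f :: "'a::euclidean_space \<Rightarrow> 'a"
  assumes lin: "linear f" and sym: "\<And>x y. f x \<bullet> y = x \<bullet> f y"
    and "subspace S" "\<And>x. x \<in> S \<Longrightarrow> f x \<in> S"
  shows "\<exists>B. B \<subseteq> S \<and> pairwise orthogonal B \<and> span B = S \<and> (\<forall>x\<in>B. norm x = 1 \<and> (\<exists>\<mu>. f x = \<mu> *\<^sub>R x))"
  using assms(3,4)
proof (induction "dim S" arbitrary: S rule: less_induct)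
  case less
  show ?case
  proof (cases "S = {0}")
    case True
    then show ?thesis by (intro exI[of _ "{}"]) auto
  next
    case False
    obtain x \<mu> where x: "x \<in> S" "norm x = 1" "f x = \<mu> *\<^sub>R x"
      using selfadjoint_eigenvector_exists[OF lin sym less.prems False] by blast
    define T where "T = S \<inter> {y. x \<bullet> y = 0}"
    have subT: "subspace T" unfolding T_def using less.prems(1) subspace_hyperplane by (rule subspace_inter)
    have "x \<notin> T" using x by (auto simp: T_def)
    moreover have "T \<subseteq> S" by (auto simp: T_def)
    ultimately have "dim T < dim S"
      using x subspace_dim_equal[OF subT less.prems(1)] dim_subset[of T S] by (metis le_neq_implies_less nat_le_linear)
    moreover have "f y \<in> T" if "y \<in> T" for y
      using that less.prems(2) x(3) sym[of x y, symmetric] by (auto simp: T_def)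
    ultimately obtain B where B: "B \<subseteq> T" "pairwise orthogonal B" "span B = T"
        "\<And>y. y \<in> B \<Longrightarrow> norm y = 1 \<and> (\<exists>\<mu>. f y = \<mu> *\<^sub>R y)"
      using less.hyps[OF _ subT] by metis
    have "pairwise orthogonal (insert x B)"
      using B(1,2) by (auto simp: pairwise_insert T_def orthogonal_def inner_commute)
    moreover have "span (insert x B) = S"
    proof
      show "span (insert x B) \<subseteq> S"
        using x B(1) less.prems(1) by (intro span_minimal) (auto simp: T_def)
      show "S \<subseteq> span (insert x B)"
      proof
        fix y assume y: "y \<in> S"
        have "y - (x \<bullet> y) *\<^sub>R x \<in> T"
          using y x less.prems(1) by (simp add: T_def subspace_diff subspace_scale inner_diff_right norm_eq_1)
        then show "y \<in> span (insert x B)" using B(3) unfolding span_insert by blast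
      qed
    qed
    ultimately show ?thesis using B x
      by (intro exI[of _ "insert x B"]) (auto simp: T_def)
  qed
qed

lemma symmetric_matrix_eigenbasis:
  fixes H :: "real^'d^'d"
  assumes "transpose H = H"
  obtains v :: "'d \<Rightarrow> real^'d" and s :: "'d \<Rightarrow> real"
  where "\<And>i j. v i \<bullet> v j = (if i = j then 1 else 0)" "\<And>i. H *v v i = s i *\<^sub>R v i"
proof -
  have "\<exists>B. B \<subseteq> UNIV \<and> pairwise orthogonal B \<and> span B = (UNIV :: (real^'d) set) \<and>
      (\<forall>x\<in>B. norm x = 1 \<and> (\<exists>\<mu>. H *v x = \<mu> *\<^sub>R x))"
  proof (intro selfadjoint_orthonormal_eigenbasis)
    show "(H *v x) \<bullet> y = x \<bullet> (H *v y)" for x y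
      using dot_lmul_matrix[of x H y] assms transpose_matrix_vector[of H x] by simp
  qed auto
  then obtain B where B: "pairwise orthogonal B" "span B = (UNIV :: (real^'d) set)"
      "\<And>x. x \<in> B \<Longrightarrow> norm x = 1 \<and> (\<exists>\<mu>. H *v x = \<mu> *\<^sub>R x)" by blast
  have ind: "independent B"
    using B by (intro pairwise_orthogonal_independent) force+
  then have "finite B" "card B = CARD('d)"
    using independent_imp_finite dim_eq_card_independent[OF ind] dim_span[of B] B(2) by (auto simp: dim_UNIV)
  \<comment> \<open>The basis has \<open>CARD('d)\<close> elements, so the type \<open>'d\<close>
    itself can index it.\<close>
  then obtain v where v: "bij_betw v (UNIV :: 'd set) B"
    by (metis finite_same_card_bij finite_class.finite_UNIV)
  then have vB: "v i \<in> B" and inj: "v i = v j \<longleftrightarrow> i = j" for i j by (auto simp: bij_betw_def inj_def)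
  obtain s where "\<And>i. H *v v i = s i *\<^sub>R v i" using B(3)[OF vB] by metis
  moreover have "v i \<bullet> v j = (if i = j then 1 else 0)" for i j
    using B(1,3) vB inj by (auto simp: pairwise_def orthogonal_def norm_eq_1)
  ultimately show ?thesis using that by blast
qed

section \<open>Characteristic polynomial and singular values in an eigenbasis\<close>

lemma matrix_mult_diff_left: "(A - B) ** C = A ** C - B ** (C :: 'a::ring_1^'n^'k)"
  by (simp add: matrix_matrix_mult_def vec_eq_iff left_diff_distrib sum_subtractf)

lemma matrix_mult_diff_right: "C ** (A - B) = C ** A - C ** (B :: 'a::ring_1^'n^'k)"
  by (simp add: matrix_matrix_mult_def vec_eq_iff right_diff_distrib sum_subtractf)

abbreviation const_poly_matrix :: "real^'n^'m \<Rightarrow> (real poly)^'n^'m" where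
  "const_poly_matrix A \<equiv> (\<chi> i j. [:A $ i $ j:])"

lemma const_poly_sum: "[:\<Sum>k\<in>K. f k:] = (\<Sum>k\<in>K. [:f k :: real:])"
proof -
  have pc: "[:a + b:] = [:a:] + [:b:]" for a b :: real by simp
  show ?thesis by (induction K rule: infinite_finite_induct) (auto simp: pc simp del: add_pCons)
qed

lemma const_poly_matrix_mult: "const_poly_matrix (A ** B) = const_poly_matrix A ** const_poly_matrix B"
  by (simp add: matrix_matrix_mult_def vec_eq_iff const_poly_sum mult.commute)

text \<open>With the eigenvectors as columns of \<open>V\<close>, both sides of
  \<open>(X - A) V = V (X - D)\<close> are taken to determinants over the polynomial ring. The
  determinant of \<open>V\<close> cancels; it is nonzero because \<open>V\<close> is
  orthogonal.\<close>

lemma charpoly_eigenbasis: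
  fixes A :: "real^'d^'d" and v :: "'d \<Rightarrow> real^'d"
  assumes on: "\<And>i j. v i \<bullet> v j = (if i = j then 1 else 0)" and ev: "\<And>i. A *v v i = a i *\<^sub>R v i"
  shows "charpoly A = (\<Prod>i\<in>UNIV. [:- a i, 1:])"
proof -
  define V where "V = (\<chi> i j. v j $ i)"
  define D where "D = (\<chi> i j. if i = j then a i else (0::real))"
  have VV: "transpose V ** V = mat 1"
    by (simp add: V_def matrix_matrix_mult_def transpose_def mat_def vec_eq_iff on[unfolded inner_vec_def, simplified])
  have "(A ** V) $ i $ j = (V ** D) $ i $ j" for i j
  proof -
    have "(A ** V) $ i $ j = (A *v v j) $ i" by (simp add: V_def matrix_matrix_mult_def matrix_vector_mult_def)
    also have "\<dots> = (V ** D) $ i $ j" unfolding ev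
      by (simp add: V_def D_def matrix_matrix_mult_def if_distrib[of "\<lambda>x. _ * x"] cong: if_cong)
    finally show ?thesis .
  qed
  then have AV: "A ** V = V ** D" by (simp add: vec_eq_iff)
  let ?X = "mat [:0, 1:] :: (real poly)^'d^'d"
  have matX: "?X ** C = C ** ?X" for C
    by (simp add: matrix_matrix_mult_def mat_def vec_eq_iff if_distrib[of "\<lambda>x. _ * x"] if_distrib[of "\<lambda>x. x * _"] cong: if_cong)
  have one: "const_poly_matrix (mat 1 :: real^'d^'d) = mat 1"
    by (simp add: mat_def vec_eq_iff one_pCons)
  have "const_poly_matrix (transpose V) ** const_poly_matrix V = mat 1"
    unfolding const_poly_matrix_mult[symmetric] VV one ..
  then have "det (const_poly_matrix (transpose V)) * det (const_poly_matrix V) = 1"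
    by (metis det_I det_mul)
  then have nz: "det (const_poly_matrix V) \<noteq> 0" by auto
  have "(?X - const_poly_matrix A) ** const_poly_matrix V = const_poly_matrix V ** (?X - const_poly_matrix D)"
  proof -
    have "(?X - const_poly_matrix A) ** const_poly_matrix V = ?X ** const_poly_matrix V - const_poly_matrix (A ** V)"
      unfolding const_poly_matrix_mult
      by (rule matrix_mult_diff_left)
    also have "\<dots> = const_poly_matrix V ** (?X - const_poly_matrix D)"
      unfolding AV const_poly_matrix_mult matX[of "const_poly_matrix V"]
      by (rule matrix_mult_diff_right[symmetric])
    finally show ?thesis .
  qed
  from arg_cong[OF this, of det]
  have "charpoly A * det (const_poly_matrix V) = det (const_poly_matrix V) * det (?X - const_poly_matrix D)"
    unfolding charpoly_def det_mul .
  then have "charpoly A = det (?X - const_poly_matrix D)" using nz by simp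
  also have "\<dots> = (\<Prod>i\<in>UNIV. (?X - const_poly_matrix D) $ i $ i)"
    by (rule det_diagonal) (simp add: mat_def D_def)
  finally show ?thesis by (simp add: mat_def D_def)
qed

text \<open>\<open>transpose H ** H\<close> has the eigenvalues \<open>(s i)\<^sup>2\<close> in the
  same basis, and nonnegativity lets the square root recover \<open>s i\<close>.\<close>

lemma singular_values_eigenbasis:
  fixes H :: "real^'d^'d" and v :: "'d \<Rightarrow> real^'d"
  assumes on: "\<And>i j. v i \<bullet> v j = (if i = j then 1 else 0)" and ev: "\<And>i. H *v v i = s i *\<^sub>R v i"
    and sym: "transpose H = H" and pos: "\<And>i. 0 \<le> s i"
  shows "singular_values H = rev (sorted_list_of_multiset (image_mset s (mset_set UNIV)))"
proof -
  have "charpoly (transpose H ** H) = (\<Prod>i\<in>UNIV. [:- (s i)\<^sup>2, 1:])"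
    by (rule charpoly_eigenbasis[OF on])
      (simp add: sym ev power2_eq_square matrix_vector_mult_scaleR flip: matrix_vector_mul_assoc)
  then have "proots (charpoly (transpose H ** H)) = (\<Sum>i\<in>UNIV. {#(s i)\<^sup>2#})"
    by (simp add: proots_prod)
  also have "\<dots> = image_mset (\<lambda>i. (s i)\<^sup>2) (mset_set UNIV)"
    by (simp add: sum_unfold_sum_mset)
  finally show ?thesis by (simp add: singular_values_def image_mset.compositionality comp_def pos)
qed

text \<open>\<open>I\<close> collects the indices of the \<open>m\<close> largest eigenvalues.
  Sorting indices instead of values gives exactly \<open>m\<close> of them even if eigenvalues
  coincide across the threshold. The last conclusion later yields the positivity of the
  threshold.\<close>

lemma sigma_threshold:
  fixes H :: "real^'d^'d" and v :: "'d \<Rightarrow> real^'d"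
  assumes on: "\<And>i j. v i \<bullet> v j = (if i = j then 1 else 0)" and ev: "\<And>i. H *v v i = s i *\<^sub>R v i"
    and sym: "transpose H = H" and pos: "\<And>i. 0 \<le> s i" and m: "m < CARD('d)"
  obtains I where "card I = m" "\<And>j. j \<notin> I \<Longrightarrow> s j \<le> sigma (m + 1) H" "sigma (m + 1) H \<in> range s"
proof -
  obtain ys :: "'d list" where ys: "set ys = UNIV" "distinct ys" using finite_distinct_list[OF finite[of UNIV]] by auto
  define zs where "zs = rev (sort_key s ys)"
  have zs: "set zs = UNIV" "distinct zs" "length zs = CARD('d)"
    using ys distinct_card[of ys] by (auto simp: zs_def)
  have dec: "sorted_wrt (\<lambda>i j. s j \<le> s i) zs"
    using sorted_sort_key[of s ys] by (simp add: zs_def sorted_wrt_rev sorted_map)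
  have "mset_set (UNIV :: 'd set) = mset ys" using ys by (metis mset_set_set)
  then have "image_mset s (mset_set UNIV) = mset (map s (sort_key s ys))" by simp
  then have "sorted_list_of_multiset (image_mset s (mset_set UNIV)) = map s (sort_key s ys)"
    by (metis sorted_list_of_multiset_mset sorted_sort_id sorted_sort_key)
  then have "sigma (m + 1) H = map s zs ! m"
    by (simp add: sigma_def singular_values_eigenbasis[OF on ev sym pos] zs_def rev_map)
  then have sg: "sigma (m + 1) H = s (zs ! m)" using m zs by simp
  show ?thesis
  proof (rule that[of "set (take m zs)"])
    show "card (set (take m zs)) = m" using zs m by (simp add: distinct_card)
    show "sigma (m + 1) H \<in> range s" using sg by simp
    fix j assume j: "j \<notin> set (take m zs)"
    obtain k where k: "k < length zs" "zs ! k = j" using zs by (metis UNIV_I in_set_conv_nth)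
    have "m \<le> k" using j k by (metis in_set_conv_nth length_take linorder_not_le min_less_iff_conj nth_take)
    then show "s j \<le> sigma (m + 1) H"
      using sorted_wrt_nth_less[OF dec, of m k] k sg by (cases "m = k") auto
  qed
qed

section \<open>Deterministic error bounds\<close>

text \<open>By Cauchy-Schwarz the ratios of successive norms \<open>norm ((f ^^ j) x)\<close>
  increase with \<open>j\<close>. The claim compares the first ratio with a later one, with
  denominators cleared because they may vanish.\<close>

lemma selfadjoint_norm_iterate_logconvex:
  fixes f :: "'a::real_inner \<Rightarrow> 'a"
  assumes sym: "\<And>x y. f x \<bullet> y = x \<bullet> f y"
  shows "norm (f x) * norm ((f ^^ j) x) \<le> norm ((f ^^ Suc j) x) * norm x"
proof (induction j)
  case 0
  then show ?case by simp
next
  case (Suc j)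
  let ?a = "\<lambda>j. norm ((f ^^ j) x)"
  have "(?a (Suc j))\<^sup>2 = (f ^^ j) x \<bullet> (f ^^ Suc (Suc j)) x"
    by (simp add: power2_norm_eq_inner sym)
  also have "\<dots> \<le> ?a j * ?a (Suc (Suc j))" by (rule norm_cauchy_schwarz)
  finally have lc: "(?a (Suc j))\<^sup>2 \<le> ?a j * ?a (Suc (Suc j))" .
  show ?case
  proof (cases "?a j = 0")
    case True
    then have "?a (Suc j) = 0" using lc by simp
    then show ?thesis by simp
  next
    case False
    have "(norm (f x) * ?a (Suc j)) * ?a j = (norm (f x) * ?a j) * ?a (Suc j)" by simp
    also have "\<dots> \<le> (?a (Suc j) * norm x) * ?a (Suc j)" using Suc.IH by (intro mult_right_mono) auto
    also have "\<dots> = (?a (Suc j))\<^sup>2 * norm x" by (simp add: power2_eq_square)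
    also have "\<dots> \<le> (?a j * ?a (Suc (Suc j))) * norm x" using lc by (intro mult_right_mono) auto
    finally have "(norm (f x) * ?a (Suc j)) * ?a j \<le> (?a (Suc (Suc j)) * norm x) * ?a j" by (simp add: mult_ac)
    moreover have "?a j > 0" using False by simp
    ultimately show ?thesis by (rule mult_right_le_imp_le)
  qed
qed

text \<open>The product of \<open>j + 1\<close> successive ratios, each at least the first
  one.\<close>

lemma selfadjoint_norm_power_le:
  fixes f :: "'a::real_inner \<Rightarrow> 'a"
  assumes sym: "\<And>x y. f x \<bullet> y = x \<bullet> f y"
  shows "norm (f x) ^ Suc j \<le> norm ((f ^^ Suc j) x) * norm x ^ j"
proof (induction j)
  case 0
  then show ?case by simp
next
  case (Suc j)
  have "norm (f x) ^ Suc (Suc j) \<le> norm (f x) * (norm ((f ^^ Suc j) x) * norm x ^ j)"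
    using Suc.IH by (simp add: mult_left_mono)
  also have "\<dots> = norm (f x) * norm ((f ^^ Suc j) x) * norm x ^ j" by simp
  also have "\<dots> \<le> norm ((f ^^ Suc (Suc j)) x) * norm x * norm x ^ j"
    by (intro mult_right_mono selfadjoint_norm_iterate_logconvex sym) auto
  finally show ?case by (simp add: mult_ac)
qed

lemma selfadjoint_funpow:
  fixes f :: "'a::real_inner \<Rightarrow> 'a"
  assumes sym: "\<And>x y. f x \<bullet> y = x \<bullet> f y"
  shows "(f ^^ k) x \<bullet> y = x \<bullet> (f ^^ k) y"
proof (induction k arbitrary: y)
  case (Suc k)
  have "(f ^^ Suc k) x \<bullet> y = (f ^^ k) x \<bullet> f y" by (simp add: sym)
  also have "\<dots> = x \<bullet> (f ^^ k) (f y)" by (rule Suc.IH)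
  also have "(f ^^ k) (f y) = (f ^^ Suc k) y" by (simp add: funpow_swap1)
  finally show ?case .
qed simp

lemma linear_funpow: "linear f \<Longrightarrow> linear (f ^^ k)" for f :: "'a::real_vector \<Rightarrow> 'a"
proof (induction k)
  case (Suc k)
  then show ?case unfolding funpow.simps by (intro linear_compose)
qed (use linear_id in \<open>simp add: id_def\<close>)

lemma orthogonal_projection_norm_le:
  fixes Q :: "'a::real_inner \<Rightarrow> 'a"
  assumes Qsym: "\<And>x y. Q x \<bullet> y = x \<bullet> Q y" and QQ: "\<And>x. Q (Q x) = Q x"
  shows "norm (Q y) \<le> norm y"
proof -
  have "(norm (Q y))\<^sup>2 = y \<bullet> Q y" by (simp add: power2_norm_eq_inner Qsym QQ)
  also have "\<dots> \<le> norm y * norm (Q y)" by (rule norm_cauchy_schwarz)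
  finally show ?thesis by (cases "Q y = 0") (auto simp: power2_eq_square)
qed

text \<open>Pairing \<open>S x\<close> with itself moves \<open>S\<close> over to its adjoint
  \<open>T\<close>. The lemma serves to exchange the order of \<open>f\<close> and a projection in
  norm bounds.\<close>

lemma norm_adjoint_le:
  fixes S T :: "'a::real_inner \<Rightarrow> 'a"
  assumes adj: "\<And>x y. S x \<bullet> y = x \<bullet> T y" and T: "\<And>x. norm (T x) \<le> C * norm x"
  shows "norm (S x) \<le> C * norm x"
proof (cases "S x = 0")
  case True
  then show ?thesis using order_trans[OF norm_ge_zero T[of x]] by simp
next
  case False
  have "(norm (S x))\<^sup>2 = x \<bullet> T (S x)" by (simp add: power2_norm_eq_inner adj)
  also have "\<dots> \<le> norm x * norm (T (S x))" by (rule norm_cauchy_schwarz)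
  also have "\<dots> \<le> norm x * (C * norm (S x))" using T by (intro mult_left_mono) auto
  finally have "norm (S x) * norm (S x) \<le> (C * norm x) * norm (S x)" by (simp add: power2_eq_square mult_ac)
  then show ?thesis by (rule mult_right_le_imp_le) (use False in simp)
qed

text \<open>The power scheme: passing from \<open>f\<^sup>k\<close> back to \<open>f\<close> takes the \<open>k\<close>-th root of the constant.\<close>

lemma projected_power_bound:
  fixes f Q :: "'a::real_inner \<Rightarrow> 'a"
  assumes sym: "\<And>x y. f x \<bullet> y = x \<bullet> f y" and Qsym: "\<And>x y. Q x \<bullet> y = x \<bullet> Q y"
    and Qle: "\<And>x. norm (Q x) \<le> norm x"
    and bd: "\<And>x. norm (Q ((f ^^ Suc j) x)) \<le> L ^ Suc j * norm x" and L: "0 \<le> L"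
  shows "norm (f (Q x)) \<le> L * norm x"
proof -
  \<comment> \<open>The hypothesis has \<open>Q\<close> after the power. Passing to the adjoint puts
    \<open>Q\<close> first, so that log-convexity can be used at the vector
    \<open>Q x\<close>.\<close>
  have "norm ((f ^^ Suc j) (Q x)) \<le> L ^ Suc j * norm x"
    using norm_adjoint_le[of "\<lambda>x. (f ^^ Suc j) (Q x)" "\<lambda>x. Q ((f ^^ Suc j) x)"] bd
    by (metis selfadjoint_funpow[of f] sym Qsym)
  then have "norm ((f ^^ Suc j) (Q x)) * norm (Q x) ^ j \<le> (L ^ Suc j * norm x) * norm x ^ j"
    using Qle L by (intro mult_mono power_mono) auto
  with selfadjoint_norm_power_le[of f "Q x" j] sym
  have "norm (f (Q x)) ^ Suc j \<le> (L ^ Suc j * norm x) * norm x ^ j" by fastforce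
  also have "\<dots> = (L * norm x) ^ Suc j" by (simp add: power_mult_distrib mult_ac)
  finally show ?thesis by (rule power_le_imp_le_base) (use L in simp)
qed

text \<open>The spectrum of \<open>T\<close> lies in [0, L], hence that of \<open>c - T\<close> in
  [c - L, c], where the modulus is at most \<open>L\<close>. Expanding squares makes the same
  argument in any inner product space.\<close>

lemma psd_shift_bound:
  fixes T :: "'a::real_inner \<Rightarrow> 'a"
  assumes lin: "linear T" and sym: "\<And>x y. T x \<bullet> y = x \<bullet> T y" and psd: "\<And>x. 0 \<le> x \<bullet> T x"
    and T: "\<And>x. norm (T x) \<le> L * norm x" and c: "0 < c" "c \<le> L"
  shows "norm (c *\<^sub>R x - T x) \<le> L * norm x"
proof -
  interpret linear T by fact
  have L: "L > 0" using c by simp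
  have "T x \<bullet> T (T x) \<le> norm (T x) * (L * norm (T x))"
    using norm_cauchy_schwarz[of "T x" "T (T x)"] T[of "T x"] by (meson mult_left_mono norm_ge_zero order_trans)
  then have a: "T x \<bullet> T (T x) \<le> L * (norm (T x))\<^sup>2" by (simp add: power2_eq_square mult_ac)
  \<comment> \<open>Positivity at this point yields
    \<open>norm (T x) ^ 2 <= L * (x \<bullet> T x)\<close>, which is the operator inequality
    \<open>T^2 <= L T\<close>.\<close>
  have "0 \<le> (x - (1 / L) *\<^sub>R T x) \<bullet> T (x - (1 / L) *\<^sub>R T x)" by (rule psd)
  also have "\<dots> = x \<bullet> T x - 2 / L * (norm (T x))\<^sup>2 + (1 / L)\<^sup>2 * (T x \<bullet> T (T x))"
    using sym[of x "T x"] power2_norm_eq_inner[of "T x"]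
    by (simp add: diff scaleR inner_diff_left inner_diff_right power2_norm_eq_inner power2_eq_square algebra_simps)
  also have "\<dots> \<le> x \<bullet> T x - 2 / L * (norm (T x))\<^sup>2 + (1 / L)\<^sup>2 * (L * (norm (T x))\<^sup>2)"
    using a by (intro add_left_mono mult_left_mono) auto
  also have "\<dots> = x \<bullet> T x - (norm (T x))\<^sup>2 / L" using L by (simp add: power2_eq_square field_simps)
  finally have b: "(norm (T x))\<^sup>2 / L \<le> x \<bullet> T x" by simp
  have Tx2: "(norm (T x))\<^sup>2 \<le> L\<^sup>2 * (norm x)\<^sup>2"
    using power_mono[OF T[of x] norm_ge_zero, of 2] by (simp add: power_mult_distrib)
  have "(norm (c *\<^sub>R x - T x))\<^sup>2 = c\<^sup>2 * (norm x)\<^sup>2 - 2 * c * (x \<bullet> T x) + (norm (T x))\<^sup>2"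
    unfolding power2_norm_eq_inner
    by (simp add: inner_diff_left inner_diff_right power2_eq_square inner_commute)
  also have "\<dots> \<le> c\<^sup>2 * (norm x)\<^sup>2 - 2 * c * ((norm (T x))\<^sup>2 / L) + (norm (T x))\<^sup>2"
    using mult_left_mono[OF b, of "2 * c"] c by simp
  also have "\<dots> = c\<^sup>2 * (norm x)\<^sup>2 + (1 - 2 * c / L) * (norm (T x))\<^sup>2" by (simp add: algebra_simps)
  also have "\<dots> \<le> L\<^sup>2 * (norm x)\<^sup>2"
  \<comment> \<open>The sign of the coefficient of \<open>norm (T x) ^ 2\<close> decides: inserting
    the bound for \<open>norm (T x)\<close> leaves the factor \<open>(L - c) ^ 2\<close>, discarding
    the term leaves \<open>c ^ 2\<close>.\<close>
  proof (cases "2 * c \<le> L")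
    case True
    then have "(1 - 2 * c / L) * (norm (T x))\<^sup>2 \<le> (1 - 2 * c / L) * (L\<^sup>2 * (norm x)\<^sup>2)"
      using Tx2 L by (intro mult_left_mono) auto
    then have "c\<^sup>2 * (norm x)\<^sup>2 + (1 - 2 * c / L) * (norm (T x))\<^sup>2 \<le> (c\<^sup>2 + L\<^sup>2 - 2 * c * L) * (norm x)\<^sup>2"
      using L by (simp add: algebra_simps power2_eq_square)
    also have "\<dots> \<le> L\<^sup>2 * (norm x)\<^sup>2"
      using c L by (intro mult_right_mono) (auto simp: power2_eq_square)
    finally show ?thesis .
  next
    case False
    then have "(1 - 2 * c / L) * (norm (T x))\<^sup>2 \<le> 0" using L by (intro mult_nonpos_nonneg) (auto simp: field_simps)
    moreover have "c\<^sup>2 * (norm x)\<^sup>2 \<le> L\<^sup>2 * (norm x)\<^sup>2" using c by (intro mult_right_mono power_mono) auto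
    ultimately show ?thesis by linarith
  qed
  finally have "(norm (c *\<^sub>R x - T x))\<^sup>2 \<le> (L * norm x)\<^sup>2" by (simp add: power_mult_distrib)
  then show ?thesis using L by (simp add: power2_le_iff_abs_le)
qed

text \<open>
  In block form with respect to the range of \<open>P\<close> and of \<open>Q\<close> the error has a vanishing \<open>PP\<close> block;
  its off-diagonal part and its \<open>QQ\<close> block are bounded by \<open>L\<close> each.
\<close>

lemma compression_error_bound:
  fixes f Q :: "'a::real_inner \<Rightarrow> 'a"
  assumes lin: "linear f" and sym: "\<And>x y. f x \<bullet> y = x \<bullet> f y" and psd: "\<And>x. 0 \<le> x \<bullet> f x"
    and Qlin: "linear Q" and Qsym: "\<And>x y. Q x \<bullet> y = x \<bullet> Q y" and QQ: "\<And>x. Q (Q x) = Q x"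
    and fQ: "\<And>x. norm (f (Q x)) \<le> L * norm x" and c: "0 < c" "c \<le> L"
    and p: "p = x - Q x"
  shows "norm ((f p - Q (f p)) + c *\<^sub>R Q x - f x) \<le> 2 * L * norm x"
proof -
  interpret f: linear f by fact
  interpret Q: linear Q by fact
  have L: "L > 0" using c by simp
  define r where "r = Q x"
  have x: "x = p + r" by (simp add: p r_def)
  have Qr: "Q r = r" and Qp: "Q p = 0" by (simp_all add: r_def p QQ Q.diff)
  have pr: "p \<bullet> r = 0" using Qsym[of p x] by (simp add: r_def Qp)
  have nx: "(norm x)\<^sup>2 = (norm p)\<^sup>2 + (norm r)\<^sup>2" unfolding x using pr by (intro norm_add_Pythagorean) (simp add: orthogonal_def)
  have Qle: "norm (Q y) \<le> norm y" for y using Qsym QQ by (rule orthogonal_projection_norm_le)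
  have P_le: "norm (y - Q y) \<le> norm y" for y
  proof -
    have "(norm (y - Q y))\<^sup>2 = (norm y)\<^sup>2 - (norm (Q y))\<^sup>2"
      unfolding power2_norm_eq_inner using Qsym[of y "Q y"]
      by (simp add: inner_diff_left inner_diff_right QQ inner_commute)
    then have "(norm (y - Q y))\<^sup>2 \<le> (norm y)\<^sup>2" by simp
    then show ?thesis by (rule power2_le_imp_le) simp
  qed
  have Qf: "norm (Q (f y)) \<le> L * norm y" for y
    using norm_adjoint_le[of "\<lambda>y. Q (f y)" "\<lambda>y. f (Q y)"] fQ by (metis sym Qsym)
  \<comment> \<open>The two off-diagonal blocks: \<open>u\<close> goes from the range of
    \<open>Q\<close> to that of \<open>P\<close>, \<open>w\<close> the other way. Their values are
    orthogonal and come from orthogonal parts of \<open>x\<close>, so by Pythagoras they cost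
    \<open>L\<close> together instead of \<open>L\<close> each.\<close>
  define u w where "u = f r - Q (f r)" and "w = Q (f p)"
  have Qu: "Q u = 0" and Qw: "Q w = w" by (simp_all add: u_def w_def Q.diff QQ)
  have uw: "u \<bullet> w = 0" using Qsym[of u w] by (simp add: Qu Qw)
  have "norm u \<le> L * norm r"
    unfolding u_def using P_le[of "f r"] fQ[of r] Qr by simp
  then have nu: "(norm u)\<^sup>2 \<le> L\<^sup>2 * (norm r)\<^sup>2"
    using power_mono[of "norm u" "L * norm r" 2] by (simp add: power_mult_distrib)
  have "norm w \<le> L * norm p" unfolding w_def by (rule Qf)
  then have nw: "(norm w)\<^sup>2 \<le> L\<^sup>2 * (norm p)\<^sup>2"
    using power_mono[of "norm w" "L * norm p" 2] by (simp add: power_mult_distrib)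
  have "(norm (u + w))\<^sup>2 = (norm u)\<^sup>2 + (norm w)\<^sup>2"
    using uw by (intro norm_add_Pythagorean) (simp add: orthogonal_def)
  also have "\<dots> \<le> (L * norm x)\<^sup>2" using nu nw by (simp add: power_mult_distrib nx distrib_left)
  finally have off: "norm (u + w) \<le> L * norm x" by (rule power2_le_imp_le) (use L in simp)
  \<comment> \<open>The \<open>QQ\<close> block of the error is \<open>c\<close> minus the
    compression of \<open>f\<close>, which is positive semidefinite of norm at most
    \<open>L\<close>.\<close>
  have "norm (c *\<^sub>R r - Q (f (Q r))) \<le> L * norm r"
  proof (rule psd_shift_bound)
    show "linear (\<lambda>a. Q (f (Q a)))"
      using linear_compose[OF linear_compose[OF Qlin lin] Qlin] by (simp add: comp_def)
    show "norm (Q (f (Q y))) \<le> L * norm y" for y using Qle fQ order_trans by blast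
    show "0 \<le> y \<bullet> Q (f (Q y))" for y using psd[of "Q y"] by (simp add: Qsym[symmetric])
  qed (use c in \<open>auto simp: sym Qsym\<close>)
  then have dia: "norm (c *\<^sub>R r - Q (f r)) \<le> L * norm r" by (simp add: Qr)
  have rx: "norm r \<le> norm x" unfolding r_def by (rule Qle)
  have "(f p - Q (f p)) + c *\<^sub>R Q x - f x = (c *\<^sub>R r - Q (f r)) - (u + w)"
    by (simp add: u_def w_def x f.add Q.add Qr Qp algebra_simps)
  then have "norm ((f p - Q (f p)) + c *\<^sub>R Q x - f x) \<le> norm (c *\<^sub>R r - Q (f r)) + norm (u + w)"
    by (metis norm_triangle_ineq4)
  also have "\<dots> \<le> L * norm r + L * norm x" using dia off by simp
  also have "\<dots> \<le> L * norm x + L * norm x" using rx L by simp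
  finally show ?thesis by simp
qed

section \<open>Error of the approximate Hessian for a given sketch\<close>

lemma orthonormal_expansion:
  fixes v :: "'d::finite \<Rightarrow> real^'d"
  assumes on: "\<And>i j. v i \<bullet> v j = (if i = j then 1 else 0)"
  shows "(\<Sum>i\<in>UNIV. (v i \<bullet> z) *\<^sub>R v i) = z" and "(norm z)\<^sup>2 = (\<Sum>i\<in>UNIV. (v i \<bullet> z)\<^sup>2)"
proof -
  define V where "V = (\<chi> i. v i)"
  have "V ** transpose V = mat 1"
    by (simp add: V_def matrix_matrix_mult_def transpose_def mat_def vec_eq_iff on[unfolded inner_vec_def, simplified])
  then have "transpose V ** V = mat 1" by (metis matrix_left_right_inverse)
  then have "transpose V *v (V *v z) = z" by (simp add: matrix_vector_mul_assoc)
  moreover have "V *v z = (\<chi> i. v i \<bullet> z)"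
    by (simp add: V_def matrix_vector_mult_def inner_vec_def vec_eq_iff)
  ultimately show e: "(\<Sum>i\<in>UNIV. (v i \<bullet> z) *\<^sub>R v i) = z"
    by (simp add: V_def matrix_vector_mult_def transpose_def vec_eq_iff mult.commute)
  have "(norm z)\<^sup>2 = z \<bullet> (\<Sum>i\<in>UNIV. (v i \<bullet> z) *\<^sub>R v i)" by (simp add: e power2_norm_eq_inner)
  then show "(norm z)\<^sup>2 = (\<Sum>i\<in>UNIV. (v i \<bullet> z)\<^sup>2)"
    by (simp add: inner_sum_right power2_eq_square inner_commute)
qed

lemma power_iterate_mult_vec:
  "power_iterate H W k *v c = (((*v) H) ^^ k) (W *v c)"
proof (induction k)
  case (Suc k)
  then show ?case by (simp add: matrix_vector_mul_assoc[symmetric])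
qed simp

text \<open>The assumption \<open>good\<close> lets some \<open>W *v c\<close> match the leading
  coordinates of any vector, with trailing coordinates larger by at most the factor
  \<open>a\<close>. Subtracting it removes the leading part of \<open>z\<close> and costs a factor
  \<open>1 + a\<close> in the trailing part, where \<open>H\<close> is at most the
  threshold.\<close>

lemma spectral_norm_approx_hessian_le:
  fixes H :: "real^'d^'d" and W U :: "real^('l::{finite,linorder})^'d" and v :: "'d \<Rightarrow> real^'d"
  assumes on: "\<And>i j. v i \<bullet> v j = (if i = j then 1 else 0)" and ev: "\<And>i. H *v v i = s i *\<^sub>R v i"
    and sym: "transpose H = H" and pos: "\<And>i. 0 \<le> s i"
    and tail: "\<And>j. j \<notin> I \<Longrightarrow> s j \<le> \<sigma>" and \<sigma>: "0 < \<sigma>"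
    and qr: "is_QR (power_iterate H W (2 * q + 1)) U R"
    and good: "\<And>y. \<exists>c. (\<forall>i\<in>I. v i \<bullet> (W *v c) = v i \<bullet> y) \<and>
        (\<Sum>j\<in>-I. (v j \<bullet> (W *v c))\<^sup>2) \<le> a\<^sup>2 * (\<Sum>i\<in>I. (v i \<bullet> y)\<^sup>2)"
    and a: "0 \<le> a" "1 + a \<le> (3 / 2) ^ (2 * q + 1)" and lam: "0 < lam" "lam \<le> \<sigma>"
  shows "spectral_norm (approx_hessian H U lam - H) \<le> 3 * \<sigma>"
proof -
  define f where "f = (*v) H"
  define Q where "Q x = x - (U ** transpose U) *v x" for x
  have UU: "transpose U ** U = mat 1" and Y: "power_iterate H W (2 * q + 1) = U ** R"
    using qr unfolding is_QR_def by auto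
  have fsym: "f x \<bullet> y = x \<bullet> f y" for x y
    unfolding f_def using dot_lmul_matrix[of x H y] sym transpose_matrix_vector[of H x] by simp
  have flin: "linear f" unfolding f_def by (rule matrix_vector_mul_linear)
  have Qlin: "linear Q" unfolding Q_def by (intro linear_compose_sub linear_ident matrix_vector_mul_linear)
  interpret f: linear f by fact
  interpret Q: linear Q by fact
  have PT: "transpose (U ** transpose U) = U ** transpose U" by (simp add: matrix_transpose_mul)
  have PP: "(U ** transpose U) ** (U ** transpose U) = U ** transpose U"
    by (metis UU matrix_mul_assoc matrix_mul_rid)
  have Qsym: "Q x \<bullet> y = x \<bullet> Q y" for x y
    unfolding Q_def using dot_lmul_matrix[of x "U ** transpose U" y] PT transpose_matrix_vector[of "U ** transpose U" x]
    by (simp add: inner_diff_left inner_diff_right)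
  have QQ: "Q (Q x) = Q x" for x
    unfolding Q_def by (simp add: matrix_vector_mult_diff_distrib matrix_vector_mul_assoc PP)
  have Qle: "norm (Q y) \<le> norm y" for y using Qsym QQ by (rule orthogonal_projection_norm_le)
  have comp: "v i \<bullet> (f ^^ k) x = s i ^ k * (v i \<bullet> x)" for i k x
  proof (induction k)
    case (Suc k)
    have "v i \<bullet> (f ^^ Suc k) x = f (v i) \<bullet> (f ^^ k) x" by (simp add: fsym)
    then show ?case by (simp add: f_def ev Suc.IH[unfolded f_def])
  qed simp
  have psd: "0 \<le> x \<bullet> f x" for x
  proof -
    have "x \<bullet> f x = (\<Sum>i\<in>UNIV. (v i \<bullet> x) *\<^sub>R v i) \<bullet> f x" by (simp add: orthonormal_expansion(1)[OF on])
    also have "\<dots> = (\<Sum>i\<in>UNIV. s i * (v i \<bullet> x)\<^sup>2)"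
      using comp[of _ 1] by (simp add: inner_sum_left power2_eq_square mult_ac)
    also have "\<dots> \<ge> 0" using pos by (intro sum_nonneg) auto
    finally show ?thesis .
  qed
  define k where "k = 2 * q + 1"
  define J where "J = -I"
  \<comment> \<open>The sketched range is contained in that of \<open>U\<close>, which
    \<open>Q\<close> annihilates, whatever the rank of \<open>R\<close>.\<close>
  have range0: "Q ((f ^^ k) (W *v c)) = 0" for c
  proof -
    have "(f ^^ k) (W *v c) = U *v (R *v c)"
      using power_iterate_mult_vec[of H W k c] Y by (simp add: f_def k_def matrix_vector_mul_assoc)
    moreover have "(U ** transpose U) *v (U *v z) = U *v z" for z
      by (metis UU matrix_mul_assoc matrix_mul_rid matrix_vector_mul_assoc)
    ultimately show ?thesis by (simp add: Q_def)
  qed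
  have bd: "norm (Q ((f ^^ k) z)) \<le> (3 / 2 * \<sigma>) ^ k * norm z" for z
  proof -
    obtain c where c: "\<And>i. i \<in> I \<Longrightarrow> v i \<bullet> (W *v c) = v i \<bullet> z"
      and c2: "(\<Sum>j\<in>J. (v j \<bullet> (W *v c))\<^sup>2) \<le> a\<^sup>2 * (\<Sum>i\<in>I. (v i \<bullet> z)\<^sup>2)" using good[of z] by (auto simp: J_def)
    define e where "e = z - W *v c"
    have fk: "linear (f ^^ k)" using flin by (rule linear_funpow)
    have "Q ((f ^^ k) z) = Q ((f ^^ k) e)"
      unfolding e_def by (simp add: linear_diff[OF fk] Q.diff range0)
    then have "norm (Q ((f ^^ k) z)) \<le> norm ((f ^^ k) e)" using Qle by metis
    also have "\<dots> \<le> \<sigma> ^ k * ((1 + a) * norm z)"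
    proof (rule power2_le_imp_le)
      have ez: "v i \<bullet> e = 0" if "i \<in> I" for i using c[OF that] by (simp add: e_def inner_diff_right)
      have "(norm ((f ^^ k) e))\<^sup>2 = (\<Sum>i\<in>UNIV. (s i ^ k * (v i \<bullet> e))\<^sup>2)"
        unfolding orthonormal_expansion(2)[OF on] comp ..
      also have "\<dots> = (\<Sum>i\<in>J. (s i ^ k * (v i \<bullet> e))\<^sup>2)"
        by (rule sum.mono_neutral_right) (auto simp: J_def ez)
      also have "\<dots> \<le> (\<Sum>i\<in>J. (\<sigma> ^ k)\<^sup>2 * (v i \<bullet> e)\<^sup>2)"
        unfolding power_mult_distrib using tail pos
        by (intro sum_mono mult_right_mono power_mono) (auto simp: J_def)
      also have "\<dots> = (\<sigma> ^ k * L2_set (\<lambda>i. v i \<bullet> e) J)\<^sup>2"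
        by (simp add: L2_set_def power_mult_distrib sum_distrib_left sum_nonneg)
      also have "\<dots> \<le> (\<sigma> ^ k * ((1 + a) * norm z))\<^sup>2"
      proof (intro power_mono mult_left_mono)
        have "L2_set (\<lambda>i. v i \<bullet> z - v i \<bullet> (W *v c)) J \<le> L2_set (\<lambda>i. v i \<bullet> z) J + L2_set (\<lambda>i. - (v i \<bullet> (W *v c))) J"
          using L2_set_triangle_ineq[of "\<lambda>i. v i \<bullet> z" "\<lambda>i. - (v i \<bullet> (W *v c))" J] by simp
        moreover have "L2_set (\<lambda>i. v i \<bullet> z) J \<le> norm z"
          unfolding L2_set_def using sum_mono2[of UNIV J "\<lambda>i. (v i \<bullet> z)\<^sup>2"]
          by (intro real_le_lsqrt) (auto simp: sum_nonneg orthonormal_expansion(2)[OF on, of z])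
        moreover have "L2_set (\<lambda>i. - (v i \<bullet> (W *v c))) J \<le> a * norm z"
        proof -
          have "(\<Sum>i\<in>I. (v i \<bullet> z)\<^sup>2) \<le> (norm z)\<^sup>2"
            unfolding orthonormal_expansion(2)[OF on, of z] by (rule sum_mono2) auto
          then have "(\<Sum>j\<in>J. (v j \<bullet> (W *v c))\<^sup>2) \<le> a\<^sup>2 * (norm z)\<^sup>2"
            using c2 by (meson mult_left_mono order_trans zero_le_power2)
          then show ?thesis unfolding L2_set_def
            using a by (intro real_le_lsqrt) (auto simp: sum_nonneg power_mult_distrib)
        qed
        ultimately show "L2_set (\<lambda>i. v i \<bullet> e) J \<le> (1 + a) * norm z"
          unfolding e_def inner_diff_right distrib_right by linarith
      qed (use \<sigma> in \<open>auto simp: L2_set_nonneg\<close>)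
      finally show "(norm ((f ^^ k) e))\<^sup>2 \<le> (\<sigma> ^ k * ((1 + a) * norm z))\<^sup>2" .
    qed (use \<sigma> a in auto)
    \<comment> \<open>The amplification is absorbed into a \<open>k\<close>-th power, to be undone
      by the \<open>k\<close>-th root.\<close>
    also have "\<dots> \<le> \<sigma> ^ k * ((3 / 2) ^ k * norm z)"
      using a \<sigma> by (intro mult_left_mono mult_right_mono) (auto simp: k_def)
    also have "\<dots> = (3 / 2 * \<sigma>) ^ k * norm z" by (simp add: power_mult_distrib power_divide)
    finally show ?thesis .
  qed
  have fQ: "norm (f (Q x)) \<le> (3 / 2 * \<sigma>) * norm x" for x
  proof (rule projected_power_bound[OF fsym Qsym Qle])
    show "norm (Q ((f ^^ Suc (2 * q)) x)) \<le> (3 / 2 * \<sigma>) ^ Suc (2 * q) * norm x" for x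
      using bd[of x] unfolding k_def by simp
  qed (use \<sigma> in auto)
  have "norm ((approx_hessian H U lam - H) *v x) \<le> 3 * \<sigma> * norm x" for x
  proof -
    define p where "p = x - Q x"
    have p: "p = (U ** transpose U) *v x" by (simp add: p_def Q_def)
    have "approx_hessian H U lam *v x = (U ** transpose U) *v f p + lam *\<^sub>R (x - p)"
      unfolding approx_hessian_def p f_def
      by (simp add: matrix_vector_mult_add_rdistrib matrix_vector_mult_diff_rdistrib
          scaleR_matrix_vector_assoc[symmetric] matrix_vector_mul_assoc[symmetric])
    also have "\<dots> = (f p - Q (f p)) + lam *\<^sub>R Q x" by (simp add: Q_def p)
    finally have eq: "(approx_hessian H U lam - H) *v x = (f p - Q (f p)) + lam *\<^sub>R Q x - f x"
      by (simp add: matrix_vector_mult_diff_rdistrib f_def)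
    \<comment> \<open>The block bound \<open>2 * L\<close> with \<open>L = 3 / 2 * \<sigma>\<close>
      produces the factor 3.\<close>
    have "norm ((f p - Q (f p)) + lam *\<^sub>R Q x - f x) \<le> 2 * (3 / 2 * \<sigma>) * norm x"
      by (rule compression_error_bound[OF flin fsym psd Qlin Qsym QQ fQ])
        (use lam \<sigma> in \<open>auto simp: p_def\<close>)
    then show ?thesis unfolding eq by simp
  qed
  then show ?thesis unfolding spectral_norm_def by (intro onorm_le)
qed

section \<open>Gaussian measures on Euclidean spaces\<close>

text \<open>The images \<open>h a\<close> are completed to an orthogonal basis, whose new members
  serve as images of the remaining coordinate vectors. Gaussian integrals over an orthonormal system
  are thereby reduced to coordinates.\<close>

lemma orthogonal_transformation_extending:
  fixes h :: "'a::euclidean_space \<Rightarrow> 'a"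
  assumes A: "A \<subseteq> Basis" and h: "\<And>a b. a \<in> A \<Longrightarrow> b \<in> A \<Longrightarrow> h a \<bullet> h b = (if a = b then 1 else 0)"
  obtains f where "orthogonal_transformation f" "\<And>a. a \<in> A \<Longrightarrow> f a = h a"
proof -
  define S where "S = h ` A"
  have finA: "finite A" using A finite_Basis finite_subset by blast
  have injh: "inj_on h A" using h by (intro inj_onI) (metis zero_neq_one)
  have S1: "x \<bullet> x = 1" if "x \<in> S" for x using that h by (auto simp: S_def)
  have "pairwise orthogonal S"
    using h by (auto simp: S_def pairwise_def orthogonal_def)
  then obtain U where U: "U \<inter> insert 0 S = {}" "pairwise orthogonal (S \<union> U)" "span (S \<union> U) = span (S \<union> UNIV)"
    by (rule orthogonal_extension_strong)
  have "0 \<notin> S \<union> U" using U(1) S1[of 0] by auto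
  then have ind: "independent (S \<union> U)" using U(2) pairwise_orthogonal_independent by blast
  then have finSU: "finite (S \<union> U)" by (rule independent_imp_finite)
  have "card (S \<union> U) = DIM('a)"
    using dim_eq_card_independent[OF ind] dim_span[of "S \<union> U"] U(3) by (simp add: dim_UNIV)
  then have "card S + card U = DIM('a)" using U(1) finSU by (subst card_Un_disjoint[symmetric]) auto
  moreover have "card S = card A" using injh by (simp add: S_def card_image)
  ultimately have "card (Basis - A) = card U" using A finA by (simp add: card_Diff_subset)
  then obtain g where g: "bij_betw g (Basis - A) U"
    using finSU finite_same_card_bij[of "Basis - A" U] by auto
  \<comment> \<open>The extension is orthogonal but not normalised, hence the division.\<close>
  define k where "k b = (if b \<in> A then h b else g b /\<^sub>R norm (g b))" for b
  have gU: "g b \<in> U" if "b \<in> Basis" "b \<notin> A" for b using g that by (auto simp: bij_betw_def)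
  have gn: "g b \<noteq> 0" if "b \<in> Basis" "b \<notin> A" for b using gU[OF that] U(1) by auto
  have orth: "x \<in> S \<union> U \<Longrightarrow> y \<in> S \<union> U \<Longrightarrow> x \<noteq> y \<Longrightarrow> x \<bullet> y = 0" for x y
    using U(2) unfolding pairwise_def orthogonal_def by blast
  have hS: "b \<in> A \<Longrightarrow> h b \<in> S" for b by (simp add: S_def)
  have SU: "x \<in> S \<Longrightarrow> y \<in> U \<Longrightarrow> x \<noteq> y" for x y using U(1) by blast
  have k: "k a \<bullet> k b = (if a = b then 1 else 0)" if ab: "a \<in> Basis" "b \<in> Basis" for a b
  proof (cases "a = b")
    case True
    then show ?thesis
    proof (cases "b \<in> A")
      case True
      then show ?thesis using h \<open>a = b\<close> by (simp add: k_def)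
    next
      case False
      then show ?thesis using gn[OF ab(2)] ab \<open>a = b\<close> by (simp add: k_def dot_square_norm power2_eq_square)
    qed
  next
    case False
    have "a \<notin> A \<Longrightarrow> b \<notin> A \<Longrightarrow> g a \<noteq> g b"
      using False g ab by (auto simp: bij_betw_def dest: inj_onD)
    moreover have "a \<in> A \<Longrightarrow> b \<notin> A \<Longrightarrow> h a \<noteq> g b" "a \<notin> A \<Longrightarrow> b \<in> A \<Longrightarrow> g a \<noteq> h b"
      using SU[OF hS gU[OF ab(2)]] SU[OF hS gU[OF ab(1)], symmetric] by auto
    ultimately show ?thesis using False h[of a b] gU[OF ab(1)] gU[OF ab(2)] hS
      by (auto simp: k_def orth)
  qed
  define f where "f x = (\<Sum>b\<in>Basis. (x \<bullet> b) *\<^sub>R k b)" for x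
  have "linear f"
    unfolding f_def by (intro linearI) (simp_all add: inner_add_left scaleR_add_left sum.distrib scaleR_sum_right)
  moreover have "f x \<bullet> f y = x \<bullet> y" for x y
  proof -
    have "f x \<bullet> f y = (\<Sum>a\<in>Basis. \<Sum>b\<in>Basis. (x \<bullet> a) * (y \<bullet> b) * (k a \<bullet> k b))"
      unfolding f_def inner_sum_left inner_sum_right by (subst sum.swap) (simp add: mult_ac)
    also have "\<dots> = (\<Sum>a\<in>Basis. \<Sum>b\<in>Basis. if a = b then (x \<bullet> a) * (y \<bullet> b) else 0)"
      by (intro sum.cong refl) (auto simp: k)
    also have "\<dots> = x \<bullet> y" by (simp add: euclidean_inner[of x y])
    finally show ?thesis .
  qed
  ultimately have "orthogonal_transformation f" by (simp add: orthogonal_transformation_def)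
  moreover have "f a = h a" if "a \<in> A" for a
  proof -
    have "f a = (\<Sum>b\<in>Basis. if b = a then k b else 0)"
      unfolding f_def using that A by (intro sum.cong refl) (auto simp: inner_Basis)
    then show ?thesis using that A by (auto simp: k_def)
  qed
  ultimately show ?thesis using that by blast
qed

lemma borel_measurable_linear:
  fixes f :: "'a::euclidean_space \<Rightarrow> 'b::euclidean_space"
  shows "linear f \<Longrightarrow> f \<in> borel_measurable borel"
  by (intro borel_measurable_continuous_onI linear_continuous_on linear_conv_bounded_linear[THEN iffD1])

text \<open>
  Both measures are translation invariant; comparing the two iterated integrals of
  \<open>1\<^sub>b\<^sub>a\<^sub>l\<^sub>l(x) 1\<^sub>B(x + y)\<close> shows that they are proportional, and they agree on the unit ball.
\<close>

lemma lborel_distr_orthogonal: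
  fixes f :: "'a::euclidean_space \<Rightarrow> 'a"
  assumes f: "orthogonal_transformation f"
  shows "distr lborel borel f = lborel"
proof -
  define \<mu> where "\<mu> = distr lborel borel f"
  have lin: "linear f" using f by (rule orthogonal_transformation_linear)
  have [measurable]: "f \<in> borel_measurable borel"
    using lin by (rule borel_measurable_linear)
  have [simp, measurable_cong]: "sets \<mu> = sets borel" by (simp add: \<mu>_def)
  have ballf: "f -` ball 0 r = ball 0 r" for r
    using orthogonal_transformation_norm[OF f] by auto
  have \<mu>ball: "emeasure \<mu> (ball 0 r) = emeasure lborel (ball 0 r :: 'a set)" for r
    unfolding \<mu>_def by (subst emeasure_distr) (auto simp: ballf)
  have ballfin: "emeasure lborel (ball x r :: 'a set) < \<infinity>" for x :: 'a and r
    by (rule emeasure_bounded_finite) simp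
  \<comment> \<open>Needed for Fubini; the balls around 0 are invariant under \<open>f\<close> and
    exhaust the space.\<close>
  interpret \<mu>: sigma_finite_measure \<mu>
  proof
    show "\<exists>A. countable A \<and> A \<subseteq> sets \<mu> \<and> \<Union>A = space \<mu> \<and> (\<forall>a\<in>A. emeasure \<mu> a \<noteq> \<infinity>)"
    proof (intro exI[of _ "range (\<lambda>n. ball 0 (real n))"] conjI)
      show "\<Union>(range (\<lambda>n. ball (0::'a) (real n))) = space \<mu>"
        using reals_Archimedean2 by (auto simp: \<mu>_def)
      show "\<forall>a\<in>range (\<lambda>n. ball (0::'a) (real n)). emeasure \<mu> a \<noteq> \<infinity>"
        using ballfin by (auto simp: \<mu>ball less_top[symmetric])
    qed auto
  qed
  interpret pair_sigma_finite \<mu> "lborel :: 'a measure" by standard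
  have trans: "(\<integral>\<^sup>+x. g (x + y) \<partial>\<mu>) = (\<integral>\<^sup>+x. g x \<partial>\<mu>)" if [measurable]: "g \<in> borel_measurable borel" for g :: "'a \<Rightarrow> ennreal" and y
  proof -
    \<comment> \<open>A shift by \<open>y\<close> after \<open>f\<close> is a shift by a preimage of
      \<open>y\<close> before it.\<close>
    obtain z where z: "f z = y" using orthogonal_transformation_surj[OF f] by (metis surjD)
    have "(\<integral>\<^sup>+x. g (x + y) \<partial>\<mu>) = (\<integral>\<^sup>+x. g (f (z + x)) \<partial>lborel)"
      unfolding \<mu>_def by (subst nn_integral_distr) (auto simp: linear_add[OF lin] z add.commute)
    also have "\<dots> = (\<integral>\<^sup>+x. g (f x) \<partial>distr lborel borel ((+) z))"
      by (subst nn_integral_distr) auto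
    also have "\<dots> = (\<integral>\<^sup>+x. g x \<partial>\<mu>)"
      unfolding lborel_distr_plus \<mu>_def by (subst nn_integral_distr) auto
    finally show ?thesis .
  qed
  have ltrans: "(\<integral>\<^sup>+y. g (x + y) \<partial>lborel) = (\<integral>\<^sup>+y. g y \<partial>lborel)" if [measurable]: "g \<in> borel_measurable borel" for g :: "'a \<Rightarrow> ennreal" and x
    using nn_integral_distr[of "(+) x" lborel borel g] by (simp add: lborel_distr_plus)
  let ?A = "ball 0 1 :: 'a set"
  have [measurable]: "?A \<in> sets borel" by simp
  have meas: "g \<in> borel_measurable (borel \<Otimes>\<^sub>M borel) \<Longrightarrow> g \<in> borel_measurable (\<mu> \<Otimes>\<^sub>M lborel)"
    for g :: "'a \<times> 'a \<Rightarrow> ennreal"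
    by (subst measurable_cong_sets[OF sets_pair_measure_cong refl]) auto
  have "\<mu> = lborel"
  proof (rule measure_eqI)
    fix B assume "B \<in> sets \<mu>"
    then have B[measurable]: "B \<in> sets borel" by simp
    have "emeasure \<mu> ?A * emeasure lborel B = (\<integral>\<^sup>+x. indicator ?A x * emeasure lborel B \<partial>\<mu>)"
      by (subst nn_integral_multc) (auto intro!: borel_measurable_indicator)
    also have "\<dots> = (\<integral>\<^sup>+x. (\<integral>\<^sup>+y. indicator ?A x * indicator B (x + y) \<partial>lborel) \<partial>\<mu>)"
      by (intro nn_integral_cong) (simp add: nn_integral_cmult ltrans[of "indicator B"])
    also have "\<dots> = (\<integral>\<^sup>+y. (\<integral>\<^sup>+x. indicator ?A x * indicator B (x + y) \<partial>\<mu>) \<partial>lborel)"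
      by (rule Fubini'[symmetric], rule meas) measurable
    \<comment> \<open>Translation invariance moves the shift by \<open>y\<close> from
      \<open>B\<close> to the ball.\<close>
    also have "\<dots> = (\<integral>\<^sup>+y. (\<integral>\<^sup>+x. indicator ?A (x - y) * indicator B x \<partial>\<mu>) \<partial>lborel)"
    proof (rule nn_integral_cong)
      fix y :: 'a
      show "(\<integral>\<^sup>+x. indicator ?A x * indicator B (x + y) \<partial>\<mu>) = (\<integral>\<^sup>+x. indicator ?A (x - y) * indicator B x \<partial>\<mu>)"
        using trans[of "\<lambda>x. indicator ?A (x - y) * indicator B x" y] by simp
    qed
    also have "\<dots> = (\<integral>\<^sup>+x. (\<integral>\<^sup>+y. indicator ?A (x - y) * indicator B x \<partial>lborel) \<partial>\<mu>)"
      by (rule Fubini', rule meas) measurable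
    also have "\<dots> = (\<integral>\<^sup>+x. emeasure lborel ?A * indicator B x \<partial>\<mu>)"
    proof (intro nn_integral_cong)
      fix x
      have "(\<integral>\<^sup>+y. indicator ?A (x - y) \<partial>lborel) = (\<integral>\<^sup>+y. indicator ?A y \<partial>lborel)"
        using ltrans[of "\<lambda>y. indicator ?A (x - y)" x]
        by (simp add: indicator_def)
      then show "(\<integral>\<^sup>+y. indicator ?A (x - y) * indicator B x \<partial>lborel) = emeasure lborel ?A * indicator B x"
        by (simp add: nn_integral_multc)
    qed
    also have "\<dots> = emeasure lborel ?A * emeasure \<mu> B" by (simp add: nn_integral_cmult)
    finally have eq: "emeasure lborel ?A * emeasure lborel B = emeasure lborel ?A * emeasure \<mu> B"
      by (simp add: \<mu>ball)
    \<comment> \<open>Positive and finite, the measure of the ball can be cancelled.\<close>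
    have "emeasure lborel ?A > 0" by (subst emeasure_ball) (auto simp: unit_ball_vol_pos)
    then show "emeasure \<mu> B = emeasure lborel B"
      using eq ballfin[of 0 1] by (auto simp: ennreal_mult_cancel_left)
  qed simp
  then show ?thesis by (simp add: \<mu>_def)
qed

text \<open>The standard normal law. It serves rows and whole matrices alike, because
  \<open>real^'l^'d\<close> is a Euclidean space under the entrywise inner product.\<close>

definition gaussian :: "'a::euclidean_space measure" where
  "gaussian = density lborel (\<lambda>x. ennreal (\<Prod>b\<in>Basis. std_normal_density (x \<bullet> b)))"

lemma sets_gaussian [simp, measurable_cong]: "sets gaussian = sets borel"
  and space_gaussian [simp]: "space gaussian = UNIV"
  by (simp_all add: gaussian_def)

lemma nn_integral_gaussian:
  fixes g :: "'a::euclidean_space \<Rightarrow> ennreal"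
  assumes [measurable]: "g \<in> borel_measurable borel"
  shows "(\<integral>\<^sup>+x. g x \<partial>gaussian) = (\<integral>\<^sup>+x. (\<Prod>b\<in>Basis. ennreal (std_normal_density (x \<bullet> b))) * g x \<partial>lborel)"
  unfolding gaussian_def by (subst nn_integral_density) (auto simp: prod_ennreal)

text \<open>In this form the density visibly depends on the norm alone, which is the source of
  rotation invariance.\<close>

lemma gaussian_density_radial:
  "(\<Prod>b\<in>Basis. std_normal_density (x \<bullet> b)) = (1 / sqrt (2 * pi)) ^ DIM('a) * exp (- (norm x)\<^sup>2 / 2)"
  for x :: "'a::euclidean_space"
proof -
  have "(norm x)\<^sup>2 = (\<Sum>b\<in>Basis. (x \<bullet> b)\<^sup>2)"
    unfolding power2_norm_eq_inner euclidean_inner[of x x] by (simp add: power2_eq_square)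
  then have "exp (- (norm x)\<^sup>2 / 2) = (\<Prod>b\<in>Basis. exp (- (x \<bullet> b)\<^sup>2 / 2))"
    by (simp add: exp_sum[symmetric] sum_negf sum_divide_distrib)
  then show ?thesis
    unfolding std_normal_density_def prod.distrib by simp
qed

lemma distr_gaussian_orthogonal:
  fixes f :: "'a::euclidean_space \<Rightarrow> 'a"
  assumes f: "orthogonal_transformation f"
  shows "distr gaussian borel f = gaussian"
proof (rule measure_eqI)
  have lin: "linear f" using f by (rule orthogonal_transformation_linear)
  have [measurable]: "f \<in> borel_measurable borel"
    using lin by (rule borel_measurable_linear)
  let ?g = "\<lambda>x::'a. ennreal (\<Prod>b\<in>Basis. std_normal_density (x \<bullet> b))"
  have gf: "?g (f x) = ?g x" for x
    unfolding gaussian_density_radial orthogonal_transformation_norm[OF f] ..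
  fix B assume "B \<in> sets (distr gaussian borel f)"
  then have [measurable]: "B \<in> sets borel" by simp
  have "emeasure (distr gaussian borel f) B = (\<integral>\<^sup>+x. indicator B (f x) \<partial>gaussian)"
    using nn_integral_distr[of f gaussian borel "indicator B"] by simp
  also have "\<dots> = (\<integral>\<^sup>+x. ?g (f x) * indicator B (f x) \<partial>lborel)"
    unfolding gaussian_def by (subst nn_integral_density) (auto simp: gf)
  also have "\<dots> = (\<integral>\<^sup>+x. ?g x * indicator B x \<partial>distr lborel borel f)"
    by (subst nn_integral_distr) auto
  also have "\<dots> = emeasure gaussian B"
    unfolding lborel_distr_orthogonal[OF f] gaussian_def by (subst emeasure_density) auto
  finally show "emeasure (distr gaussian borel f) B = emeasure gaussian B" .
qed simp

lemma nn_integral_gaussian_orthogonal: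
  fixes f :: "'a::euclidean_space \<Rightarrow> 'a"
  assumes f: "orthogonal_transformation f" and [measurable]: "g \<in> borel_measurable borel"
  shows "(\<integral>\<^sup>+x. g (f x) \<partial>gaussian) = (\<integral>\<^sup>+x. g x \<partial>gaussian)"
proof -
  have "linear f" using f by (rule orthogonal_transformation_linear)
  then have [measurable]: "f \<in> borel_measurable borel"
    by (rule borel_measurable_linear)
  show ?thesis
    by (subst (2) distr_gaussian_orthogonal[OF f, symmetric]) (simp add: nn_integral_distr)
qed

lemma prob_space_std_normal_distribution: "prob_space std_normal_distribution"
  by (rule prob_space_normal_density) simp

lemma distr_gaussian_coordinates:
  "distr gaussian (\<Pi>\<^sub>M b\<in>Basis. borel) (\<lambda>x::'a::euclidean_space. \<lambda>b\<in>Basis. x \<bullet> b)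
    = (\<Pi>\<^sub>M b\<in>Basis. std_normal_distribution)"
proof -
  interpret product_prob_space "\<lambda>_::'a. std_normal_distribution" Basis
    by (intro product_prob_spaceI prob_space_std_normal_distribution)
  show ?thesis
  proof (rule PiM_eqI)
    show "sets (distr gaussian (\<Pi>\<^sub>M b\<in>Basis. borel) (\<lambda>x::'a. \<lambda>b\<in>Basis. x \<bullet> b)) = sets (\<Pi>\<^sub>M b\<in>Basis. std_normal_distribution)"
      by (simp cong: sets_PiM_cong)
    fix A :: "'a \<Rightarrow> real set" assume A: "\<And>b. b \<in> Basis \<Longrightarrow> A b \<in> sets std_normal_distribution"
    then have A'[measurable]: "b \<in> Basis \<Longrightarrow> A b \<in> sets borel" for b by simp
    have "emeasure (distr gaussian (\<Pi>\<^sub>M b\<in>Basis. borel) (\<lambda>x::'a. \<lambda>b\<in>Basis. x \<bullet> b)) (Pi\<^sub>E Basis A)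
        = emeasure gaussian {x::'a. \<forall>b\<in>Basis. x \<bullet> b \<in> A b}"
      by (subst emeasure_distr) (auto intro!: arg_cong2[where f=emeasure] sets_PiM_I_finite)
    also have "\<dots> = (\<integral>\<^sup>+x. (\<Prod>b\<in>Basis. ennreal (std_normal_density (x \<bullet> b)) * indicator (A b) (x \<bullet> b)) \<partial>lborel)"
    proof -
      have "emeasure gaussian {x::'a. \<forall>b\<in>Basis. x \<bullet> b \<in> A b} = (\<integral>\<^sup>+x. (\<Prod>b\<in>Basis. indicator (A b) (x \<bullet> b)) \<partial>gaussian)"
      proof (subst nn_integral_indicator[symmetric])
        show "(\<integral>\<^sup>+x. indicator {x. \<forall>b\<in>Basis. x \<bullet> b \<in> A b} x \<partial>gaussian) = (\<integral>\<^sup>+x. (\<Prod>b\<in>Basis. indicator (A b) (x \<bullet> b)) \<partial>gaussian)"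
          by (intro nn_integral_cong) (auto simp: indicator_def prod_eq_1_iff)
      qed simp
      then show ?thesis by (subst (asm) nn_integral_gaussian) (auto simp: prod.distrib)
    qed
    also have "\<dots> = (\<Prod>b\<in>Basis. emeasure std_normal_distribution (A b))"
      by (subst nn_integral_lborel_prod) (auto intro!: prod.cong simp: emeasure_density)
    finally show "emeasure (distr gaussian (\<Pi>\<^sub>M b\<in>Basis. borel) (\<lambda>x::'a. \<lambda>b\<in>Basis. x \<bullet> b)) (Pi\<^sub>E Basis A)
        = (\<Prod>b\<in>Basis. emeasure std_normal_distribution (A b))" .
  qed simp
qed

lemma gaussian_eq_distr_PiM:
  "gaussian = distr (\<Pi>\<^sub>M b\<in>Basis. std_normal_distribution) borel (\<lambda>x. \<Sum>b\<in>Basis. x b *\<^sub>R (b::'a::euclidean_space))"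
proof -
  have "distr (distr gaussian (\<Pi>\<^sub>M b\<in>Basis. borel) (\<lambda>x::'a. \<lambda>b\<in>Basis. x \<bullet> b)) borel (\<lambda>x. \<Sum>b\<in>Basis. x b *\<^sub>R (b::'a))
      = distr gaussian borel (\<lambda>x. x)"
    by (subst distr_distr) (auto intro!: distr_cong simp: comp_def euclidean_representation)
  also have "\<dots> = gaussian" by (rule distr_id2) simp
  finally show ?thesis unfolding distr_gaussian_coordinates by simp
qed

text \<open>Links the entrywise description in \<open>std_gaussian_matrix\<close> with the rotation
  invariant law: a vector and its coordinate tuple determine each other measurably, and independence
  means that the joint law is the product.\<close>

lemma (in prob_space) distr_eq_gaussian_iff:
  fixes X :: "'a \<Rightarrow> 'b::euclidean_space"
  assumes X[measurable]: "random_variable borel X"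
  shows "distr M borel X = gaussian \<longleftrightarrow>
    indep_vars (\<lambda>_. borel) (\<lambda>b \<omega>. X \<omega> \<bullet> b) Basis \<and>
    (\<forall>b\<in>Basis. distr M borel (\<lambda>\<omega>. X \<omega> \<bullet> b) = std_normal_distribution)"
proof -
  let ?P = "\<Pi>\<^sub>M b\<in>(Basis::'b set). std_normal_distribution"
  let ?D = "distr M (\<Pi>\<^sub>M b\<in>Basis. borel) (\<lambda>\<omega>. \<lambda>b\<in>Basis. X \<omega> \<bullet> b)"
  have ind: "indep_vars (\<lambda>_. borel) (\<lambda>b \<omega>. X \<omega> \<bullet> b) Basis \<longleftrightarrow>
      ?D = (\<Pi>\<^sub>M b\<in>Basis. distr M borel (\<lambda>\<omega>. X \<omega> \<bullet> b))"
    by (rule indep_vars_iff_distr_eq_PiM') auto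
  show ?thesis
  proof (intro iffI conjI)
    assume g: "distr M borel X = gaussian"
    have "?D = distr (distr M borel X) (\<Pi>\<^sub>M b\<in>Basis. borel) (\<lambda>x. \<lambda>b\<in>Basis. x \<bullet> b)"
      by (subst distr_distr) (auto simp: comp_def)
    also have "\<dots> = ?P" unfolding g by (rule distr_gaussian_coordinates)
    finally have D: "?D = ?P" .
    have marg: "distr M borel (\<lambda>\<omega>. X \<omega> \<bullet> b) = std_normal_distribution" if b: "b \<in> Basis" for b
    proof -
      have "distr M borel (\<lambda>\<omega>. X \<omega> \<bullet> b) = distr ?D borel (\<lambda>x. x b)"
        using b by (subst distr_distr) (auto simp: comp_def)
      also have "\<dots> = distr ?P std_normal_distribution (\<lambda>x. x b)" unfolding D by (rule distr_cong) auto
      also have "\<dots> = std_normal_distribution"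
        using b by (intro distr_PiM_component prob_space_std_normal_distribution)
      finally show ?thesis .
    qed
    then show "\<forall>b\<in>Basis. distr M borel (\<lambda>\<omega>. X \<omega> \<bullet> b) = std_normal_distribution" ..
    show "indep_vars (\<lambda>_. borel) (\<lambda>b \<omega>. X \<omega> \<bullet> b) Basis"
      unfolding ind D using marg by (intro PiM_cong) auto
  next
    assume a: "indep_vars (\<lambda>_. borel) (\<lambda>b \<omega>. X \<omega> \<bullet> b) Basis \<and>
      (\<forall>b\<in>Basis. distr M borel (\<lambda>\<omega>. X \<omega> \<bullet> b) = std_normal_distribution)"
    then have "?D = (\<Pi>\<^sub>M b\<in>Basis. distr M borel (\<lambda>\<omega>. X \<omega> \<bullet> b))" unfolding ind by blast
    also have "\<dots> = ?P" using a by (intro PiM_cong) auto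
    finally have D: "?D = ?P" .
    have "distr M borel X = distr ?D borel (\<lambda>x. \<Sum>b\<in>Basis. x b *\<^sub>R b)"
      by (subst distr_distr) (auto intro!: distr_cong simp: comp_def euclidean_representation)
    also have "\<dots> = gaussian" unfolding D by (rule gaussian_eq_distr_PiM[symmetric])
    finally show "distr M borel X = gaussian" .
  qed
qed

lemma prob_space_gaussian: "prob_space (gaussian :: 'a::euclidean_space measure)"
  unfolding gaussian_eq_distr_PiM
  by (intro prob_space.prob_space_distr prob_space_PiM prob_space_std_normal_distribution) measurable

section \<open>Moments of Gaussian vectors\<close>

text \<open>The tilted density is a multiple of the normal density of deviation
  \<open>1 / sqrt (1 + t)\<close>. Negative \<open>t\<close> will give the positive chi moments,
  nonnegative \<open>t\<close> the negative ones.\<close>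

lemma nn_integral_std_normal_exp_square:
  assumes t: "t > -1"
  shows "(\<integral>\<^sup>+x. ennreal (std_normal_density x) * ennreal (exp (- (t / 2) * x\<^sup>2)) \<partial>lborel) = ennreal (1 / sqrt (1 + t))"
proof -
  let ?s = "1 / sqrt (1 + t)"
  have s: "?s > 0" using t by simp
  have eq: "std_normal_density x * exp (- (t / 2) * x\<^sup>2) = ?s * normal_density 0 ?s x" for x
  proof -
    have "exp (- x\<^sup>2 / 2) * exp (- (t / 2) * x\<^sup>2) = exp (- ((1 + t) * x\<^sup>2 / 2))"
      by (simp add: exp_add[symmetric] algebra_simps add_divide_distrib)
    moreover have "sqrt (2 * pi * ?s\<^sup>2) = sqrt (2 * pi) * ?s" using t by (simp add: real_sqrt_mult real_sqrt_divide power_divide)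
    moreover have "(x - 0)\<^sup>2 / (2 * ?s\<^sup>2) = (1 + t) * x\<^sup>2 / 2" using t by (simp add: power_divide field_simps)
    ultimately show ?thesis using s by (simp add: normal_density_def mult_ac)
  qed
  have "(\<integral>\<^sup>+x. ennreal (std_normal_density x) * ennreal (exp (- (t / 2) * x\<^sup>2)) \<partial>lborel)
      = (\<integral>\<^sup>+x. ennreal ?s * ennreal (normal_density 0 ?s x) \<partial>lborel)"
    by (simp only: ennreal_mult'[symmetric] normal_density_nonneg eq less_imp_le[OF s])
  also have "\<dots> = ennreal ?s * (\<integral>\<^sup>+x. ennreal (normal_density 0 ?s x) \<partial>lborel)"
    by (rule nn_integral_cmult) measurable
  also have "(\<integral>\<^sup>+x. ennreal (normal_density 0 ?s x) \<partial>lborel) = 1"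
    using s by (subst nn_integral_eq_integral) auto
  finally show ?thesis by simp
qed

lemma nn_integral_std_normal: "(\<integral>\<^sup>+x. ennreal (std_normal_density x) \<partial>lborel) = 1"
  using nn_integral_std_normal_exp_square[of 0] by simp

text \<open>The Laplace transform at \<open>t / 2\<close> of a chi-square variable with
  \<open>card A\<close> degrees of freedom: a rotation takes coordinate vectors to \<open>A\<close>,
  and then the integral factors.\<close>

lemma nn_integral_gaussian_exp_squares:
  fixes A :: "'a::euclidean_space set"
  assumes A: "finite A" "\<And>a b. a \<in> A \<Longrightarrow> b \<in> A \<Longrightarrow> a \<bullet> b = (if a = b then 1 else 0)" and t: "t > -1"
  shows "(\<integral>\<^sup>+x. ennreal (exp (- (t / 2) * (\<Sum>a\<in>A. (x \<bullet> a)\<^sup>2))) \<partial>gaussian) = ennreal ((1 / sqrt (1 + t)) ^ card A)"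
proof -
  have "independent A"
  proof (rule pairwise_orthogonal_independent)
    show "pairwise orthogonal A" using A(2) by (auto simp: pairwise_def orthogonal_def)
    show "0 \<notin> A" using A(2)[of 0 0] by auto
  qed
  then have "card A \<le> card (Basis :: 'a set)" using independent_bound by blast
  then obtain T where T: "T \<subseteq> (Basis :: 'a set)" "card T = card A" by (meson obtain_subset_with_card_n)
  then have finT: "finite T" using finite_Basis finite_subset by blast
  then obtain h where h: "bij_betw h T A" using A(1) T(2) finite_same_card_bij by blast
  have hA: "a \<in> T \<Longrightarrow> h a \<in> A" for a using h by (auto simp: bij_betw_def)
  have "h a \<bullet> h b = (if a = b then 1 else 0)" if "a \<in> T" "b \<in> T" for a b
    using A(2)[OF hA[OF that(1)] hA[OF that(2)]] h that by (auto simp: bij_betw_def dest: inj_onD)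
  then obtain f where f: "orthogonal_transformation f" "\<And>a. a \<in> T \<Longrightarrow> f a = h a"
    using orthogonal_transformation_extending[OF T(1)] by blast
  have sumf: "(\<Sum>a\<in>A. (f x \<bullet> a)\<^sup>2) = (\<Sum>b\<in>T. (x \<bullet> b)\<^sup>2)" for x
  proof -
    have "(\<Sum>b\<in>T. (f x \<bullet> h b)\<^sup>2) = (\<Sum>a\<in>A. (f x \<bullet> a)\<^sup>2)" using h by (rule sum.reindex_bij_betw)
    moreover have "f x \<bullet> h b = x \<bullet> b" if "b \<in> T" for b
      using f that unfolding orthogonal_transformation_def by metis
    ultimately show ?thesis by simp
  qed
  have "(\<integral>\<^sup>+x. ennreal (exp (- (t / 2) * (\<Sum>a\<in>A. (x \<bullet> a)\<^sup>2))) \<partial>gaussian)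
      = (\<integral>\<^sup>+x. ennreal (exp (- (t / 2) * (\<Sum>a\<in>A. (f x \<bullet> a)\<^sup>2))) \<partial>gaussian)"
    by (rule nn_integral_gaussian_orthogonal[OF f(1), symmetric]) measurable
  also have "\<dots> = (\<integral>\<^sup>+x. ennreal (exp (- (t / 2) * (\<Sum>b\<in>T. (x \<bullet> b)\<^sup>2))) \<partial>gaussian)" unfolding sumf ..
  also have "\<dots> = (\<integral>\<^sup>+x. (\<Prod>b\<in>Basis. ennreal (std_normal_density (x \<bullet> b)) *
          (if b \<in> T then ennreal (exp (- (t / 2) * (x \<bullet> b)\<^sup>2)) else 1)) \<partial>lborel)"
  proof (subst nn_integral_gaussian)
    have "ennreal (exp (- (t / 2) * (\<Sum>b\<in>T. (x \<bullet> b)\<^sup>2)))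
        = (\<Prod>b\<in>Basis. if b \<in> T then ennreal (exp (- (t / 2) * (x \<bullet> b)\<^sup>2)) else 1)" for x
    proof -
      have "exp (- (t / 2) * (\<Sum>b\<in>T. (x \<bullet> b)\<^sup>2)) = (\<Prod>b\<in>T. exp (- (t / 2) * (x \<bullet> b)\<^sup>2))"
        using finT by (simp add: sum_distrib_left exp_sum)
      then have "ennreal (exp (- (t / 2) * (\<Sum>b\<in>T. (x \<bullet> b)\<^sup>2))) = (\<Prod>b\<in>T. ennreal (exp (- (t / 2) * (x \<bullet> b)\<^sup>2)))"
        by (simp add: prod_ennreal)
      also have "\<dots> = (\<Prod>b\<in>Basis. if b \<in> T then ennreal (exp (- (t / 2) * (x \<bullet> b)\<^sup>2)) else 1)"
        using T(1) by (subst prod.inter_restrict[symmetric]) (auto simp: Int_absorb1)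
      finally show ?thesis .
    qed
    then show "(\<integral>\<^sup>+x. (\<Prod>b\<in>Basis. ennreal (std_normal_density (x \<bullet> b))) * ennreal (exp (- (t / 2) * (\<Sum>b\<in>T. (x \<bullet> b)\<^sup>2))) \<partial>lborel) =
      (\<integral>\<^sup>+x. (\<Prod>b\<in>Basis. ennreal (std_normal_density (x \<bullet> b)) *
          (if b \<in> T then ennreal (exp (- (t / 2) * (x \<bullet> b)\<^sup>2)) else 1)) \<partial>lborel)"
      by (simp add: prod.distrib)
  qed measurable
  also have "\<dots> = (\<Prod>b\<in>Basis. \<integral>\<^sup>+x. ennreal (std_normal_density x) * (if b \<in> T then ennreal (exp (- (t / 2) * x\<^sup>2)) else 1) \<partial>lborel)"
    by (rule nn_integral_lborel_prod) auto
  also have "\<dots> = (\<Prod>b\<in>Basis. if b \<in> T then ennreal (1 / sqrt (1 + t)) else 1)"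
    using nn_integral_std_normal_exp_square[OF t] nn_integral_std_normal by (intro prod.cong refl) (auto simp del: mult_minus_left)
  also have "\<dots> = (\<Prod>b\<in>T. ennreal (1 / sqrt (1 + t)))"
    using T(1) by (subst prod.inter_restrict[symmetric]) (auto simp: Int_absorb1)
  also have "\<dots> = ennreal ((1 / sqrt (1 + t)) ^ card A)" using t by (simp add: T(2) ennreal_power)
  finally show ?thesis .
qed

text \<open>The right-hand side is the double factorial \<open>(2 k - 1)!!\<close>, the moment of
  one standard normal variable; \<open>u\<close> is rotated to a coordinate vector.\<close>

lemma nn_integral_gaussian_even_moment:
  fixes u :: "'a::euclidean_space"
  assumes u: "norm u = 1"
  shows "(\<integral>\<^sup>+x. ennreal ((x \<bullet> u) ^ (2 * k)) \<partial>gaussian) = ennreal (fact (2 * k) / (2 ^ k * fact k))"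
proof -
  obtain e :: 'a where e: "e \<in> Basis" using nonempty_Basis by blast
  have "{e} \<subseteq> Basis" using e by simp
  then obtain f where f: "orthogonal_transformation f" "f e = u"
    using orthogonal_transformation_extending[of "{e}" "\<lambda>_. u"] u by (auto simp: norm_eq_1)
  have "(\<integral>\<^sup>+x. ennreal ((x \<bullet> u) ^ (2 * k)) \<partial>gaussian) = (\<integral>\<^sup>+x. ennreal ((f x \<bullet> u) ^ (2 * k)) \<partial>gaussian)"
    by (rule nn_integral_gaussian_orthogonal[OF f(1), symmetric]) measurable
  also have "\<dots> = (\<integral>\<^sup>+x. ennreal ((x \<bullet> e) ^ (2 * k)) \<partial>gaussian)"
    using f unfolding orthogonal_transformation_def by (metis (no_types, lifting))
  also have "\<dots> = (\<integral>\<^sup>+x. (\<Prod>b\<in>Basis. ennreal (std_normal_density (x \<bullet> b)) * (if b = e then ennreal ((x \<bullet> b) ^ (2 * k)) else 1)) \<partial>lborel)"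
    using e by (subst nn_integral_gaussian) (auto simp: prod.distrib)
  also have "\<dots> = (\<Prod>b\<in>Basis. \<integral>\<^sup>+x. ennreal (std_normal_density x) * (if b = e then ennreal (x ^ (2 * k)) else 1) \<partial>lborel)"
    by (rule nn_integral_lborel_prod) auto
  also have "\<dots> = (\<Prod>b\<in>Basis. if b = e then ennreal (fact (2 * k) / (2 ^ k * fact k)) else 1)"
  proof (intro prod.cong refl)
    have "(\<integral>\<^sup>+x. ennreal (std_normal_density x) * ennreal (x ^ (2 * k)) \<partial>lborel) = (\<integral>\<^sup>+x. ennreal (std_normal_density x * x ^ (2 * k)) \<partial>lborel)"
      by (intro nn_integral_cong) (simp add: ennreal_mult)
    also have "\<dots> = ennreal (fact (2 * k) / (2 ^ k * fact k))"
      using std_normal_moment_even[of k] by (subst nn_integral_eq_integral) (auto simp: has_bochner_integral_iff)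
    finally show "(\<integral>\<^sup>+x. ennreal (std_normal_density x) * (if b = e then ennreal (x ^ (2 * k)) else 1) \<partial>lborel)
        = (if b = e then ennreal (fact (2 * k) / (2 ^ k * fact k)) else 1)" for b
      using nn_integral_std_normal by auto
  qed
  also have "\<dots> = ennreal (fact (2 * k) / (2 ^ k * fact k))" using e by simp
  finally show ?thesis .
qed

text \<open>A single term of the exponential series is at most its sum.\<close>

lemma power_le_fact_exp:
  assumes "0 \<le> (x::real)"
  shows "x ^ k \<le> fact k * exp x"
proof -
  have "x ^ k / fact k \<le> (\<Sum>n. x ^ n / fact n)"
    using sum_le_suminf[of "\<lambda>n. x ^ n / fact n" "{k}"] summable_exp_generic[of x] assms
    by (simp add: divide_inverse mult.commute)
  then have "x ^ k / fact k \<le> exp x" by (simp add: exp_def divide_inverse mult.commute)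
  then show ?thesis by (simp add: field_simps)
qed

text \<open>The optimal exponent in the Chernoff bound is \<open>\<theta> = k / (n + 2 k)\<close>.\<close>

lemma nn_integral_gaussian_chi_moment_le:
  fixes A :: "'a::euclidean_space set"
  assumes A: "finite A" "\<And>a b. a \<in> A \<Longrightarrow> b \<in> A \<Longrightarrow> a \<bullet> b = (if a = b then 1 else 0)" and k: "k \<ge> 1"
  shows "(\<integral>\<^sup>+x. ennreal ((\<Sum>a\<in>A. (x \<bullet> a)\<^sup>2) ^ k) \<partial>gaussian)
    \<le> ennreal (fact k * exp (real k) / real k ^ k * (real (card A) + 2 * real k) ^ k)"
proof (cases "A = {}")
  case True
  then show ?thesis using k by (simp add: power_0_left)
next
  case False
  define n where "n = real (card A)"
  have n: "n \<ge> 1" using False A(1) by (simp add: n_def Suc_leI card_gt_0_iff)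
  define \<theta> where "\<theta> = real k / (n + 2 * real k)"
  have th: "\<theta> > 0" "2 * \<theta> < 1" using n k by (auto simp: \<theta>_def field_simps)
  have c: "- (- (2 * \<theta>) / 2) = \<theta>" by simp
  have "(\<integral>\<^sup>+x. ennreal ((\<Sum>a\<in>A. (x \<bullet> a)\<^sup>2) ^ k) \<partial>gaussian)
     \<le> (\<integral>\<^sup>+x. ennreal (fact k / \<theta> ^ k) * ennreal (exp (- (- (2 * \<theta>) / 2) * (\<Sum>a\<in>A. (x \<bullet> a)\<^sup>2))) \<partial>gaussian)"
  proof (rule nn_integral_mono)
    fix x :: 'a
    let ?S = "\<Sum>a\<in>A. (x \<bullet> a)\<^sup>2"
    have "(\<theta> * ?S) ^ k \<le> fact k * exp (\<theta> * ?S)"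
      using th by (intro power_le_fact_exp mult_nonneg_nonneg sum_nonneg) auto
    then have "?S ^ k \<le> fact k / \<theta> ^ k * exp (- (- (2 * \<theta>) / 2) * ?S)"
      using th unfolding c by (simp add: power_mult_distrib field_simps)
    then show "ennreal (?S ^ k) \<le> ennreal (fact k / \<theta> ^ k) * ennreal (exp (- (- (2 * \<theta>) / 2) * ?S))"
      using th by (simp add: ennreal_mult[symmetric] ennreal_leI del: mult_minus_left)
  qed
  also have "\<dots> = ennreal (fact k / \<theta> ^ k) * (\<integral>\<^sup>+x. ennreal (exp (- (- (2 * \<theta>) / 2) * (\<Sum>a\<in>A. (x \<bullet> a)\<^sup>2))) \<partial>gaussian)"
    by (rule nn_integral_cmult) measurable
  also have "\<dots> = ennreal (fact k / \<theta> ^ k) * ennreal ((1 / sqrt (1 + - (2 * \<theta>))) ^ card A)"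
    using th by (subst nn_integral_gaussian_exp_squares[OF A]) auto
  also have "\<dots> = ennreal (fact k / \<theta> ^ k * (1 / sqrt (1 + - (2 * \<theta>))) ^ card A)"
    using th by (simp add: ennreal_mult[symmetric])
  also have "\<dots> \<le> ennreal (fact k * exp (real k) / real k ^ k * (n + 2 * real k) ^ k)"
  proof (rule ennreal_leI)
    have "1 - 2 * \<theta> = n / (n + 2 * real k)" using n k by (simp add: \<theta>_def field_simps)
    then have "1 / sqrt (1 - 2 * \<theta>) = sqrt ((n + 2 * real k) / n)"
      by (simp add: real_sqrt_divide)
    \<comment> \<open>From \<open>1 + y <= exp y\<close>. The power \<open>card A\<close> turns this
      into \<open>exp k\<close>, free of the dimension.\<close>
    also have "\<dots> \<le> sqrt (exp (2 * real k / n))"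
      using n exp_ge_add_one_self[of "2 * real k / n"] by (simp add: add_divide_distrib)
    also have "\<dots> = exp (real k / n)"
      by (rule real_sqrt_unique) (simp_all add: exp_double[symmetric])
    finally have "(1 / sqrt (1 - 2 * \<theta>)) ^ card A \<le> exp (real k / n) ^ card A"
      using th by (intro power_mono) auto
    also have "\<dots> = exp (real k)" using n by (simp add: exp_of_nat_mult[symmetric] n_def)
    finally have "fact k / \<theta> ^ k * (1 / sqrt (1 - 2 * \<theta>)) ^ card A \<le> fact k / \<theta> ^ k * exp (real k)"
      using th by (intro mult_left_mono) auto
    also have "\<dots> = fact k * exp (real k) / real k ^ k * (n + 2 * real k) ^ k"
      using k n by (simp add: \<theta>_def power_divide)
    finally show "fact k / \<theta> ^ k * (1 / sqrt (1 + - (2 * \<theta>))) ^ card A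
        \<le> fact k * exp (real k) / real k ^ k * (n + 2 * real k) ^ k" by simp
  qed
  finally show ?thesis by (simp add: n_def)
qed

section \<open>Negative chi moments\<close>

lemma nn_integral_Gamma_kernel:
  assumes r: "r > 0" and k: "k \<ge> 1"
  shows "(\<integral>\<^sup>+t. ennreal (t ^ (k - 1) * exp (- (t / 2) * r)) * indicator {0..} t \<partial>lborel) = ennreal (fact (k - 1) * 2 ^ k / r ^ k)"
proof -
  have "(\<integral>\<^sup>+t. ennreal (erlang_density (k - 1) (r / 2) t * t ^ 0) \<partial>lborel) = 1"
    using r by (subst nn_integral_erlang_ith_moment) auto
  then have one: "(\<integral>\<^sup>+t. ennreal (erlang_density (k - 1) (r / 2) t) \<partial>lborel) = 1" by simp
  have "(\<integral>\<^sup>+t. ennreal (t ^ (k - 1) * exp (- (t / 2) * r)) * indicator {0..} t \<partial>lborel)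
      = (\<integral>\<^sup>+t. ennreal (fact (k - 1) * 2 ^ k / r ^ k) * ennreal (erlang_density (k - 1) (r / 2) t) \<partial>lborel)"
    using r k by (intro nn_integral_cong)
      (auto simp: erlang_density_def ennreal_mult[symmetric] field_simps indicator_def)
  also have "\<dots> = ennreal (fact (k - 1) * 2 ^ k / r ^ k)"
    by (subst nn_integral_cmult) (simp_all add: one[simplified])
  finally show ?thesis .
qed

text \<open>For positive \<open>r\<close> this is the Gamma integral. At \<open>r = 0\<close> the
  left-hand side is infinite, so divergence of the integral has to be shown.\<close>

lemma inverse_power_le_Gamma_kernel:
  assumes r: "r \<ge> 0" and k: "k \<ge> 1"
  shows "inverse (ennreal r) ^ k \<le> ennreal (1 / (fact (k - 1) * 2 ^ k)) *
    (\<integral>\<^sup>+t. ennreal (t ^ (k - 1) * exp (- (t / 2) * r)) * indicator {0..} t \<partial>lborel)"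
proof (cases "r = 0")
  case False
  then have "r > 0" using r by simp
  then show ?thesis unfolding nn_integral_Gamma_kernel[OF \<open>r > 0\<close> k]
    by (simp add: ennreal_mult[symmetric] inverse_ennreal ennreal_power power_inverse[symmetric] field_simps)
next
  case True
  let ?J = "\<integral>\<^sup>+t. ennreal (t ^ (k - 1)) * indicator {0..} t \<partial>lborel"
  \<comment> \<open>The integrand is at least 1 on \<open>[1, 1 + n]\<close>.\<close>
  have large: "ennreal (real n) \<le> ?J" for n :: nat
  proof -
    have "ennreal (real n) = (\<integral>\<^sup>+t. indicator {1..1 + real n} t \<partial>lborel)" by simp
    also have "\<dots> \<le> ?J"
      by (intro nn_integral_mono) (auto simp: indicator_def one_le_power ennreal_ge_1)
    finally show ?thesis .
  qed
  have "?J = \<infinity>"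
  proof (rule ccontr)
    assume "?J \<noteq> \<infinity>"
    then obtain n where "?J < of_nat n" using ennreal_Ex_less_of_nat[of ?J] by (auto simp: less_top)
    then show False using large[of n] by (simp add: ennreal_of_nat_eq_real_of_nat)
  qed
  then show ?thesis using True by (simp add: ennreal_mult_top)
qed

lemma nn_integral_inverse_sqrt_cube:
  "(\<integral>\<^sup>+t. ennreal ((1 / sqrt (1 + t)) ^ 3) * indicator {0..} t \<partial>lborel) = ennreal 2"
proof -
  have "(\<integral>\<^sup>+t. ennreal ((1 / sqrt (1 + t)) ^ 3) * indicator {0..} t \<partial>lborel) = ennreal (0 - (- 2 / sqrt (1 + 0)))"
  proof (rule nn_integral_FTC_atLeast)
    fix x :: real assume x: "0 \<le> x"
    show "((\<lambda>x. - 2 / sqrt (1 + x)) has_real_derivative (1 / sqrt (1 + x)) ^ 3) (at x)"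
      using x by (auto intro!: derivative_eq_intros simp: field_simps power3_eq_cube real_sqrt_mult[symmetric])
    show "0 \<le> (1 / sqrt (1 + x)) ^ 3" using x by simp
  next
    show "((\<lambda>x. - 2 / sqrt (1 + x)) \<longlongrightarrow> 0) at_top"
      by (intro tendsto_divide_0[OF tendsto_const] filterlim_at_top_imp_at_infinity
          filterlim_compose[OF sqrt_at_top] filterlim_tendsto_add_at_top[OF tendsto_const] filterlim_ident)
  qed measurable
  then show ?thesis by simp
qed

text \<open>
  Writing \<open>r\<^sup>-\<^sup>k\<close> as a Laplace transform reduces the negative moment to the previous integral.
\<close>

lemma nn_integral_gaussian_inverse_chi_moment_le:
  fixes A :: "'a::euclidean_space set"
  assumes A: "finite A" "\<And>a b. a \<in> A \<Longrightarrow> b \<in> A \<Longrightarrow> a \<bullet> b = (if a = b then 1 else 0)"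
    and k: "k \<ge> 1" and cA: "card A = 2 * k + 1"
  shows "(\<integral>\<^sup>+x. inverse (ennreal (\<Sum>a\<in>A. (x \<bullet> a)\<^sup>2)) ^ k \<partial>gaussian) \<le> ennreal (2 / (fact (k - 1) * 2 ^ k))"
proof -
  interpret g: prob_space "gaussian :: 'a measure" by (rule prob_space_gaussian)
  interpret pair_sigma_finite "gaussian :: 'a measure" "lborel :: real measure" by standard
  define S where "S x = (\<Sum>a\<in>A. (x \<bullet> a)\<^sup>2)" for x :: 'a
  have S0: "S x \<ge> 0" for x by (simp add: S_def sum_nonneg)
  have [measurable]: "S \<in> borel_measurable borel" unfolding S_def by measurable
  let ?C = "ennreal (1 / (fact (k - 1) * 2 ^ k))"
  have "(\<integral>\<^sup>+x. inverse (ennreal (S x)) ^ k \<partial>gaussian)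
    \<le> (\<integral>\<^sup>+x. ?C * (\<integral>\<^sup>+t. ennreal (t ^ (k - 1) * exp (- (t / 2) * S x)) * indicator {0..} t \<partial>lborel) \<partial>gaussian)"
    by (intro nn_integral_mono inverse_power_le_Gamma_kernel S0 k)
  also have "\<dots> = ?C * (\<integral>\<^sup>+x. (\<integral>\<^sup>+t. ennreal (t ^ (k - 1) * exp (- (t / 2) * S x)) * indicator {0..} t \<partial>lborel) \<partial>gaussian)"
    by (rule nn_integral_cmult) measurable
  also have "(\<integral>\<^sup>+x. (\<integral>\<^sup>+t. ennreal (t ^ (k - 1) * exp (- (t / 2) * S x)) * indicator {0..} t \<partial>lborel) \<partial>gaussian)
     = (\<integral>\<^sup>+t. (\<integral>\<^sup>+x. ennreal (t ^ (k - 1) * exp (- (t / 2) * S x)) * indicator {0..} t \<partial>gaussian) \<partial>lborel)"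
    by (rule Fubini'[symmetric]) measurable
  also have "\<dots> \<le> (\<integral>\<^sup>+t. ennreal ((1 / sqrt (1 + t)) ^ 3) * indicator {0..} t \<partial>lborel)"
  proof (rule nn_integral_mono)
    fix t :: real
    show "(\<integral>\<^sup>+x. ennreal (t ^ (k - 1) * exp (- (t / 2) * S x)) * indicator {0..} t \<partial>gaussian)
        \<le> ennreal ((1 / sqrt (1 + t)) ^ 3) * indicator {0..} t"
    proof (cases "t \<ge> 0")
      case True
      have "(\<integral>\<^sup>+x. ennreal (t ^ (k - 1) * exp (- (t / 2) * S x)) * indicator {0..} t \<partial>gaussian)
         = (\<integral>\<^sup>+x. ennreal (t ^ (k - 1)) * ennreal (exp (- (t / 2) * S x)) \<partial>gaussian)"
        using True by (intro nn_integral_cong) (simp add: ennreal_mult)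
      also have "\<dots> = ennreal (t ^ (k - 1)) * (\<integral>\<^sup>+x. ennreal (exp (- (t / 2) * S x)) \<partial>gaussian)"
        by (rule nn_integral_cmult) measurable
      also have "\<dots> = ennreal (t ^ (k - 1) * (1 / sqrt (1 + t)) ^ (2 * k + 1))"
        using True unfolding S_def by (subst nn_integral_gaussian_exp_squares[OF A]) (auto simp: cA ennreal_mult[symmetric])
      also have "\<dots> \<le> ennreal ((1 / sqrt (1 + t)) ^ 3)"
      proof (rule ennreal_leI)
        \<comment> \<open>Each factor \<open>t\<close> is paired with one
          \<open>1 / (1 + t)\<close>. Three factors \<open>1 / sqrt (1 + t)\<close> remain, just
          enough for integrability; with only \<open>2 * k\<close> directions two would remain and
          the integral would diverge.\<close>
        have e: "2 * k + 1 = 2 * (k - 1) + 3" using k by simp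
        have "t ^ (k - 1) * (1 / sqrt (1 + t)) ^ (2 * k + 1) = (t / (1 + t)) ^ (k - 1) * (1 / sqrt (1 + t)) ^ 3"
          using True unfolding e power_add power_mult by (simp add: power_divide)
        also have "\<dots> \<le> 1 * (1 / sqrt (1 + t)) ^ 3"
          using True by (intro mult_right_mono power_le_one) auto
        finally show "t ^ (k - 1) * (1 / sqrt (1 + t)) ^ (2 * k + 1) \<le> (1 / sqrt (1 + t)) ^ 3" by simp
      qed
      finally show ?thesis using True by simp
    qed simp
  qed
  also have "\<dots> = ennreal 2" by (rule nn_integral_inverse_sqrt_cube)
  finally have "(\<integral>\<^sup>+x. inverse (ennreal (S x)) ^ k \<partial>gaussian) \<le> ?C * ennreal 2" by (simp add: mult_left_mono)
  also have "\<dots> = ennreal (2 / (fact (k - 1) * 2 ^ k))" by (subst ennreal_mult[symmetric]) auto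
  finally show ?thesis by (simp add: S_def)
qed

section \<open>Independent Gaussian rows\<close>

lemma axis_inner_eq: "A \<bullet> axis i b = A $ i \<bullet> b" for A :: "'a::real_inner^'n"
  by (rule inner_axis)

lemma borel_measurable_vec_nth [measurable]:
  "(\<lambda>A. A $ i) \<in> borel_measurable borel" for i :: "'n::finite"
  by (intro borel_measurable_continuous_onI continuous_on_component continuous_on_id)

lemma (in prob_space) indep_vars_reindex_inj:
  assumes ind: "indep_vars (\<lambda>_. N) X I" and g: "inj_on g L" "g ` L \<subseteq> I"
  shows "indep_vars (\<lambda>_. N) (\<lambda>j. X (g j)) L"
proof -
  have "indep_vars (\<lambda>j. PiM {g j} (\<lambda>_. N)) (\<lambda>j \<omega>. restrict (\<lambda>i. X i \<omega>) {g j}) L"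
    using g by (intro indep_vars_restrict[OF ind]) (auto simp: disjoint_family_on_def dest: inj_onD)
  then have "indep_vars (\<lambda>_. N) (\<lambda>j \<omega>. (\<lambda>f. f (g j)) (restrict (\<lambda>i. X i \<omega>) {g j})) L"
    by (rule indep_vars_compose2) measurable
  then show ?thesis by simp
qed

text \<open>The entries of a row form one block of coordinates, and disjoint blocks of independent
  variables are independent.\<close>

lemma distr_gaussian_row:
  "distr (gaussian :: (real^'l^'d) measure) borel (\<lambda>A. A $ i) = gaussian"
  and distr_gaussian_rows:
  "distr (gaussian :: (real^'l^'d) measure) (Pi\<^sub>M UNIV (\<lambda>_. borel)) (\<lambda>A i. A $ i) = Pi\<^sub>M UNIV (\<lambda>_. gaussian)"
proof -
  let ?G = "gaussian :: (real^'l^'d) measure"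
  interpret prob_space ?G by (rule prob_space_gaussian)
  have "distr ?G borel (\<lambda>A. A) = ?G" by (rule distr_id2) simp
  then have ind: "indep_vars (\<lambda>_. borel) (\<lambda>b (A :: real^'l^'d). A \<bullet> b) Basis"
    and marg: "\<And>b::real^'l^'d. b \<in> Basis \<Longrightarrow> distr ?G borel (\<lambda>A. A \<bullet> b) = std_normal_distribution"
    by (subst (asm) distr_eq_gaussian_iff; auto)+
  have ax: "axis i b \<in> (Basis :: (real^'l^'d) set)" if "b \<in> Basis" for i and b :: "real^'l"
    using that by (auto simp: Basis_vec_def)
  show row: "distr ?G borel (\<lambda>A. A $ i) = gaussian" for i
  proof (subst distr_eq_gaussian_iff, measurable, intro conjI ballI)
    show "indep_vars (\<lambda>_. borel) (\<lambda>b A. A $ i \<bullet> b) Basis"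
    proof -
      have "inj_on (axis i) (Basis :: (real^'l) set)" "axis i ` Basis \<subseteq> (Basis :: (real^'l^'d) set)"
        using ax by (auto simp: inj_on_def axis_eq_axis)
      from indep_vars_reindex_inj[OF ind this] show ?thesis by (simp add: axis_inner_eq)
    qed
    show "distr ?G borel (\<lambda>A. A $ i \<bullet> b) = std_normal_distribution" if "b \<in> Basis" for b
      using marg[OF ax[OF that, of i]] by (simp add: axis_inner_eq)
  qed
  let ?K = "\<lambda>i::'d. axis i ` (Basis :: (real^'l) set)"
  have "indep_vars (\<lambda>i. PiM (?K i) (\<lambda>_. borel)) (\<lambda>i A. restrict (\<lambda>b. A \<bullet> b) (?K i)) (UNIV :: 'd set)"
  proof (rule indep_vars_restrict[OF ind])
    show "disjoint_family ?K"
      by (auto simp: disjoint_family_on_def axis_eq_axis)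
  qed (use ax in auto)
  then have "indep_vars (\<lambda>_. borel) (\<lambda>i A. (\<lambda>f. \<Sum>b\<in>Basis. f (axis i b) *\<^sub>R b) (restrict (\<lambda>b. A \<bullet> b) (?K i))) (UNIV :: 'd set)"
    by (rule indep_vars_compose2) measurable
  moreover have "(\<lambda>f. \<Sum>b\<in>Basis. f (axis i b) *\<^sub>R b) (restrict (\<lambda>b. A \<bullet> b) (?K i)) = A $ i" for A :: "real^'l^'d" and i
    by (simp add: axis_inner_eq euclidean_representation)
  ultimately have "indep_vars (\<lambda>_. borel) (\<lambda>i (A :: real^'l^'d). A $ i) (UNIV :: 'd set)" by simp
  then have "distr ?G (Pi\<^sub>M UNIV (\<lambda>_. borel)) (\<lambda>A. \<lambda>i\<in>UNIV. A $ i) = (\<Pi>\<^sub>M i\<in>UNIV. distr ?G borel (\<lambda>A. A $ i))"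
    by (subst (asm) indep_vars_iff_distr_eq_PiM') auto
  then show "distr ?G (Pi\<^sub>M UNIV (\<lambda>_. borel)) (\<lambda>A i. A $ i) = Pi\<^sub>M UNIV (\<lambda>_. gaussian)"
    by (simp add: row restrict_UNIV)
qed

text \<open>As a product measure over functions the sketch can be split by rows, some being
  integrated while others are held fixed. The matrix form serves for rotations.\<close>

abbreviation gaussian_rows :: "('d \<Rightarrow> real^'l) measure" where
  "gaussian_rows \<equiv> Pi\<^sub>M UNIV (\<lambda>_. gaussian)"

lemma prob_space_gaussian_rows: "prob_space (gaussian_rows :: ('d \<Rightarrow> real^'l) measure)"
  by (intro prob_space_PiM prob_space_gaussian)

lemma sets_gaussian_rows: "sets gaussian_rows = sets (Pi\<^sub>M UNIV (\<lambda>_. borel))"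
  by (intro sets_PiM_cong) auto

lemma measurable_gaussian_rows: "measurable gaussian_rows N = measurable (Pi\<^sub>M UNIV (\<lambda>_. borel)) N"
  by (intro measurable_cong_sets sets_gaussian_rows refl)

lemma measurable_rows [measurable]: "(\<lambda>(A::real^'l^'d) i. A $ i) \<in> borel \<rightarrow>\<^sub>M Pi\<^sub>M UNIV (\<lambda>_. borel)"
  by (rule measurable_PiM_single') auto

lemma nn_integral_gaussian_rows:
  assumes "F \<in> borel_measurable (Pi\<^sub>M UNIV (\<lambda>_. borel))"
  shows "(\<integral>\<^sup>+x. F x \<partial>gaussian_rows) = (\<integral>\<^sup>+(A::real^'l^'d). F (\<lambda>i. A $ i) \<partial>gaussian)"
  using assms by (subst distr_gaussian_rows[symmetric]) (rule nn_integral_distr, auto)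

text \<open>The entrywise inner product is a sum over columns, and \<open>V\<close> acts on each
  column separately.\<close>

lemma orthogonal_transformation_matrix_mult:
  fixes V :: "real^'d^'d"
  assumes "orthogonal_matrix V"
  shows "orthogonal_transformation (\<lambda>A::real^'l^'d. V ** A)"
proof -
  have V: "orthogonal_transformation ((*v) V)"
    using assms by (simp add: orthogonal_transformation_matrix matrix_vector_mul_linear)
  have "linear (\<lambda>A::real^'l^'d. V ** A)"
    by (intro linearI) (simp_all add: matrix_matrix_mult_def vec_eq_iff sum_distrib_left
        distrib_left sum.distrib mult_ac)
  moreover have "(V ** A) \<bullet> (V ** B) = A \<bullet> B" for A B :: "real^'l^'d"
  proof -
    have "C \<bullet> D = (\<Sum>j\<in>UNIV. column j C \<bullet> column j D)" for C D :: "real^'l^'d"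
      unfolding inner_vec_def column_def by (simp add: sum.swap[of _ "UNIV :: 'l set"])
    moreover have "column j (V ** C) = V *v column j C" for j and C :: "real^'l^'d"
      by (simp add: column_def matrix_matrix_mult_def matrix_vector_mult_def vec_eq_iff)
    ultimately show ?thesis using V by (simp add: orthogonal_transformation_def)
  qed
  ultimately show ?thesis by (simp add: orthogonal_transformation_def)
qed

definition rotate_rows :: "real^'d^'d \<Rightarrow> ('d \<Rightarrow> real^'l) \<Rightarrow> 'd \<Rightarrow> real^'l" where
  "rotate_rows V x i = (\<Sum>j\<in>UNIV. V $ i $ j *\<^sub>R x j)"

lemma rotate_rows_matrix: "rotate_rows V (\<lambda>i. A $ i) = (\<lambda>i. (V ** A) $ i)"
  by (simp add: rotate_rows_def matrix_matrix_mult_def vec_eq_iff fun_eq_iff)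

lemma measurable_rotate_rows [measurable]:
  "rotate_rows V \<in> Pi\<^sub>M UNIV (\<lambda>_. borel) \<rightarrow>\<^sub>M (Pi\<^sub>M UNIV (\<lambda>_. borel) :: ('d::finite \<Rightarrow> real^'l) measure)"
  by (rule measurable_PiM_single') (auto simp: rotate_rows_def)

lemma nn_integral_gaussian_rows_rotate:
  fixes F :: "('d::finite \<Rightarrow> real^'l) \<Rightarrow> ennreal"
  assumes V: "orthogonal_matrix V" and [measurable]: "F \<in> borel_measurable (Pi\<^sub>M UNIV (\<lambda>_. borel))"
  shows "(\<integral>\<^sup>+x. F (rotate_rows V x) \<partial>gaussian_rows) = (\<integral>\<^sup>+x. F x \<partial>gaussian_rows)"
proof -
  have "(\<integral>\<^sup>+x. F (rotate_rows V x) \<partial>gaussian_rows) = (\<integral>\<^sup>+(A::real^'l^'d). F (\<lambda>i. (V ** A) $ i) \<partial>gaussian)"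
    by (subst nn_integral_gaussian_rows) (auto simp: rotate_rows_matrix)
  also have "\<dots> = (\<integral>\<^sup>+(A::real^'l^'d). F (\<lambda>i. A $ i) \<partial>gaussian)"
    by (rule nn_integral_gaussian_orthogonal[OF orthogonal_transformation_matrix_mult[OF V]]) measurable
  also have "\<dots> = (\<integral>\<^sup>+x. F x \<partial>gaussian_rows)" by (subst nn_integral_gaussian_rows) auto
  finally show ?thesis .
qed

lemma distr_std_gaussian_matrix:
  fixes \<Omega> :: "'w \<Rightarrow> real^'l^'d"
  assumes "prob_space M" and g: "std_gaussian_matrix M \<Omega>"
  shows "\<Omega> \<in> borel_measurable M" and "distr M borel \<Omega> = gaussian"
proof -
  interpret prob_space M by fact
  have ind: "indep_vars (\<lambda>_. borel) (\<lambda>(i, j) \<omega>. \<Omega> \<omega> $ i $ j) UNIV"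
    and dist: "\<And>i j. distributed M lborel (\<lambda>\<omega>. \<Omega> \<omega> $ i $ j) std_normal_density"
    using g by (auto simp: std_gaussian_matrix_def)
  have entry: "\<exists>i j. b = axis i (axis j 1)" if "b \<in> Basis" for b :: "real^'l^'d"
    using that by (auto simp: Basis_vec_def)
  have inner_entry: "A \<bullet> axis i (axis j 1) = A $ i $ j" for A :: "real^'l^'d" and i j
    by (simp add: inner_axis)
  have [measurable]: "(\<lambda>\<omega>. \<Omega> \<omega> $ i $ j) \<in> borel_measurable M" for i j
    using distributed_measurable[OF dist[of i j]] by simp
  show meas: "\<Omega> \<in> borel_measurable M"
  proof (subst borel_measurable_euclidean_space, rule ballI)
    fix b :: "real^'l^'d" assume "b \<in> Basis"
    from entry[OF this] obtain i j where "b = axis i (axis j 1)" by (elim exE)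
    then show "(\<lambda>\<omega>. \<Omega> \<omega> \<bullet> b) \<in> borel_measurable M" by (simp add: inner_entry)
  qed
  \<comment> \<open>Independence is given for index pairs but wanted for basis vectors.
    \<open>idx\<close> is injective because the pair determines the basis vector.\<close>
  define idx where "idx b = (SOME p. b = axis (fst p) (axis (snd p) (1::real)))" for b :: "real^'l^'d"
  have idx: "b = axis (fst (idx b)) (axis (snd (idx b)) 1)" if b: "b \<in> Basis" for b
  proof -
    from entry[OF b] obtain i j where "b = axis i (axis j 1)" by (elim exE)
    then have "\<exists>p. b = axis (fst p) (axis (snd p) 1)" by (intro exI[of _ "(i, j)"]) simp
    then show ?thesis unfolding idx_def by (rule someI_ex)
  qed
  have "indep_vars (\<lambda>_. borel) (\<lambda>b. (\<lambda>(i, j) \<omega>. \<Omega> \<omega> $ i $ j) (idx b)) Basis"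
  proof (rule indep_vars_reindex_inj[OF ind inj_onI])
    fix a b :: "real^'l^'d" assume ab: "a \<in> Basis" "b \<in> Basis" and eq: "idx a = idx b"
    have "a = axis (fst (idx a)) (axis (snd (idx a)) 1)" by (rule idx[OF ab(1)])
    also have "\<dots> = b" unfolding eq by (rule idx[OF ab(2), symmetric])
    finally show "a = b" .
  qed auto
  moreover have "(\<lambda>(i, j) \<omega>. \<Omega> \<omega> $ i $ j) (idx b) = (\<lambda>\<omega>. \<Omega> \<omega> \<bullet> b)" if "b \<in> Basis" for b
  proof -
    have "\<Omega> \<omega> \<bullet> b = \<Omega> \<omega> $ fst (idx b) $ snd (idx b)" for \<omega>
      using inner_entry[of "\<Omega> \<omega>" "fst (idx b)" "snd (idx b)"] unfolding idx[OF that, symmetric] .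
    then show ?thesis by (simp add: case_prod_beta)
  qed
  ultimately have "indep_vars (\<lambda>_. borel) (\<lambda>b \<omega>. \<Omega> \<omega> \<bullet> b) Basis"
    by (subst (asm) indep_vars_cong[OF refl]) auto
  moreover have "distr M borel (\<lambda>\<omega>. \<Omega> \<omega> \<bullet> b) = std_normal_distribution" if b: "b \<in> Basis" for b
  proof -
    from entry[OF b] obtain i j where "b = axis i (axis j 1)" by (elim exE)
    then show ?thesis using distributed_distr_eq_density[OF dist[of i j]]
      by (simp add: inner_entry cong: distr_cong)
  qed
  ultimately show "distr M borel \<Omega> = gaussian" by (subst distr_eq_gaussian_iff[OF meas]) auto
qed

lemma distr_rotated_rows:
  fixes \<Omega> :: "'w \<Rightarrow> real^'l^'d"
  assumes "prob_space M" and g: "std_gaussian_matrix M \<Omega>" and V: "orthogonal_matrix V"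
  shows "(\<lambda>\<omega> i. (V ** \<Omega> \<omega>) $ i) \<in> M \<rightarrow>\<^sub>M Pi\<^sub>M UNIV (\<lambda>_. borel)"
    and "distr M (Pi\<^sub>M UNIV (\<lambda>_. borel)) (\<lambda>\<omega> i. (V ** \<Omega> \<omega>) $ i) = gaussian_rows"
proof -
  note [measurable] = distr_std_gaussian_matrix(1)[OF assms(1,2)]
  note ot = orthogonal_transformation_matrix_mult[OF V]
  have mV[measurable]: "(\<lambda>A::real^'l^'d. V ** A) \<in> borel_measurable borel"
    using orthogonal_transformation_linear[OF ot] by (rule borel_measurable_linear)
  show "(\<lambda>\<omega> i. (V ** \<Omega> \<omega>) $ i) \<in> M \<rightarrow>\<^sub>M Pi\<^sub>M UNIV (\<lambda>_. borel)" by measurable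
  have "distr M (Pi\<^sub>M UNIV (\<lambda>_. borel)) (\<lambda>\<omega> i. (V ** \<Omega> \<omega>) $ i)
      = distr (distr (distr M borel \<Omega>) borel (\<lambda>A. V ** A)) (Pi\<^sub>M UNIV (\<lambda>_. borel)) (\<lambda>A i. A $ i)"
    by (subst distr_distr, measurable, subst distr_distr, measurable) (simp add: comp_def)
  then show "distr M (Pi\<^sub>M UNIV (\<lambda>_. borel)) (\<lambda>\<omega> i. (V ** \<Omega> \<omega>) $ i) = gaussian_rows"
    by (simp add: distr_std_gaussian_matrix(2)[OF assms(1,2)] distr_gaussian_orthogonal[OF ot] distr_gaussian_rows)
qed

section \<open>Minimum-norm solutions\<close>

definition restr_vec :: "'d set \<Rightarrow> real^'d \<Rightarrow> real^'d" where
  "restr_vec I w = (\<chi> i. if i \<in> I then w $ i else 0)"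

text \<open>Padding with the identity outside \<open>I\<close> avoids an index type of size \<open>card I\<close>.\<close>

definition gram :: "'d set \<Rightarrow> ('d \<Rightarrow> real^'l) \<Rightarrow> real^'d^'d" where
  "gram I x = (\<chi> i j. if i \<in> I \<and> j \<in> I then x i \<bullet> x j else if i = j then 1 else 0)"

text \<open>
  The minimum-norm solution \<open>c\<close> of \<open>x i \<bullet> c = w $ i\<close> for \<open>i \<in> I\<close>, provided that the rows in \<open>I\<close> are
  linearly independent, and \<open>0\<close> otherwise.
\<close>

definition min_sol :: "'d set \<Rightarrow> ('d \<Rightarrow> real^'l) \<Rightarrow> real^'d \<Rightarrow> real^'l" where
  "min_sol I x w = (if det (gram I x) = 0 then 0
     else (\<Sum>j\<in>I. (matrix_inv (gram I x) *v restr_vec I w) $ j *\<^sub>R x j))"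

lemma linear_restr_vec: "linear (restr_vec I)"
  by (intro linearI) (simp_all add: restr_vec_def vec_eq_iff)

lemma restr_vec_idem [simp]: "restr_vec I (restr_vec I w) = restr_vec I w"
  by (simp add: restr_vec_def vec_eq_iff)

lemma norm_restr_vec: "(norm (restr_vec I w))\<^sup>2 = (\<Sum>i\<in>I. (w $ i)\<^sup>2)"
proof -
  have "(norm (restr_vec I w))\<^sup>2 = (\<Sum>i\<in>UNIV. if i \<in> I then (w $ i)\<^sup>2 else 0)"
    unfolding power2_norm_eq_inner inner_vec_def restr_vec_def
    by (intro sum.cong) (auto simp: power2_eq_square)
  then show ?thesis by (simp add: sum.If_cases)
qed

lemma linear_min_sol: "linear (min_sol I x)"
proof (cases "det (gram I x) = 0")
  case True
  then have "min_sol I x = (\<lambda>w. 0)" by (simp add: min_sol_def fun_eq_iff)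
  then show ?thesis by (simp add: linear_zero)
next
  case False
  interpret r: linear "restr_vec I" by (rule linear_restr_vec)
  from False show ?thesis
    by (intro linearI) (simp_all add: min_sol_def r.add r.scaleR matrix_vector_right_distrib
      scaleR_add_left sum.distrib matrix_vector_mult_scaleR scaleR_sum_right)
qed

lemma min_sol_restr_vec [simp]: "min_sol I x (restr_vec I w) = min_sol I x w"
  by (simp add: min_sol_def)

lemma matrix_inv_inverse:
  fixes A :: "real^'d^'d"
  assumes "det A \<noteq> 0"
  shows "A ** matrix_inv A = mat 1" and "matrix_inv A ** A = mat 1"
proof -
  have "\<exists>A'. A ** A' = mat 1 \<and> A' ** A = mat 1"
    using assms invertible_det_nz[of A] by (simp add: invertible_def)
  from someI_ex[OF this] show "A ** matrix_inv A = mat 1" "matrix_inv A ** A = mat 1"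
    by (simp_all add: matrix_inv_def)
qed

lemma matrix_inv_mult_vec:
  fixes A :: "real^'d^'d"
  assumes "det A \<noteq> 0"
  shows "A *v (matrix_inv A *v w) = w"
  using matrix_inv_inverse(1)[OF assms] by (simp add: matrix_vector_mul_assoc)

lemma gram_mult_vec:
  "(gram I x *v y) $ i = (if i \<in> I then x i \<bullet> (\<Sum>j\<in>I. y $ j *\<^sub>R x j) else y $ i)"
proof (cases "i \<in> I")
  case True
  have "(gram I x *v y) $ i = (\<Sum>j\<in>UNIV. if j \<in> I then (x i \<bullet> x j) * y $ j else 0)"
    unfolding gram_def matrix_vector_mult_def using True by (auto intro!: sum.cong)
  also have "\<dots> = (\<Sum>j\<in>I. (x i \<bullet> x j) * y $ j)" by (simp add: sum.If_cases)
  finally show ?thesis using True by (simp add: inner_sum_right mult.commute)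
next
  case False
  have "(gram I x *v y) $ i = (\<Sum>j\<in>UNIV. if j = i then y $ j else 0)"
    unfolding gram_def matrix_vector_mult_def using False
    by (simp add: if_distrib[of "\<lambda>r. r * _"] eq_commute[of i] cong: if_cong)
  then show ?thesis using False by simp
qed

lemma min_sol_solves:
  assumes "det (gram I x) \<noteq> 0" "i \<in> I"
  shows "x i \<bullet> min_sol I x w = w $ i"
  using gram_mult_vec[of I x "matrix_inv (gram I x) *v restr_vec I w" i] assms
  by (simp add: matrix_inv_mult_vec min_sol_def restr_vec_def)

text \<open>On \<open>I\<close> the quadratic form of the Gram matrix is the squared length of the
  linear combination, so a kernel vector is a linear relation among the rows; the padding makes it
  vanish outside \<open>I\<close>.\<close>

lemma gram_nonsingular_iff:
  fixes x :: "'d::finite \<Rightarrow> real^'l"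
  shows "det (gram I x) \<noteq> 0 \<longleftrightarrow> (\<forall>y::real^'d. (\<Sum>j\<in>I. y $ j *\<^sub>R x j) = 0 \<longrightarrow> (\<forall>j\<in>I. y $ j = 0))"
proof
  assume d: "det (gram I x) \<noteq> 0"
  show "\<forall>y. (\<Sum>j\<in>I. y $ j *\<^sub>R x j) = 0 \<longrightarrow> (\<forall>j\<in>I. y $ j = 0)"
  proof (intro allI impI ballI)
    fix y :: "real^'d" and j assume y: "(\<Sum>j\<in>I. y $ j *\<^sub>R x j) = 0" and j: "j \<in> I"
    have e: "(\<Sum>j\<in>I. restr_vec I y $ j *\<^sub>R x j) = (\<Sum>j\<in>I. y $ j *\<^sub>R x j)"
      by (intro sum.cong) (auto simp: restr_vec_def)
    have "gram I x *v restr_vec I y = 0"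
      unfolding vec_eq_iff gram_mult_vec e y by (simp add: restr_vec_def)
    moreover have "matrix_inv (gram I x) ** gram I x = mat 1"
      using d by (rule matrix_inv_inverse)
    ultimately have "restr_vec I y = 0"
      by (metis matrix_vector_mul_assoc matrix_vector_mul_lid matrix_vector_mult_0_right)
    then have "restr_vec I y $ j = 0" by simp
    then show "y $ j = 0" using j by (simp add: restr_vec_def)
  qed
next
  assume a: "\<forall>y. (\<Sum>j\<in>I. y $ j *\<^sub>R x j) = 0 \<longrightarrow> (\<forall>j\<in>I. y $ j = 0)"
  have "y = 0" if y: "gram I x *v y = 0" for y
  proof -
    have *: "(if i \<in> I then x i \<bullet> (\<Sum>j\<in>I. y $ j *\<^sub>R x j) else y $ i) = 0" for i
      using y gram_mult_vec[of I x y i] by simp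
    let ?s = "\<Sum>j\<in>I. y $ j *\<^sub>R x j"
    have "?s \<bullet> ?s = (\<Sum>i\<in>I. y $ i * (x i \<bullet> ?s))" by (simp add: inner_sum_left)
    also have "\<dots> = 0" using * by (intro sum.neutral) (metis mult_zero_right)
    finally have "?s = 0" by simp
    then have "j \<in> I \<Longrightarrow> y $ j = 0" for j using a by blast
    then show "y = 0" using * unfolding vec_eq_iff by (metis zero_index)
  qed
  then show "det (gram I x) \<noteq> 0"
    using matrix_left_invertible_ker[of "gram I x"] invertible_det_nz invertible_left_inverse by blast
qed

lemma min_sol_cong:
  assumes "\<And>i. i \<in> I \<Longrightarrow> x i = x' i"
  shows "min_sol I x w = min_sol I x' w"
proof -
  have "gram I x $ i $ j = gram I x' $ i $ j" for i j using assms by (simp add: gram_def)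
  then have "gram I x = gram I x'" by (simp add: vec_eq_iff)
  then show ?thesis using assms by (simp add: min_sol_def)
qed

lemma min_sol_in_span: "min_sol I x w \<in> span (x ` I)"
  unfolding min_sol_def by (auto intro!: span_zero span_sum span_scale intro: span_base)

text \<open>Gives measurability: \<open>matrix_inv\<close> is defined by choice, whereas Cramer's
  rule exhibits the coefficients as quotients of determinants. Division by zero reproduces the
  default value 0 of the singular case.\<close>

lemma min_sol_cramer:
  "min_sol I x w = (\<Sum>k\<in>I. (det (\<chi> i j. if j = k then restr_vec I w $ i else gram I x $ i $ j) / det (gram I x)) *\<^sub>R x k)"
proof (cases "det (gram I x) = 0")
  case False
  have "matrix_inv (gram I x) *v restr_vec I w
      = (\<chi> k. det (\<chi> i j. if j = k then restr_vec I w $ i else gram I x $ i $ j) / det (gram I x))"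
    using cramer[OF False] matrix_inv_mult_vec[OF False] by blast
  then show ?thesis using False by (simp add: min_sol_def)
qed (simp add: min_sol_def)

lemma borel_measurable_det:
  fixes A :: "'a \<Rightarrow> real^'n^'n"
  assumes "\<And>i j. (\<lambda>\<omega>. A \<omega> $ i $ j) \<in> borel_measurable M"
  shows "(\<lambda>\<omega>. det (A \<omega>)) \<in> borel_measurable M"
  unfolding det_def using assms by measurable

lemma borel_measurable_gram_entry [measurable (raw)]:
  assumes [measurable]: "X \<in> M \<rightarrow>\<^sub>M (Pi\<^sub>M UNIV (\<lambda>_. borel) :: ('d::finite \<Rightarrow> real^'l) measure)"
  shows "(\<lambda>\<omega>. gram I (X \<omega>) $ i $ j) \<in> borel_measurable M"
  unfolding gram_def by simp

lemma borel_measurable_det_gram [measurable (raw)]: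
  assumes [measurable]: "X \<in> M \<rightarrow>\<^sub>M (Pi\<^sub>M UNIV (\<lambda>_. borel) :: ('d::finite \<Rightarrow> real^'l) measure)"
  shows "(\<lambda>\<omega>. det (gram I (X \<omega>))) \<in> borel_measurable M"
  by (rule borel_measurable_det) measurable

lemma borel_measurable_min_sol [measurable (raw)]:
  assumes [measurable]: "X \<in> M \<rightarrow>\<^sub>M (Pi\<^sub>M UNIV (\<lambda>_. borel) :: ('d::finite \<Rightarrow> real^'l) measure)"
    and [measurable]: "W \<in> borel_measurable M"
  shows "(\<lambda>\<omega>. min_sol I (X \<omega>) (W \<omega>)) \<in> borel_measurable M"
proof -
  have [measurable]: "(\<lambda>\<omega>. det (\<chi> i j. if j = k then restr_vec I (W \<omega>) $ i else gram I (X \<omega>) $ i $ j)) \<in> borel_measurable M" for k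
  proof (rule borel_measurable_det)
    show "(\<lambda>\<omega>. (\<chi> i j. if j = k then restr_vec I (W \<omega>) $ i else gram I (X \<omega>) $ i $ j) $ i $ j) \<in> borel_measurable M" for i j
      by (cases "j = k"; cases "i \<in> I") (simp_all add: restr_vec_def)
  qed
  show ?thesis unfolding min_sol_cramer by measurable
qed

lemma bessel_inequality:
  fixes A :: "'a::real_inner set"
  assumes A: "finite A" "\<And>a b. a \<in> A \<Longrightarrow> b \<in> A \<Longrightarrow> a \<bullet> b = (if a = b then 1 else 0)"
  shows "(\<Sum>a\<in>A. (c \<bullet> a)\<^sup>2) \<le> (norm c)\<^sup>2"
proof -
  let ?p = "\<Sum>a\<in>A. (c \<bullet> a) *\<^sub>R a"
  have "?p \<bullet> b = c \<bullet> b" if b: "b \<in> A" for b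
  proof -
    have "?p \<bullet> b = (\<Sum>a\<in>A. if a = b then c \<bullet> a else 0)"
      unfolding inner_sum_left using A(2) b by (intro sum.cong) auto
    then show ?thesis using A(1) b by simp
  qed
  then have pp: "?p \<bullet> ?p = (\<Sum>a\<in>A. (c \<bullet> a)\<^sup>2)"
    by (simp add: inner_sum_right power2_eq_square)
  have "c \<bullet> ?p = (\<Sum>a\<in>A. (c \<bullet> a)\<^sup>2)" by (simp add: inner_sum_right power2_eq_square)
  then have "0 \<le> (norm c)\<^sup>2 - (\<Sum>a\<in>A. (c \<bullet> a)\<^sup>2)"
    using inner_ge_zero[of "c - ?p"] pp
    by (simp add: inner_diff_left inner_diff_right inner_commute[of ?p c] power2_norm_eq_inner)
  then show ?thesis by simp
qed

lemma orthonormal_set_orthogonal_to: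
  fixes F :: "'a::euclidean_space set"
  assumes "subspace F" "dim F + n \<le> DIM('a)"
  obtains A where "finite A" "card A = n" "\<And>a y. a \<in> A \<Longrightarrow> y \<in> F \<Longrightarrow> a \<bullet> y = 0"
    "\<And>a b. a \<in> A \<Longrightarrow> b \<in> A \<Longrightarrow> a \<bullet> b = (if a = b then 1 else 0)"
proof -
  define C where "C = {y \<in> UNIV. \<forall>x\<in>F. orthogonal x y}"
  have "dim C + dim F = DIM('a)"
    using dim_subspace_orthogonal_to_vectors[OF assms(1) subspace_UNIV] by (simp add: C_def dim_UNIV)
  moreover have subC: "subspace C" unfolding C_def using subspace_orthogonal_to_vectors by simp
  obtain B where B: "B \<subseteq> C" "pairwise orthogonal B" "\<And>x. x \<in> B \<Longrightarrow> norm x = 1"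
      "independent B" "card B = dim C" "span B = C"
    using orthonormal_basis_subspace[OF subC] by metis
  ultimately have "n \<le> card B" using assms(2) by simp
  then obtain A where A: "A \<subseteq> B" "card A = n" by (meson obtain_subset_with_card_n)
  show ?thesis
  proof
    show "finite A" using A B(4) independent_imp_finite finite_subset by blast
    show "card A = n" by fact
    show "a \<bullet> y = 0" if "a \<in> A" "y \<in> F" for a y
      using A B(1) that by (auto simp: C_def orthogonal_def inner_commute)
    show "a \<bullet> b = (if a = b then 1 else 0)" if "a \<in> A" "b \<in> A" for a b
      using A(1) B(2,3) that by (auto simp: pairwise_def orthogonal_def norm_eq_1)
  qed
qed

text \<open>
  Here \<open>V\<close> rotates the rows so that \<open>w\<close> becomes the row \<open>i\<^sub>0\<close>: the solution is then the dual vector of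
  that row, of length \<open>1 / dist (z i\<^sub>0) (span \<dots>)\<close>.
\<close>

lemma min_sol_norm_bound:
  fixes V :: "real^('d::finite)^'d" and z :: "'d::finite \<Rightarrow> real^'l"
  assumes V: "orthogonal_matrix V" and i0: "i0 \<in> I"
    and Vw: "V $ i0 = w" and Vout: "\<And>j. j \<notin> I \<Longrightarrow> V $ j = axis j 1"
    and A: "finite A" "\<And>a b. a \<in> A \<Longrightarrow> b \<in> A \<Longrightarrow> a \<bullet> b = (if a = b then 1 else 0)"
      "\<And>a i. a \<in> A \<Longrightarrow> i \<in> I - {i0} \<Longrightarrow> a \<bullet> z i = 0"
  shows "(norm (min_sol I (rotate_rows (transpose V) z) w))\<^sup>2 * (\<Sum>a\<in>A. (z i0 \<bullet> a)\<^sup>2) \<le> 1"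
proof -
  define x where "x = rotate_rows (transpose V) z"
  define c where "c = min_sol I x w"
  have orth: "V $ i \<bullet> V $ j = (if i = j then 1 else 0)" for i j
    using V unfolding orthogonal_matrix_orthonormal_rows
    by (auto simp: row_def norm_eq_1 pairwise_def orthogonal_def vec_lambda_eta)
  \<comment> \<open>\<open>V\<close> is block diagonal: it combines rows in \<open>I\<close> only
    among themselves.\<close>
  have out: "V $ i $ j = 0" if "i \<in> I" "j \<notin> I" for i j
    using orth[of i j] that Vout by (auto simp: inner_axis)
  show ?thesis
  proof (cases "det (gram I x) = 0")
    case True
    then show ?thesis by (simp add: min_sol_def flip: x_def)
  next
    case False
    have zx: "z i = (\<Sum>j\<in>UNIV. V $ i $ j *\<^sub>R x j)" for i
    proof -
      have VV: "V ** transpose V = mat 1" using V by (simp add: orthogonal_matrix_def)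
      have "(\<Sum>j\<in>UNIV. V $ i $ j *\<^sub>R x j) = (\<Sum>j\<in>UNIV. \<Sum>k\<in>UNIV. (V $ i $ j * V $ k $ j) *\<^sub>R z k)"
        by (simp add: x_def rotate_rows_def transpose_def scaleR_sum_right)
      also have "\<dots> = (\<Sum>k\<in>UNIV. (\<Sum>j\<in>UNIV. V $ i $ j * V $ k $ j) *\<^sub>R z k)"
        by (subst sum.swap) (simp add: scaleR_sum_left)
      also have "\<dots> = (\<Sum>k\<in>UNIV. (if i = k then 1 else 0) *\<^sub>R z k)"
        using orth by (simp add: inner_vec_def)
      also have "\<dots> = z i" by (simp add: if_distrib[of "\<lambda>r. r *\<^sub>R _"] cong: if_cong)
      finally show ?thesis ..
    qed
    \<comment> \<open>In the rotated frame the right-hand side \<open>w\<close> becomes the unit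
      vector of \<open>i0\<close>, so \<open>c\<close> is dual to \<open>z i0\<close>.\<close>
    have zc: "z i \<bullet> c = (if i = i0 then 1 else 0)" if i: "i \<in> I" for i
    proof -
      have "z i \<bullet> c = (\<Sum>j\<in>UNIV. V $ i $ j * (x j \<bullet> c))" by (subst zx) (simp add: inner_sum_left)
      also have "\<dots> = (\<Sum>j\<in>UNIV. V $ i $ j * w $ j)"
        using out[OF i] min_sol_solves[OF False, of _ w] by (intro sum.cong refl) (force simp: c_def)
      also have "\<dots> = V $ i \<bullet> w" by (simp add: inner_vec_def)
      finally show ?thesis using orth[of i i0] Vw by auto
    qed
    have "c \<in> span (z ` I)"
    proof -
      have "x j \<in> span (z ` I)" if "j \<in> I" for j
        unfolding x_def rotate_rows_def
      proof (intro span_sum)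
        fix k
        show "transpose V $ j $ k *\<^sub>R z k \<in> span (z ` I)"
        proof (cases "k \<in> I")
          case True
          then show ?thesis by (intro span_scale span_base) auto
        next
          case False
          then have "V $ k $ j = 0" using that Vout by (auto simp: axis_def)
          then show ?thesis by (simp add: transpose_def span_zero)
        qed
      qed
      then have "span (x ` I) \<subseteq> span (z ` I)" by (intro span_minimal) auto
      then show ?thesis using min_sol_in_span unfolding c_def by blast
    qed
    moreover have "z ` I = insert (z i0) (z ` (I - {i0}))" using i0 by auto
    ultimately obtain \<alpha> where \<alpha>: "c - \<alpha> *\<^sub>R z i0 \<in> span (z ` (I - {i0}))"
      by (auto simp: span_insert)
    define g where "g = c - \<alpha> *\<^sub>R z i0"
    have perp: "g \<bullet> y = 0" if "\<And>i. i \<in> I - {i0} \<Longrightarrow> y \<bullet> z i = 0" for y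
      unfolding g_def using \<alpha>
    proof (rule span_induct)
      show "subspace {v. v \<bullet> y = 0}" using subspace_hyperplane[of y] by (simp add: inner_commute)
      show "v \<bullet> y = 0" if v: "v \<in> z ` (I - {i0})" for v
      proof -
        obtain i where "i \<in> I - {i0}" "v = z i" using v by blast
        then show ?thesis using \<open>\<And>i. i \<in> I - {i0} \<Longrightarrow> y \<bullet> z i = 0\<close> by (simp add: inner_commute)
      qed
    qed
    \<comment> \<open>\<open>g\<close> lies in the span of the other rows, hence is orthogonal to
      \<open>c\<close> and to \<open>A\<close>. Pairing with \<open>c\<close> identifies
      \<open>\<alpha>\<close> with \<open>(norm c)\<^sup>2\<close>; pairing with \<open>A\<close>,
      followed by Bessel's inequality, bounds it.\<close>
    have ca: "c = \<alpha> *\<^sub>R z i0 + g" by (simp add: g_def)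
    have "g \<bullet> c = 0" by (rule perp) (use zc in \<open>auto simp: inner_commute\<close>)
    then have nc: "(norm c)\<^sup>2 = \<alpha>"
      using zc[OF i0] arg_cong[OF ca, of "\<lambda>v. v \<bullet> c"] by (simp add: inner_add_left power2_norm_eq_inner)
    have "c \<noteq> 0" using zc[OF i0] by auto
    then have \<alpha>pos: "\<alpha> > 0" using nc by (metis zero_less_norm_iff zero_less_power)
    have "c \<bullet> a = \<alpha> * (z i0 \<bullet> a)" if "a \<in> A" for a
    proof -
      have "g \<bullet> a = 0" by (rule perp) (use A(3) that in auto)
      then show ?thesis by (subst ca) (simp add: inner_add_left)
    qed
    then have "\<alpha>\<^sup>2 * (\<Sum>a\<in>A. (z i0 \<bullet> a)\<^sup>2) = (\<Sum>a\<in>A. (c \<bullet> a)\<^sup>2)"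
      by (simp add: sum_distrib_left power_mult_distrib)
    also have "\<dots> \<le> \<alpha>" using bessel_inequality[OF A(1,2), of c] nc by simp
    finally have "\<alpha> * (\<alpha> * (\<Sum>a\<in>A. (z i0 \<bullet> a)\<^sup>2)) \<le> \<alpha> * 1" by (simp add: power2_eq_square mult_ac)
    then have "\<alpha> * (\<Sum>a\<in>A. (z i0 \<bullet> a)\<^sup>2) \<le> 1" using \<alpha>pos by (simp only: mult_le_cancel_left_pos)
    then show ?thesis using nc by (simp add: c_def x_def)
  qed
qed

section \<open>Moments of the minimum-norm solution\<close>

text \<open>The Chernoff bound for the \<open>k\<close>-th moment of a chi-square variable with
  \<open>n\<close> degrees of freedom.\<close>

definition chi_const :: "nat \<Rightarrow> nat \<Rightarrow> real" where
  "chi_const k n = fact k * exp (real k) / real k ^ k * (real n + 2 * real k) ^ k"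

lemma chi_const_nonneg: "chi_const k n \<ge> 0" by (simp add: chi_const_def)

lemma product_prob_space_gaussian: "product_prob_space (\<lambda>_. gaussian :: 'a::euclidean_space measure)"
  by (intro product_prob_spaceI prob_space_gaussian)

text \<open>Fixing the axes outside \<open>I\<close> ensures that the rotation preserves the span of
  the rows in \<open>I\<close>.\<close>

lemma orthogonal_matrix_with_rows:
  fixes w :: "real^'d"
  assumes w: "norm w = 1" "\<And>i. i \<notin> I \<Longrightarrow> w $ i = 0" and i0: "i0 \<in> I"
  obtains V :: "real^'d^'d" where "orthogonal_matrix V" "V $ i0 = w" "\<And>j. j \<notin> I \<Longrightarrow> V $ j = axis j 1"
proof -
  define h where "h b = (if b = axis i0 1 then w else b)" for b :: "real^'d"
  define A where "A = (\<lambda>i. axis i (1::real)) ` insert i0 (-I)"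
  have hax: "h (axis i 1) = (if i = i0 then w else axis i 1)" for i by (simp add: h_def axis_eq_axis)
  have "h a \<bullet> h b = (if a = b then 1 else 0)" if ab: "a \<in> A" "b \<in> A" for a b
  proof -
    obtain i j where ij: "i \<in> insert i0 (-I)" "j \<in> insert i0 (-I)" "a = axis i 1" "b = axis j 1"
      using ab by (auto simp: A_def)
    have wi: "w \<bullet> axis i 1 = w $ i" for i by (simp add: inner_axis)
    show ?thesis unfolding ij(3,4) hax using ij(1,2) w i0
      by (auto simp: wi inner_commute[of "axis _ _" w] axis_eq_axis inner_axis_axis norm_eq_1)
  qed
  moreover have "A \<subseteq> Basis" by (auto simp: A_def)
  ultimately obtain f where f: "orthogonal_transformation f" "\<And>a. a \<in> A \<Longrightarrow> f a = h a"
    using orthogonal_transformation_extending[of A h] by metis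
  define V where "V = (\<chi> i. f (axis i 1))"
  have "orthogonal_matrix V"
    unfolding orthogonal_matrix_orthonormal_rows V_def row_def
    using f(1) by (auto simp: vec_lambda_eta orthogonal_transformation_norm orthogonal_def
        orthogonal_transformation_def inner_axis_axis)
  moreover have "V $ i0 = w" using f(2)[of "axis i0 1"] hax by (simp add: V_def A_def)
  moreover have "V $ j = axis j 1" if "j \<notin> I" for j
    using f(2)[of "axis j 1"] hax that i0 by (auto simp: V_def A_def)
  ultimately show ?thesis using that by blast
qed

lemma ennreal_le_inverse:
  assumes "a * s \<le> 1" "0 \<le> a" "0 \<le> s"
  shows "ennreal a \<le> inverse (ennreal s)"
proof (cases "s = 0")
  case False
  then have "s > 0" using assms by simp
  then show ?thesis using assms by (simp add: inverse_ennreal ennreal_leI field_simps)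
qed simp

text \<open>By rotation invariance \<open>w\<close> may become the row \<open>i0\<close>. With all
  other rows fixed, the length of the solution is at most the inverse of a chi variable of that row
  along \<open>2 * k + 1\<close> directions orthogonal to the others in \<open>I\<close>.\<close>

lemma nn_integral_min_sol_moment_unit:
  fixes w :: "real^'d"
  assumes w: "norm w = 1" "restr_vec I w = w" and k: "k \<ge> 1" and card: "card I + 2 * k \<le> CARD('l)"
  shows "(\<integral>\<^sup>+x. ennreal (norm (min_sol I x w) ^ (2 * k)) \<partial>(gaussian_rows :: ('d \<Rightarrow> real^'l) measure))
    \<le> ennreal (2 / (fact (k - 1) * 2 ^ k))"
proof -
  interpret product_prob_space "\<lambda>_::'d. gaussian :: (real^'l) measure" UNIV by (rule product_prob_space_gaussian)
  have wout: "w $ i = 0" if "i \<notin> I" for i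
    using arg_cong[OF w(2), of "\<lambda>v. v $ i"] that by (simp add: restr_vec_def)
  have "I \<noteq> {}"
  proof
    assume "I = {}"
    then have "w = 0" by (simp add: vec_eq_iff wout)
    then show False using w(1) by simp
  qed
  then obtain i0 where i0: "i0 \<in> I" by blast
  obtain V where V: "orthogonal_matrix V" "V $ i0 = w" "\<And>j. j \<notin> I \<Longrightarrow> V $ j = axis j 1"
    using orthogonal_matrix_with_rows[OF w(1) wout i0] by metis
  define F where "F x = ennreal (norm (min_sol I x w) ^ (2 * k))" for x :: "'d \<Rightarrow> real^'l"
  have Fm[measurable]: "F \<in> borel_measurable (Pi\<^sub>M UNIV (\<lambda>_. borel))" unfolding F_def by measurable
  let ?r = "rotate_rows (transpose V) :: ('d \<Rightarrow> real^'l) \<Rightarrow> 'd \<Rightarrow> real^'l"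
  have FVm: "(\<lambda>z. F (?r z)) \<in> borel_measurable (Pi\<^sub>M (insert i0 (UNIV - {i0})) (\<lambda>_. gaussian))"
    using measurable_compose[OF measurable_rotate_rows Fm] by (simp add: measurable_gaussian_rows insert_absorb)
  have "(\<integral>\<^sup>+x. F x \<partial>gaussian_rows) = (\<integral>\<^sup>+z. F (?r z) \<partial>gaussian_rows)"
    using V(1) by (intro nn_integral_gaussian_rows_rotate[symmetric] Fm) (simp add: orthogonal_matrix_transpose)
  also have "\<dots> = (\<integral>\<^sup>+z. F (?r z) \<partial>Pi\<^sub>M (insert i0 (UNIV - {i0})) (\<lambda>_. gaussian))"
    by (simp add: insert_absorb)
  also have "\<dots> = (\<integral>\<^sup>+x. (\<integral>\<^sup>+g. F (?r (x(i0 := g))) \<partial>gaussian) \<partial>Pi\<^sub>M (UNIV - {i0}) (\<lambda>_. gaussian))"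
    by (rule product_nn_integral_insert[OF _ _ FVm]) auto
  also have "\<dots> \<le> (\<integral>\<^sup>+x. ennreal (2 / (fact (k - 1) * 2 ^ k)) \<partial>Pi\<^sub>M (UNIV - {i0}) (\<lambda>_. gaussian :: (real^'l) measure))"
  proof (rule nn_integral_mono)
    fix x :: "'d \<Rightarrow> real^'l"
    let ?S = "span (x ` (I - {i0}))"
    have "dim ?S \<le> card (x ` (I - {i0}))" by (simp add: dim_le_card')
    also have "\<dots> \<le> card (I - {i0})" by (rule card_image_le) simp
    \<comment> \<open>Only \<open>card I - 1\<close> rows are avoided, which is where the extra
      direction comes from.\<close>
    finally have "dim ?S + (2 * k + 1) \<le> DIM(real^'l)"
      using card i0 card_Suc_Diff1[of I i0] by simp
    then obtain A where A: "finite A" "card A = 2 * k + 1" "\<And>a y. a \<in> A \<Longrightarrow> y \<in> ?S \<Longrightarrow> a \<bullet> y = 0"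
        "\<And>a b. a \<in> A \<Longrightarrow> b \<in> A \<Longrightarrow> a \<bullet> b = (if a = b then 1 else 0)"
      using orthonormal_set_orthogonal_to[OF subspace_span] by metis
    have "(\<integral>\<^sup>+g. F (?r (x(i0 := g))) \<partial>gaussian) \<le> (\<integral>\<^sup>+g. inverse (ennreal (\<Sum>a\<in>A. (g \<bullet> a)\<^sup>2)) ^ k \<partial>gaussian)"
    proof (rule nn_integral_mono)
      fix g :: "real^'l"
      let ?z = "x(i0 := g)"
      have "(norm (min_sol I (?r ?z) w))\<^sup>2 * (\<Sum>a\<in>A. (?z i0 \<bullet> a)\<^sup>2) \<le> 1"
      proof (rule min_sol_norm_bound[OF V(1) i0 V(2,3) A(1,4)])
        show "a \<bullet> ?z i = 0" if "a \<in> A" "i \<in> I - {i0}" for a i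
          using A(3)[OF that(1)] that(2) by (auto intro: span_base)
      qed
      then have "ennreal ((norm (min_sol I (?r ?z) w))\<^sup>2) \<le> inverse (ennreal (\<Sum>a\<in>A. (g \<bullet> a)\<^sup>2))"
        by (intro ennreal_le_inverse) (auto simp: sum_nonneg)
      then have "ennreal ((norm (min_sol I (?r ?z) w))\<^sup>2) ^ k \<le> inverse (ennreal (\<Sum>a\<in>A. (g \<bullet> a)\<^sup>2)) ^ k"
        by (rule power_mono) simp
      then show "F (?r ?z) \<le> inverse (ennreal (\<Sum>a\<in>A. (g \<bullet> a)\<^sup>2)) ^ k"
        by (simp add: F_def power_mult ennreal_power)
    qed
    also have "\<dots> \<le> ennreal (2 / (fact (k - 1) * 2 ^ k))"
      by (rule nn_integral_gaussian_inverse_chi_moment_le[OF A(1,4) k A(2)])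
    finally show "(\<integral>\<^sup>+g. F (?r (x(i0 := g))) \<partial>gaussian) \<le> ennreal (2 / (fact (k - 1) * 2 ^ k))" .
  qed
  also have "\<dots> = ennreal (2 / (fact (k - 1) * 2 ^ k))"
  proof -
    interpret p: prob_space "Pi\<^sub>M (UNIV - {i0}) (\<lambda>_::'d. gaussian :: (real^'l) measure)"
      by (intro prob_space_PiM prob_space_gaussian)
    show ?thesis by (simp add: p.emeasure_space_1)
  qed
  finally show ?thesis by (simp add: F_def)
qed

lemma nn_integral_min_sol_moment:
  fixes w :: "real^'d"
  assumes k: "k \<ge> 1" and card: "card I + 2 * k \<le> CARD('l)"
  shows "(\<integral>\<^sup>+x. ennreal (norm (min_sol I x w) ^ (2 * k)) \<partial>(gaussian_rows :: ('d \<Rightarrow> real^'l) measure))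
    \<le> ennreal (norm (restr_vec I w) ^ (2 * k)) * ennreal (2 / (fact (k - 1) * 2 ^ k))"
proof (cases "restr_vec I w = 0")
  case True
  have "min_sol I x w = 0" for x :: "'d \<Rightarrow> real^'l"
    using min_sol_restr_vec[of I x w] linear_0[OF linear_min_sol, of I x] True by simp
  then show ?thesis using k by (simp add: power_0_left)
next
  case False
  define r where "r = norm (restr_vec I w)"
  define u where "u = restr_vec I w /\<^sub>R r"
  have r: "r > 0" using False by (simp add: r_def)
  have u: "norm u = 1" "restr_vec I u = u"
    using r linear_scale[OF linear_restr_vec, of I] by (simp_all add: u_def r_def)
  have "restr_vec I w = r *\<^sub>R u" using r by (simp add: u_def)
  then have "min_sol I x w = r *\<^sub>R min_sol I x u" for x :: "'d \<Rightarrow> real^'l"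
    using min_sol_restr_vec[of I x w] linear_scale[OF linear_min_sol, of I x r u] by simp
  then have "(\<integral>\<^sup>+x. ennreal (norm (min_sol I x w) ^ (2 * k)) \<partial>(gaussian_rows :: ('d \<Rightarrow> real^'l) measure))
     = (\<integral>\<^sup>+x. ennreal (r ^ (2 * k)) * ennreal (norm (min_sol I x u) ^ (2 * k)) \<partial>(gaussian_rows :: ('d \<Rightarrow> real^'l) measure))"
    using r by (simp add: power_mult_distrib ennreal_mult)
  also have "\<dots> = ennreal (r ^ (2 * k)) * (\<integral>\<^sup>+x. ennreal (norm (min_sol I x u) ^ (2 * k)) \<partial>(gaussian_rows :: ('d \<Rightarrow> real^'l) measure))"
    by (rule nn_integral_cmult) (unfold measurable_gaussian_rows, measurable)
  also have "\<dots> \<le> ennreal (r ^ (2 * k)) * ennreal (2 / (fact (k - 1) * 2 ^ k))"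
    by (intro mult_left_mono nn_integral_min_sol_moment_unit u k card) simp
  finally show ?thesis by (simp add: r_def)
qed

text \<open>Up to the factor \<open>norm c\<close>, the products \<open>x j \<bullet> c\<close> are
  coordinates of the whole matrix along the orthonormal system \<open>axis j u\<close>.\<close>

lemma nn_integral_rows_chi_moment:
  fixes c :: "real^'l" and J :: "'d::finite set"
  assumes k: "k \<ge> 1"
  shows "(\<integral>\<^sup>+x. ennreal ((\<Sum>j\<in>J. (x j \<bullet> c)\<^sup>2) ^ k) \<partial>(gaussian_rows :: ('d \<Rightarrow> real^'l) measure))
    \<le> ennreal (chi_const k (card J)) * ennreal (norm c ^ (2 * k))"
proof (cases "c = 0")
  case True
  then show ?thesis using k by (simp add: power_0_left)
next
  case False
  define u where "u = c /\<^sub>R norm c"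
  have cu: "c = norm c *\<^sub>R u" and uu: "u \<bullet> u = 1" using False by (simp_all add: u_def dot_square_norm power2_eq_square)
  then have u0: "u \<noteq> 0" by auto
  define S where "S = (\<lambda>j. axis j u) ` J"
  have inj: "inj_on (\<lambda>j::'d. axis j u) J" using u0 by (auto simp: inj_on_def axis_eq_axis)
  have "(\<integral>\<^sup>+x. ennreal ((\<Sum>j\<in>J. (x j \<bullet> c)\<^sup>2) ^ k) \<partial>(gaussian_rows :: ('d \<Rightarrow> real^'l) measure))
     = (\<integral>\<^sup>+(A::real^'l^'d). ennreal ((\<Sum>j\<in>J. (A $ j \<bullet> c)\<^sup>2) ^ k) \<partial>gaussian)"
    by (rule nn_integral_gaussian_rows) measurable
  also have "(\<lambda>A::real^'l^'d. ennreal ((\<Sum>j\<in>J. (A $ j \<bullet> c)\<^sup>2) ^ k))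
     = (\<lambda>A. ennreal (norm c ^ (2 * k)) * ennreal ((\<Sum>a\<in>S. (A \<bullet> a)\<^sup>2) ^ k))"
  proof
    fix A :: "real^'l^'d"
    have "(\<Sum>j\<in>J. (A $ j \<bullet> c)\<^sup>2) = (norm c)\<^sup>2 * (\<Sum>j\<in>J. (A $ j \<bullet> u)\<^sup>2)"
      by (subst cu) (simp add: sum_distrib_left power_mult_distrib)
    also have "(\<Sum>j\<in>J. (A $ j \<bullet> u)\<^sup>2) = (\<Sum>a\<in>S. (A \<bullet> a)\<^sup>2)"
      unfolding S_def by (simp add: sum.reindex[OF inj] axis_inner_eq)
    finally show "ennreal ((\<Sum>j\<in>J. (A $ j \<bullet> c)\<^sup>2) ^ k) = ennreal (norm c ^ (2 * k)) * ennreal ((\<Sum>a\<in>S. (A \<bullet> a)\<^sup>2) ^ k)"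
      by (simp add: power_mult_distrib power_mult ennreal_mult sum_nonneg)
  qed
  also have "(\<integral>\<^sup>+A. ennreal (norm c ^ (2 * k)) * ennreal ((\<Sum>a\<in>S. (A \<bullet> a)\<^sup>2) ^ k) \<partial>gaussian)
     = ennreal (norm c ^ (2 * k)) * (\<integral>\<^sup>+A. ennreal ((\<Sum>a\<in>S. (A \<bullet> a)\<^sup>2) ^ k) \<partial>gaussian)"
    by (rule nn_integral_cmult) measurable
  also have "\<dots> \<le> ennreal (norm c ^ (2 * k)) * ennreal (chi_const k (card S))"
  proof (intro mult_left_mono)
    show "(\<integral>\<^sup>+A. ennreal ((\<Sum>a\<in>S. (A \<bullet> a)\<^sup>2) ^ k) \<partial>gaussian) \<le> ennreal (chi_const k (card S))"
      unfolding chi_const_def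
      by (rule nn_integral_gaussian_chi_moment_le) (use k uu u0 in \<open>auto simp: S_def inner_axis_axis axis_eq_axis\<close>)
  qed simp
  also have "card S = card J" unfolding S_def using inj by (rule card_image)
  finally show ?thesis by (simp add: mult.commute)
qed

text \<open>\<open>\<Omega>\<^sub>2 \<Omega>\<^sub>1\<^sup>\<dagger> w\<close> in the notation of Halko, Martinsson and Tropp, as squared norm.\<close>

definition tail_energy :: "'d set \<Rightarrow> ('d \<Rightarrow> real^'l) \<Rightarrow> real^'d \<Rightarrow> real" where
  "tail_energy I x w = (\<Sum>j\<in>-I. (x j \<bullet> min_sol I x w)\<^sup>2)"

lemma tail_energy_nonneg: "tail_energy I x w \<ge> 0"
  by (simp add: tail_energy_def sum_nonneg)

lemma borel_measurable_tail_energy [measurable (raw)]: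
  assumes [measurable]: "X \<in> M \<rightarrow>\<^sub>M (Pi\<^sub>M UNIV (\<lambda>_. borel) :: ('d::finite \<Rightarrow> real^'l) measure)"
    and [measurable]: "W \<in> borel_measurable M"
  shows "(\<lambda>\<omega>. tail_energy I (X \<omega>) (W \<omega>)) \<in> borel_measurable M"
  unfolding tail_energy_def by measurable

text \<open>The solution depends on the rows in \<open>I\<close> only. Given these, the energy is
  its squared length times a chi-square variable formed from the remaining rows.\<close>

lemma nn_integral_tail_energy_rows:
  fixes w :: "real^'d"
  assumes k: "k \<ge> 1"
  shows "(\<integral>\<^sup>+x. ennreal (tail_energy I x w ^ k) \<partial>(gaussian_rows :: ('d \<Rightarrow> real^'l) measure))
    \<le> ennreal (chi_const k (card (-I))) * (\<integral>\<^sup>+x. ennreal (norm (min_sol I x w) ^ (2 * k)) \<partial>(gaussian_rows :: ('d \<Rightarrow> real^'l) measure))"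
proof -
  interpret product_prob_space "\<lambda>_::'d. gaussian :: (real^'l) measure" UNIV by (rule product_prob_space_gaussian)
  interpret I: prob_space "Pi\<^sub>M I (\<lambda>_::'d. gaussian :: (real^'l) measure)"
    by (intro prob_space_PiM prob_space_gaussian)
  interpret J: prob_space "Pi\<^sub>M (-I) (\<lambda>_::'d. gaussian :: (real^'l) measure)"
    by (intro prob_space_PiM prob_space_gaussian)
  have fold: "(\<integral>\<^sup>+x. G x \<partial>(gaussian_rows :: ('d \<Rightarrow> real^'l) measure)) =
      (\<integral>\<^sup>+x. (\<integral>\<^sup>+y. G (merge I (-I) (x, y)) \<partial>Pi\<^sub>M (-I) (\<lambda>_. gaussian :: (real^'l) measure)) \<partial>Pi\<^sub>M I (\<lambda>_. gaussian :: (real^'l) measure))"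
    if "G \<in> borel_measurable (Pi\<^sub>M UNIV (\<lambda>_. borel))" for G :: "('d \<Rightarrow> real^'l) \<Rightarrow> ennreal"
    using product_nn_integral_fold[of I "-I" G] that by (simp add: measurable_gaussian_rows Compl_partition)
  have ms: "min_sol I (merge I (-I) (x, y)) w = min_sol I x w" for x y :: "'d \<Rightarrow> real^'l"
    by (rule min_sol_cong) (simp add: merge_def)
  have te: "tail_energy I (merge I (-I) (x, y)) w = (\<Sum>j\<in>-I. (y j \<bullet> min_sol I x w)\<^sup>2)" for x y :: "'d \<Rightarrow> real^'l"
    unfolding tail_energy_def ms by (intro sum.cong) (auto simp: merge_def)
  let ?N = "\<lambda>x. ennreal (norm (min_sol I x w) ^ (2 * k))"
  have "(\<integral>\<^sup>+x. ennreal (tail_energy I x w ^ k) \<partial>(gaussian_rows :: ('d \<Rightarrow> real^'l) measure))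
    = (\<integral>\<^sup>+x. (\<integral>\<^sup>+y. ennreal ((\<Sum>j\<in>-I. (y j \<bullet> min_sol I x w)\<^sup>2) ^ k) \<partial>Pi\<^sub>M (-I) (\<lambda>_. gaussian :: (real^'l) measure)) \<partial>Pi\<^sub>M I (\<lambda>_. gaussian :: (real^'l) measure))"
    by (subst fold, measurable) (simp add: te)
  also have "\<dots> \<le> (\<integral>\<^sup>+x. ennreal (chi_const k (card (-I))) * ?N x \<partial>Pi\<^sub>M I (\<lambda>_. gaussian :: (real^'l) measure))"
  proof (rule nn_integral_mono)
    fix x :: "'d \<Rightarrow> real^'l"
    let ?c = "min_sol I x w"
    have "(\<integral>\<^sup>+x. ennreal ((\<Sum>j\<in>-I. (x j \<bullet> ?c)\<^sup>2) ^ k) \<partial>(gaussian_rows :: ('d \<Rightarrow> real^'l) measure))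
      = (\<integral>\<^sup>+y. ennreal ((\<Sum>j\<in>-I. (y j \<bullet> ?c)\<^sup>2) ^ k) \<partial>Pi\<^sub>M (-I) (\<lambda>_. gaussian :: (real^'l) measure))"
      by (subst fold, measurable) (simp add: merge_def I.emeasure_space_1)
    with nn_integral_rows_chi_moment[OF k, where J="-I" and c="?c"]
    show "(\<integral>\<^sup>+y. ennreal ((\<Sum>j\<in>-I. (y j \<bullet> ?c)\<^sup>2) ^ k) \<partial>Pi\<^sub>M (-I) (\<lambda>_. gaussian :: (real^'l) measure))
      \<le> ennreal (chi_const k (card (-I))) * ?N x" by simp
  qed
  also have "\<dots> = (\<integral>\<^sup>+x. ennreal (chi_const k (card (-I))) * ?N x \<partial>(gaussian_rows :: ('d \<Rightarrow> real^'l) measure))"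
    by (subst fold, measurable) (simp add: ms J.emeasure_space_1)
  also have "\<dots> = ennreal (chi_const k (card (-I))) * (\<integral>\<^sup>+x. ?N x \<partial>(gaussian_rows :: ('d \<Rightarrow> real^'l) measure))"
    by (rule nn_integral_cmult) (unfold measurable_gaussian_rows, measurable)
  finally show ?thesis .
qed

text \<open>Fubini allows the rows to be integrated first, for fixed \<open>w\<close>. The three
  factors belong to \<open>w\<close>, to the rows outside \<open>I\<close>, and to the inverse
  distance of a row in \<open>I\<close> from the others.\<close>

lemma nn_integral_tail_energy:
  assumes k: "k \<ge> 1" and card: "card I + 2 * k \<le> CARD('l)"
  shows "(\<integral>\<^sup>+x. (\<integral>\<^sup>+w. ennreal (tail_energy I x w ^ k) \<partial>gaussian) \<partial>(gaussian_rows :: ('d::finite \<Rightarrow> real^'l) measure))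
    \<le> ennreal (chi_const k (card I) * chi_const k (card (-I)) * (2 / (fact (k - 1) * 2 ^ k)))"
proof -
  interpret g: prob_space "gaussian :: (real^'d) measure" by (rule prob_space_gaussian)
  interpret r: prob_space "gaussian_rows :: ('d \<Rightarrow> real^'l) measure" by (rule prob_space_gaussian_rows)
  interpret pair_sigma_finite "gaussian_rows :: ('d \<Rightarrow> real^'l) measure" "gaussian :: (real^'d) measure" by standard
  let ?\<rho> = "2 / (fact (k - 1) * 2 ^ k) :: real"
  let ?C = "ennreal (chi_const k (card (-I)))"
  have [measurable_cong]: "sets (gaussian_rows :: ('d \<Rightarrow> real^'l) measure) = sets (Pi\<^sub>M UNIV (\<lambda>_. borel))"
    by (rule sets_gaussian_rows)
  have "(\<integral>\<^sup>+x. (\<integral>\<^sup>+w. ennreal (tail_energy I x w ^ k) \<partial>gaussian) \<partial>(gaussian_rows :: ('d \<Rightarrow> real^'l) measure))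
    = (\<integral>\<^sup>+w. (\<integral>\<^sup>+x. ennreal (tail_energy I x w ^ k) \<partial>(gaussian_rows :: ('d \<Rightarrow> real^'l) measure)) \<partial>gaussian)"
    by (rule Fubini'[symmetric]) measurable
  also have "\<dots> \<le> (\<integral>\<^sup>+w. ?C * ennreal ?\<rho> * ennreal ((\<Sum>a\<in>(\<lambda>i. axis i (1::real)) ` I. (w \<bullet> a)\<^sup>2) ^ k) \<partial>gaussian)"
  proof (rule nn_integral_mono)
    fix w :: "real^'d"
    have "(\<Sum>a\<in>(\<lambda>i. axis i (1::real)) ` I. (w \<bullet> a)\<^sup>2) = (norm (restr_vec I w))\<^sup>2"
      by (subst sum.reindex) (auto simp: inj_on_def axis_eq_axis norm_restr_vec inner_axis)
    then have e: "norm (restr_vec I w) ^ (2 * k) = (\<Sum>a\<in>(\<lambda>i. axis i (1::real)) ` I. (w \<bullet> a)\<^sup>2) ^ k"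
      by (simp add: power_mult)
    have "(\<integral>\<^sup>+x. ennreal (tail_energy I x w ^ k) \<partial>(gaussian_rows :: ('d \<Rightarrow> real^'l) measure))
      \<le> ?C * (\<integral>\<^sup>+x. ennreal (norm (min_sol I x w) ^ (2 * k)) \<partial>(gaussian_rows :: ('d \<Rightarrow> real^'l) measure))"
      by (rule nn_integral_tail_energy_rows[OF k])
    also have "\<dots> \<le> ?C * (ennreal (norm (restr_vec I w) ^ (2 * k)) * ennreal ?\<rho>)"
      by (intro mult_left_mono nn_integral_min_sol_moment k card) simp
    finally show "(\<integral>\<^sup>+x. ennreal (tail_energy I x w ^ k) \<partial>(gaussian_rows :: ('d \<Rightarrow> real^'l) measure))
      \<le> ?C * ennreal ?\<rho> * ennreal ((\<Sum>a\<in>(\<lambda>i. axis i (1::real)) ` I. (w \<bullet> a)\<^sup>2) ^ k)"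
      unfolding e by (simp only: mult_ac)
  qed
  also have "\<dots> = ?C * ennreal ?\<rho> * (\<integral>\<^sup>+w. ennreal ((\<Sum>a\<in>(\<lambda>i. axis i (1::real)) ` I. (w \<bullet> a)\<^sup>2) ^ k) \<partial>(gaussian :: (real^'d) measure))"
    by (rule nn_integral_cmult) measurable
  also have "\<dots> \<le> ?C * ennreal ?\<rho> * ennreal (chi_const k (card ((\<lambda>i. axis i (1::real) :: real^'d) ` I)))"
    unfolding chi_const_def
    by (intro mult_left_mono nn_integral_gaussian_chi_moment_le) (use k in \<open>auto simp: inner_axis_axis axis_eq_axis\<close>)
  also have "card ((\<lambda>i. axis i (1::real) :: real^'d) ` I) = card I"
    by (rule card_image) (auto simp: inj_on_def axis_eq_axis)
  also have "?C * ennreal ?\<rho> * ennreal (chi_const k (card I)) = ennreal (chi_const k (card I) * chi_const k (card (-I)) * ?\<rho>)"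
    by (simp add: ennreal_mult[symmetric] chi_const_nonneg mult_ac del: ennreal_mult)
  finally show ?thesis .
qed

text \<open>
  Pairing with a fixed direction of the image shows that the Gaussian average of the energy controls
  the energy at every single \<open>y\<close>, that is, the operator norm.
\<close>

lemma tail_energy_le_average:
  fixes x :: "'d::finite \<Rightarrow> real^'l"
  shows "ennreal (tail_energy I x y ^ k * (fact (2 * k) / (2 ^ k * fact k)))
    \<le> ennreal (norm (restr_vec I y) ^ (2 * k)) * (\<integral>\<^sup>+w. ennreal (tail_energy I x w ^ k) \<partial>gaussian)"
proof -
  define L where "L w = (\<chi> j. if j \<in> I then 0 else x j \<bullet> min_sol I x w)" for w
  let ?\<mu> = "fact (2 * k) / (2 ^ k * fact k) :: real"
  interpret c: linear "min_sol I x" by (rule linear_min_sol)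
  have lin: "linear L"
    by (intro linearI) (simp_all add: L_def vec_eq_iff c.add c.scaleR inner_add_right)
  have te: "tail_energy I x w = (norm (L w))\<^sup>2" for w
  proof -
    have "(norm (L w))\<^sup>2 = (\<Sum>j\<in>UNIV. if j \<in> I then 0 else (x j \<bullet> min_sol I x w)\<^sup>2)"
      unfolding power2_norm_eq_inner inner_vec_def L_def by (intro sum.cong) (auto simp: power2_eq_square)
    also have "\<dots> = tail_energy I x w" unfolding tail_energy_def by (simp add: sum.If_cases)
    finally show ?thesis ..
  qed
  have Lr: "L (restr_vec I w) = L w" for w unfolding L_def min_sol_restr_vec ..
  show ?thesis
  proof (cases "L y = 0")
    case True
    show ?thesis
    \<comment> \<open>For exponent 0 both sides equal 1, including the power
      \<open>0 ^ 0\<close>.\<close>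
    proof (cases "k = 0")
      case True
      interpret g: prob_space "gaussian :: (real^'d) measure" by (rule prob_space_gaussian)
      show ?thesis using True by (simp add: g.emeasure_space_1[simplified])
    next
      case False
      then show ?thesis using \<open>L y = 0\<close> by (simp add: te power_0_left)
    qed
  next
    case False
    \<comment> \<open>\<open>b\<close> is the direction of the image of \<open>y\<close>, and
      \<open>w \<bullet> v = L w \<bullet> b\<close> is a normal variable of deviation
      \<open>norm v\<close> bounded by \<open>norm (L w)\<close>. The same \<open>norm v\<close>
      controls \<open>norm (L y)\<close>.\<close>
    define b where "b = L y /\<^sub>R norm (L y)"
    define v where "v = adjoint L b"
    have nb: "norm b = 1" using False by (simp add: b_def)
    have adj: "w \<bullet> v = L w \<bullet> b" for w unfolding v_def by (rule adjoint_works[OF lin])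
    have "norm (L y) = L y \<bullet> b" using False by (simp add: b_def dot_square_norm power2_eq_square)
    also have "\<dots> = restr_vec I y \<bullet> v" by (simp add: adj Lr)
    also have "\<dots> \<le> norm (restr_vec I y) * norm v" by (rule norm_cauchy_schwarz)
    finally have vy: "norm (L y) \<le> norm (restr_vec I y) * norm v" .
    then have v0: "norm v > 0" using False by (metis mult_zero_right norm_le_zero_iff zero_less_norm_iff norm_zero)
    have "ennreal (norm v ^ (2 * k) * ?\<mu>) = ennreal (norm v ^ (2 * k)) * ennreal ?\<mu>"
      by (rule ennreal_mult) auto
    also have "ennreal ?\<mu> = (\<integral>\<^sup>+w. ennreal ((w \<bullet> (v /\<^sub>R norm v)) ^ (2 * k)) \<partial>gaussian)"
      using v0 by (subst nn_integral_gaussian_even_moment) auto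
    also have "ennreal (norm v ^ (2 * k)) * (\<integral>\<^sup>+w. ennreal ((w \<bullet> (v /\<^sub>R norm v)) ^ (2 * k)) \<partial>gaussian)
        = (\<integral>\<^sup>+w. ennreal (norm v ^ (2 * k)) * ennreal ((w \<bullet> (v /\<^sub>R norm v)) ^ (2 * k)) \<partial>gaussian)"
      by (rule nn_integral_cmult[symmetric]) measurable
    also have "\<dots> \<le> (\<integral>\<^sup>+w. ennreal (tail_energy I x w ^ k) \<partial>gaussian)"
    proof (rule nn_integral_mono)
      fix w :: "real^'d"
      have "norm v * (w \<bullet> (v /\<^sub>R norm v)) = w \<bullet> v" using v0 by simp
      then have "norm v ^ (2 * k) * (w \<bullet> (v /\<^sub>R norm v)) ^ (2 * k) = ((w \<bullet> v)\<^sup>2) ^ k"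
        by (metis power_mult power_mult_distrib)
      also have "\<dots> \<le> tail_energy I x w ^ k"
      proof (rule power_mono)
        have "\<bar>w \<bullet> v\<bar> \<le> norm (L w)" using Cauchy_Schwarz_ineq2[of "L w" b] nb by (simp add: adj)
        from power_mono[OF this abs_ge_zero, of 2] show "(w \<bullet> v)\<^sup>2 \<le> tail_energy I x w"
          unfolding te by simp
      qed simp
      finally show "ennreal (norm v ^ (2 * k)) * ennreal ((w \<bullet> (v /\<^sub>R norm v)) ^ (2 * k)) \<le> ennreal (tail_energy I x w ^ k)"
        by (simp add: ennreal_mult[symmetric] ennreal_leI)
    qed
    finally have avg: "ennreal (norm v ^ (2 * k) * ?\<mu>) \<le> (\<integral>\<^sup>+w. ennreal (tail_energy I x w ^ k) \<partial>gaussian)" .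
    have "tail_energy I x y ^ k * ?\<mu> \<le> norm (restr_vec I y) ^ (2 * k) * (norm v ^ (2 * k) * ?\<mu>)"
    proof -
      have "tail_energy I x y ^ k \<le> (norm (restr_vec I y) * norm v) ^ (2 * k)"
        unfolding te power_mult[symmetric] using vy by (rule power_mono) simp
      then have "tail_energy I x y ^ k * ?\<mu> \<le> (norm (restr_vec I y) * norm v) ^ (2 * k) * ?\<mu>"
        by (rule mult_right_mono) simp
      then show ?thesis by (simp add: power_mult_distrib mult_ac)
    qed
    then have "ennreal (tail_energy I x y ^ k * ?\<mu>) \<le> ennreal (norm (restr_vec I y) ^ (2 * k)) * ennreal (norm v ^ (2 * k) * ?\<mu>)"
      by (simp add: ennreal_mult[symmetric] ennreal_leI)
    also have "\<dots> \<le> ennreal (norm (restr_vec I y) ^ (2 * k)) * (\<integral>\<^sup>+w. ennreal (tail_energy I x w ^ k) \<partial>gaussian)"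
      using avg by (rule mult_left_mono) simp
    finally show ?thesis .
  qed
qed

section \<open>Almost sure linear independence of the leading rows\<close>

lemma emeasure_gaussian_lowdim:
  fixes S :: "'a::euclidean_space set"
  assumes "subspace S" "dim S < DIM('a)"
  shows "emeasure gaussian S = 0"
proof -
  have "S \<in> null_sets lebesgue" using negligible_lowdim[OF assms(2)] negligible_iff_null_sets by blast
  moreover have S: "S \<in> sets borel" using closed_subspace[OF assms(1)] by simp
  ultimately have "S \<in> null_sets lborel" by (simp add: null_sets_completion_iff)
  then have "AE x in lborel. x \<notin> S" by (rule AE_not_in)
  then have "AE x in gaussian. x \<notin> S" unfolding gaussian_def by (subst AE_density) auto
  then show ?thesis using S by (subst (asm) AE_iff_measurable[of S]) auto
qed

text \<open>Rows are added one at a time. A new dependence puts the new row into the span of fewer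
  than \<open>CARD('l)\<close> fixed vectors, a null set.\<close>

lemma AE_gram_nonsingular:
  assumes "card I \<le> CARD('l)"
  shows "AE x in (gaussian_rows :: ('d::finite \<Rightarrow> real^'l) measure). det (gram I x) \<noteq> 0"
  using finite[of I] assms
proof (induction I rule: finite_induct)
  case empty
  have "gram {} x = mat 1" for x :: "'d \<Rightarrow> real^'l" by (simp add: gram_def mat_def vec_eq_iff)
  then show ?case by simp
next
  case (insert i J)
  interpret product_prob_space "\<lambda>_::'d. gaussian :: (real^'l) measure" UNIV by (rule product_prob_space_gaussian)
  have [measurable_cong]: "sets (gaussian_rows :: ('d \<Rightarrow> real^'l) measure) = sets (Pi\<^sub>M UNIV (\<lambda>_. borel))"
    by (rule sets_gaussian_rows)
  define bad where "bad = {x :: 'd \<Rightarrow> real^'l. det (gram J x) \<noteq> 0 \<and> det (gram (insert i J) x) = 0}"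
  have "bad = {x \<in> space (Pi\<^sub>M UNIV (\<lambda>_. borel)). det (gram J x) \<noteq> 0 \<and> det (gram (insert i J) x) = 0}"
    by (simp add: bad_def space_PiM)
  also have "\<dots> \<in> sets (Pi\<^sub>M UNIV (\<lambda>_. borel))" by measurable
  finally have bad_sets: "bad \<in> sets (Pi\<^sub>M UNIV (\<lambda>_. borel))" .
  then have bad_m: "indicator bad \<in> borel_measurable (Pi\<^sub>M (insert i (UNIV - {i})) (\<lambda>_. gaussian :: (real^'l) measure))"
    by (simp add: insert_absorb sets_gaussian_rows)
  have "emeasure gaussian_rows bad = (\<integral>\<^sup>+x. indicator bad x \<partial>Pi\<^sub>M (insert i (UNIV - {i})) (\<lambda>_. gaussian))"
    using bad_sets by (simp add: insert_absorb sets_gaussian_rows)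
  also have "\<dots> = (\<integral>\<^sup>+x. (\<integral>\<^sup>+g. indicator bad (x(i := g)) \<partial>gaussian) \<partial>Pi\<^sub>M (UNIV - {i}) (\<lambda>_. gaussian))"
    by (rule product_nn_integral_insert[OF _ _ bad_m]) auto
  also have "\<dots> \<le> (\<integral>\<^sup>+x. 0 \<partial>Pi\<^sub>M (UNIV - {i}) (\<lambda>_. gaussian :: (real^'l) measure))"
  proof (rule nn_integral_mono)
    fix x :: "'d \<Rightarrow> real^'l"
    let ?S = "span (x ` J)"
    have "dim ?S \<le> card J" by (simp add: dim_le_card' card_image_le order_trans[OF dim_le_card'])
    then have dimS: "dim ?S < DIM(real^'l)" using insert.prems insert.hyps by simp
    have sub: "g \<in> ?S" if g: "x(i := g) \<in> bad" for g
    proof -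
      let ?x = "x(i := g)"
      obtain y :: "real^'d" where y: "(\<Sum>j\<in>insert i J. y $ j *\<^sub>R ?x j) = 0" "\<exists>j\<in>insert i J. y $ j \<noteq> 0"
        using g gram_nonsingular_iff[of "insert i J" ?x] by (auto simp: bad_def simp del: insert_iff)
      have nd: "\<forall>y::real^'d. (\<Sum>j\<in>J. y $ j *\<^sub>R ?x j) = 0 \<longrightarrow> (\<forall>j\<in>J. y $ j = 0)"
        using g gram_nonsingular_iff[of J ?x] by (simp add: bad_def)
      have s: "(\<Sum>j\<in>J. y $ j *\<^sub>R ?x j) = (\<Sum>j\<in>J. y $ j *\<^sub>R x j)"
        using insert.hyps by (intro sum.cong) auto
      have e: "y $ i *\<^sub>R g + (\<Sum>j\<in>J. y $ j *\<^sub>R ?x j) = 0"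
        using y(1) insert.hyps by simp
      \<comment> \<open>Otherwise the relation would involve the independent rows in
        \<open>J\<close> only.\<close>
      have yi: "y $ i \<noteq> 0"
      proof
        assume "y $ i = 0"
        then have "\<forall>j\<in>J. y $ j = 0" using nd e by simp
        then show False using y(2) \<open>y $ i = 0\<close> by auto
      qed
      have "g = (- 1 / y $ i) *\<^sub>R (\<Sum>j\<in>J. y $ j *\<^sub>R x j)"
      proof -
        have "y $ i *\<^sub>R g = - (\<Sum>j\<in>J. y $ j *\<^sub>R x j)" using e unfolding s by (simp add: eq_neg_iff_add_eq_0)
        then have "(1 / y $ i) *\<^sub>R (y $ i *\<^sub>R g) = (1 / y $ i) *\<^sub>R (- (\<Sum>j\<in>J. y $ j *\<^sub>R x j))" by simp
        then show ?thesis using yi by simp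
      qed
      then show "g \<in> ?S" by (auto intro!: span_scale span_neg span_sum intro: span_base)
    qed
    have "(\<integral>\<^sup>+g. indicator bad (x(i := g)) \<partial>gaussian) \<le> (\<integral>\<^sup>+g. indicator ?S g \<partial>gaussian)"
      using sub by (intro nn_integral_mono) (auto simp: indicator_def)
    also have "\<dots> = emeasure gaussian ?S"
      using closed_subspace[OF subspace_span, of "x ` J"] by (intro nn_integral_indicator) simp
    also have "\<dots> = 0" by (rule emeasure_gaussian_lowdim[OF subspace_span dimS])
    finally show "(\<integral>\<^sup>+g. indicator bad (x(i := g)) \<partial>gaussian) \<le> 0" .
  qed
  finally have "emeasure gaussian_rows bad = 0" by simp
  then have "AE x in gaussian_rows. x \<notin> bad"
    using bad_sets by (intro AE_not_in) (simp add: null_sets_def sets_gaussian_rows)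
  moreover have "AE x in (gaussian_rows :: ('d \<Rightarrow> real^'l) measure). det (gram J x) \<noteq> 0"
    using insert by simp
  ultimately show ?case by eventually_elim (simp add: bad_def)
qed

section \<open>The error bound\<close>

lemma orthogonal_matrix_eigenbasis:
  fixes v :: "'d::finite \<Rightarrow> real^'d"
  assumes "\<And>i j. v i \<bullet> v j = (if i = j then 1 else 0)"
  shows "orthogonal_matrix (\<chi> i. v i)"
  unfolding orthogonal_matrix_orthonormal_rows row_def
  using assms by (auto simp: vec_lambda_eta norm_eq_1 orthogonal_def)

text \<open>Markov's inequality for the average \<open>h\<close>. Since \<open>h\<close> depends on
  the rows alone and dominates the energy of every \<open>y\<close>, one event serves all
  \<open>y\<close>, with the minimum-norm solution as \<open>c\<close>.\<close>

lemma right_inverse_event: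
  fixes \<Omega> :: "'w \<Rightarrow> real^'l^'d" and V :: "real^'d^'d"
  assumes M: "prob_space M" and g: "std_gaussian_matrix M \<Omega>" and V: "orthogonal_matrix V"
    and k: "k \<ge> 1" and card: "card I + 2 * k \<le> CARD('l)" and a: "a > 0"
  defines "t \<equiv> chi_const k (card I) * chi_const k (card (-I)) * (2 / (fact (k - 1) * 2 ^ k))
     / (a ^ (2 * k) * (fact (2 * k) / (2 ^ k * fact k)))"
  shows "\<exists>E\<in>sets M. measure M E \<ge> 1 - t \<and> (\<forall>\<omega>\<in>E. \<forall>y. \<exists>c.
    (\<forall>i\<in>I. (V ** \<Omega> \<omega>) $ i \<bullet> c = y $ i) \<and>
    (\<Sum>j\<in>-I. ((V ** \<Omega> \<omega>) $ j \<bullet> c)\<^sup>2) \<le> a\<^sup>2 * (\<Sum>i\<in>I. (y $ i)\<^sup>2))"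
proof -
  interpret M: prob_space M by fact
  interpret g: prob_space "gaussian :: (real^'d) measure" by (rule prob_space_gaussian)
  interpret r: prob_space "gaussian_rows :: ('d \<Rightarrow> real^'l) measure" by (rule prob_space_gaussian_rows)
  let ?\<mu> = "fact (2 * k) / (2 ^ k * fact k) :: real"
  let ?R = "gaussian_rows :: ('d \<Rightarrow> real^'l) measure"
  let ?B = "Pi\<^sub>M UNIV (\<lambda>_. borel) :: ('d \<Rightarrow> real^'l) measure"
  define X where "X \<omega> = (\<lambda>i. (V ** \<Omega> \<omega>) $ i)" for \<omega>
  have X[measurable]: "X \<in> M \<rightarrow>\<^sub>M ?B" and dX: "distr M ?B X = ?R"
    using distr_rotated_rows[OF M g V] by (simp_all add: X_def[abs_def])
  define h where "h x = (\<integral>\<^sup>+w. ennreal (tail_energy I x w ^ k) \<partial>gaussian)" for x :: "'d \<Rightarrow> real^'l"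
  have h[measurable]: "h \<in> borel_measurable ?B" unfolding h_def by measurable
  \<comment> \<open>The Gaussian moment in the threshold cancels the one in
    \<open>tail_energy_le_average\<close>, which leaves \<open>a ^ (2 * k)\<close>.\<close>
  define \<tau> where "\<tau> = a ^ (2 * k) * ?\<mu>"
  have \<tau>: "\<tau> > 0" using a by (simp add: \<tau>_def)
  define G where "G = {x \<in> space ?B. det (gram I x) \<noteq> 0 \<and> h x < ennreal \<tau>}"
  have G[measurable]: "G \<in> sets ?B" unfolding G_def by measurable
  define T where "T = {x \<in> space ?B. ennreal \<tau> \<le> h x}"
  have T[measurable]: "T \<in> sets ?B" unfolding T_def by measurable
  have tau_t: "\<tau> * t = chi_const k (card I) * chi_const k (card (-I)) * (2 / (fact (k - 1) * 2 ^ k))"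
    unfolding t_def \<tau>_def[symmetric] using \<tau> by simp
  have "ennreal \<tau> * emeasure ?R T = (\<integral>\<^sup>+x. ennreal \<tau> * indicator T x \<partial>?R)"
    by (subst nn_integral_cmult_indicator) (auto simp: sets_gaussian_rows)
  also have "\<dots> \<le> (\<integral>\<^sup>+x. h x \<partial>?R)"
    by (intro nn_integral_mono) (auto simp: T_def indicator_def)
  also have "\<dots> \<le> ennreal (\<tau> * t)"
    unfolding tau_t h_def by (rule nn_integral_tail_energy[OF k card])
  finally have "ennreal (\<tau> * measure ?R T) \<le> ennreal (\<tau> * t)"
    using \<tau> by (simp add: r.emeasure_eq_measure ennreal_mult)
  moreover have t0: "t \<ge> 0" unfolding t_def using a by (simp add: chi_const_nonneg)
  ultimately have mT: "measure ?R T \<le> t" using \<tau> by (simp add: ennreal_le_iff)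
  have "AE x in ?R. det (gram I x) \<noteq> 0" by (rule AE_gram_nonsingular) (use card in simp)
  then have "AE x in ?R. x \<in> space ?R - T \<longrightarrow> x \<in> G"
    by eventually_elim (auto simp: T_def G_def space_PiM not_le)
  then have "measure ?R (space ?R - T) \<le> measure ?R G"
    by (intro r.finite_measure_mono_AE) (auto simp: sets_gaussian_rows)
  moreover have "measure ?R (space ?R - T) = 1 - measure ?R T"
    by (rule r.prob_compl) (simp add: sets_gaussian_rows)
  ultimately have mG: "measure ?R G \<ge> 1 - t" using mT by linarith
  define E where "E = X -` G \<inter> space M"
  have "measure M E = measure (distr M ?B X) G" unfolding E_def by (rule measure_distr[symmetric]) measurable
  then have "measure M E \<ge> 1 - t" using mG by (simp add: dX)
  moreover have "E \<in> sets M" unfolding E_def by measurable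
  moreover have "\<exists>c. (\<forall>i\<in>I. (V ** \<Omega> \<omega>) $ i \<bullet> c = y $ i) \<and>
    (\<Sum>j\<in>-I. ((V ** \<Omega> \<omega>) $ j \<bullet> c)\<^sup>2) \<le> a\<^sup>2 * (\<Sum>i\<in>I. (y $ i)\<^sup>2)" if "\<omega> \<in> E" for \<omega> and y :: "real^'d"
  proof (intro exI conjI ballI)
    have nd: "det (gram I (X \<omega>)) \<noteq> 0" and hx: "h (X \<omega>) < ennreal \<tau>"
      using that by (auto simp: E_def G_def)
    let ?c = "min_sol I (X \<omega>) y"
    show "(V ** \<Omega> \<omega>) $ i \<bullet> ?c = y $ i" if "i \<in> I" for i
      using min_sol_solves[OF nd that, of y] by (simp add: X_def)
    let ?n = "norm (restr_vec I y)"
    have "ennreal (tail_energy I (X \<omega>) y ^ k * ?\<mu>) \<le> ennreal (?n ^ (2 * k)) * h (X \<omega>)"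
      unfolding h_def by (rule tail_energy_le_average)
    also have "\<dots> \<le> ennreal (?n ^ (2 * k)) * ennreal \<tau>"
      using hx by (intro mult_left_mono) auto
    also have "\<dots> = ennreal (?n ^ (2 * k) * \<tau>)" using \<tau> by (simp add: ennreal_mult)
    finally have "tail_energy I (X \<omega>) y ^ k * ?\<mu> \<le> ?n ^ (2 * k) * \<tau>"
      using \<tau> by (subst (asm) ennreal_le_iff) auto
    then have "tail_energy I (X \<omega>) y ^ k * ?\<mu> \<le> ((a\<^sup>2 * ?n\<^sup>2) ^ k) * ?\<mu>"
      by (simp add: \<tau>_def power_mult_distrib mult_ac flip: power_mult)
    then have "tail_energy I (X \<omega>) y ^ k \<le> (a\<^sup>2 * ?n\<^sup>2) ^ k" by (rule mult_right_le_imp_le) simp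
    then have "tail_energy I (X \<omega>) y \<le> a\<^sup>2 * ?n\<^sup>2"
      using k power_mono_iff[of "tail_energy I (X \<omega>) y" "a\<^sup>2 * ?n\<^sup>2" k] by (simp add: tail_energy_nonneg)
    then show "(\<Sum>j\<in>-I. ((V ** \<Omega> \<omega>) $ j \<bullet> ?c)\<^sup>2) \<le> a\<^sup>2 * (\<Sum>i\<in>I. (y $ i)\<^sup>2)"
      by (simp add: tail_energy_def X_def norm_restr_vec)
  qed
  ultimately show ?thesis by blast
qed

text \<open>The ratio of successive terms is at most \<open>9 / 4 * 0.1092 < 1\<close>, so
  \<open>k = 2\<close> is the worst case. The number 0.1092 bounds
  \<open>(exp 2 / 22.4) ^ 2\<close>, which occurs in the failure probability.\<close>

lemma square_times_geometric_le:
  assumes "2 \<le> k"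
  shows "(real k)\<^sup>2 * (1092 / 10000) ^ k \<le> 5 / 100"
  using assms
proof (induction k rule: dec_induct)
  case base
  show ?case by (simp add: power2_eq_square)
next
  case (step k)
  have "(real (Suc k))\<^sup>2 * (1092 / 10000) \<le> (real k)\<^sup>2"
  proof -
    have "real (Suc k) \<le> 3 / 2 * real k" using step.hyps by simp
    then have "(real (Suc k))\<^sup>2 \<le> (3 / 2 * real k)\<^sup>2" by (intro power_mono) auto
    also have "\<dots> = 9 / 4 * (real k)\<^sup>2" by (simp add: power_mult_distrib power_divide)
    finally show ?thesis using zero_le_power2[of "real k"] by linarith
  qed
  then have "(real (Suc k))\<^sup>2 * (1092 / 10000) * (1092 / 10000) ^ k \<le> (real k)\<^sup>2 * (1092 / 10000) ^ k"
    by (intro mult_right_mono) auto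
  then show ?case using step.IH by (simp only: power_Suc mult.assoc[symmetric])
qed

text \<open>The quotient equals \<open>2 k (k!)^2 / (2 k)! * (e / k)^(2 k) * Y^k / a^(2 k)\<close>.
  The central binomial coefficient and \<open>(1 + 1 / k)^(2 k) <= e^2\<close> bound it by
  \<open>4 k^2 e^2 (e / 22.4)^(2 k)\<close>. As \<open>p <= 2 k + 1\<close>, it remains to see that
  \<open>4 e^3 k^2 (e^2 / 22.4)^(2 k)\<close> is at most 6.\<close>

lemma failure_probability_le:
  fixes a :: real
  assumes p: "4 \<le> p" and k: "k = p div 2" and l: "l = m + p" and a: "0 < a"
    and al: "(real l * real (n + p)) * (224 / 10)\<^sup>2 \<le> (real (p + 1))\<^sup>2 * a\<^sup>2"
  shows "chi_const k m * chi_const k n * (2 / (fact (k - 1) * 2 ^ k))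
     / (a ^ (2 * k) * (fact (2 * k) / (2 ^ k * fact k))) \<le> 6 * exp (- real p)"
proof -
  have k2: "2 \<le> k" using p k by simp
  have pk: "p \<le> 2 * k + 1" "2 * k \<le> p" using k by auto
  define Y where "Y = (real m + 2 * real k) * (real n + 2 * real k)"
  have Y0: "0 \<le> Y" by (simp add: Y_def)
  have "Y \<le> real l * real (n + p)"
    unfolding Y_def using pk l by (intro mult_mono) auto
  then have "Y * (224 / 10)\<^sup>2 \<le> (real (p + 1))\<^sup>2 * a\<^sup>2"
    using al by (meson mult_right_mono order_trans zero_le_power2)
  \<comment> \<open>\<open>p + 1 <= 2 k + 2\<close> covers both parities of
    \<open>p\<close>.\<close>
  also have "\<dots> \<le> (2 * real k + 2)\<^sup>2 * a\<^sup>2"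
    using pk by (intro mult_right_mono power_mono) auto
  finally have "Y \<le> (2 * real k + 2)\<^sup>2 * a\<^sup>2 / (224 / 10)\<^sup>2" by (subst pos_le_divide_eq) auto
  then have "Y \<le> ((2 * real k + 2) / (224 / 10))\<^sup>2 * a\<^sup>2"
    by (simp only: power_divide[of "2 * real k + 2"] times_divide_eq_left)
  then have "Y ^ k \<le> (((2 * real k + 2) / (224 / 10))\<^sup>2 * a\<^sup>2) ^ k" using Y0 by (intro power_mono)
  then have Yk: "Y ^ k / a ^ (2 * k) \<le> ((2 * real k + 2) / (224 / 10)) ^ (2 * k)"
    using a by (simp add: power_mult_distrib power_mult[symmetric] divide_le_eq)
  have fk: "(fact k :: real) = real k * fact (k - 1)" using k2 by (simp add: fact_reduce)
  define C where "C = (fact k)\<^sup>2 * 4 ^ k / (fact (2 * k) :: real)"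
  \<comment> \<open>\<open>C\<close> is \<open>4 ^ k\<close> divided by the central binomial
    coefficient.\<close>
  have C: "C \<le> 2 * real k"
  proof -
    have "4 ^ k / (2 * real k) \<le> real ((2 * k) choose k)"
      using k2 by (intro central_binomial_lower_bound) simp
    also have "\<dots> = fact (2 * k) / (fact k * fact k)"
      by (subst binomial_fact) auto
    finally show ?thesis using k2 by (simp add: C_def power2_eq_square field_simps)
  qed
  have "chi_const k m * chi_const k n * (2 / (fact (k - 1) * 2 ^ k))
     / (a ^ (2 * k) * (fact (2 * k) / (2 ^ k * fact k)))
     = 2 * real k * ((fact k)\<^sup>2 / fact (2 * k)) * ((exp (real k))\<^sup>2 / (real k ^ k)\<^sup>2) * (Y ^ k / a ^ (2 * k))"
    unfolding chi_const_def Y_def power_mult_distrib using k2 a fk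
    by (simp add: field_simps power2_eq_square)
  also have "\<dots> \<le> 2 * real k * ((fact k)\<^sup>2 / fact (2 * k)) * ((exp (real k))\<^sup>2 / (real k ^ k)\<^sup>2)
      * ((2 * real k + 2) / (224 / 10)) ^ (2 * k)"
    using Yk by (intro mult_left_mono) auto
  also have "\<dots> = 2 * real k * C * (exp 1 * (1 + 1 / real k) / (224 / 10)) ^ (2 * k)"
  proof -
    have "(exp (real k))\<^sup>2 = exp 1 ^ (2 * k)" by (simp add: exp_of_nat_mult[symmetric] power_mult mult.commute)
    moreover have "(real k ^ k)\<^sup>2 = real k ^ (2 * k)" by (simp add: power_mult[symmetric] mult.commute)
    moreover define r where "r = (1 + 1 / real k) / (224 / 10)"
    moreover have "((2 * real k + 2) / (224 / 10)) ^ (2 * k) = 4 ^ k * (real k ^ (2 * k) * r ^ (2 * k))"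
    proof -
      have eq: "(2 * real k + 2) / (224 / 10) = 2 * (real k * r)"
        using k2 by (simp add: r_def field_simps)
      show ?thesis unfolding eq power_mult_distrib by (simp add: power_mult)
    qed
    moreover have "exp 1 * (1 + 1 / real k) / (224 / 10) = exp 1 * r" by (simp add: r_def)
    ultimately show ?thesis using k2
      by (simp only: C_def power_mult_distrib) simp
  qed
  also have "\<dots> \<le> 2 * real k * (2 * real k) * (exp 1 * (1 + 1 / real k) / (224 / 10)) ^ (2 * k)"
    using C by (intro mult_right_mono mult_left_mono) auto
  also have "(exp 1 * (1 + 1 / real k) / (224 / 10)) ^ (2 * k) = (1 + 1 / real k) ^ (2 * k) * (exp 1 / (224 / 10)) ^ (2 * k)"
    by (simp add: power_mult_distrib power_divide)
  also have "2 * real k * (2 * real k) * \<dots> \<le> 2 * real k * (2 * real k) * (exp 2 * (exp 1 / (224 / 10)) ^ (2 * k))"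
  proof (intro mult_left_mono mult_right_mono)
    have "(1 + 1 / real k) ^ (2 * k) \<le> exp (1 / real k) ^ (2 * k)"
      by (intro power_mono exp_ge_add_one_self) auto
    also have "\<dots> = exp 2" using k2 by (simp add: exp_of_nat_mult[symmetric])
    finally show "(1 + 1 / real k) ^ (2 * k) \<le> exp 2" .
  qed auto
  also have "\<dots> \<le> 6 * exp (- real (2 * k + 1))"
  proof -
    have e: "exp 1 \<le> (272 / 100 :: real)" using e_less_272 by simp
    have e2: "exp 1 * exp 1 / (224 / 10) \<le> (33029 / 100000 :: real)"
      using mult_mono[OF e e] by simp
    have sq: "(exp 1 * exp 1 / (224 / 10))\<^sup>2 \<le> (1092 / 10000 :: real)"
      using power_mono[OF e2, of 2] by (simp add: power2_eq_square)
    have "(exp 1 / (224 / 10)) ^ (2 * k) * exp (real (2 * k)) = (exp 1 * exp 1 / (224 / 10)) ^ (2 * k)"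
      by (simp add: power_mult_distrib power_divide exp_of_nat_mult[symmetric])
    also have "\<dots> = ((exp 1 * exp 1 / (224 / 10))\<^sup>2) ^ k" by (rule power_mult)
    also have "\<dots> \<le> (1092 / 10000) ^ k" using sq by (intro power_mono) auto
    finally have x: "(exp 1 / (224 / 10)) ^ (2 * k) * exp (real (2 * k)) \<le> (1092 / 10000 :: real) ^ k" .
    have e3: "exp 2 * exp 1 \<le> (21 :: real)"
    proof -
      have "exp 2 * exp 1 = (exp 1 ^ 3 :: real)" by (simp add: exp_add[symmetric] exp_of_nat_mult[symmetric])
      also have "\<dots> \<le> (272 / 100) ^ 3" using e by (intro power_mono) auto
      also have "\<dots> \<le> 21" by (simp add: power3_eq_cube)
      finally show ?thesis .
    qed
    have "(2 * real k * (2 * real k) * (exp 2 * (exp 1 / (224 / 10)) ^ (2 * k))) * exp (real (2 * k + 1))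
       = 4 * (exp 2 * exp 1) * ((real k)\<^sup>2 * ((exp 1 / (224 / 10)) ^ (2 * k) * exp (real (2 * k))))"
      by (simp add: exp_add power2_eq_square)
    also have "\<dots> \<le> 4 * 21 * ((real k)\<^sup>2 * (1092 / 10000) ^ k)"
      using e3 x by (intro mult_mono mult_left_mono) auto
    \<comment> \<open>This is 4.2, which leaves some room below 6.\<close>
    also have "\<dots> \<le> 4 * 21 * (5 / 100)"
      using square_times_geometric_le[OF k2] by (intro mult_left_mono) auto
    also have "\<dots> \<le> 6" by simp
    finally have "2 * real k * (2 * real k) * (exp 2 * (exp 1 / (224 / 10)) ^ (2 * k)) \<le> 6 / exp (real (2 * k + 1))"
      by (subst pos_le_divide_eq) auto
    then show ?thesis by (simp only: exp_minus divide_inverse)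
  qed
  also have "\<dots> \<le> 6 * exp (- real p)" using pk by simp
  finally show ?thesis .
qed

text \<open>\<open>K\<close> is the argument of the logarithm, and \<open>224 / 10\<close> is
  \<open>16 * 14 / 10\<close>. It suffices that \<open>(p + 1) K\<close> is at least
  \<open>16 sqrt (l (n + p))\<close>: of \<open>sqrt (n + p) <= sqrt n + sqrt p\<close>, the first
  part matches the second term of \<open>K\<close>, and the other fits into the first term because
  \<open>16 p <= 34 (p + 1)\<close>.\<close>

lemma sketch_constant_bound:
  fixes l m n p :: nat
  assumes p: "4 \<le> p" and l: "l = m + p"
  defines "K \<equiv> 34 * sqrt (real l / real p) + 16 * sqrt (real l) / (real p + 1) * sqrt (real n)"
  shows "34 \<le> K" and "(real l * real (n + p)) * (224 / 10)\<^sup>2 \<le> (real (p + 1))\<^sup>2 * (14 / 10 * K)\<^sup>2"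
proof -
  have "1 \<le> sqrt (real l / real p)" using p l by simp
  moreover have "0 \<le> 16 * sqrt (real l) / (real p + 1) * sqrt (real n)" by simp
  ultimately show K: "34 \<le> K" unfolding K_def by linarith
  have "sqrt (real (n + p)) \<le> sqrt (real n) + sqrt (real p)" by (simp add: sqrt_add_le_add_sqrt)
  then have "16 * (sqrt (real l) * sqrt (real (n + p))) \<le> 16 * sqrt (real l) * sqrt (real n) + 16 * (sqrt (real l) * sqrt (real p))"
    using mult_left_mono[of "sqrt (real (n + p))" "sqrt (real n) + sqrt (real p)" "16 * sqrt (real l)"]
    by (simp add: algebra_simps)
  also have "16 * (sqrt (real l) * sqrt (real p)) \<le> (real p + 1) * (34 * sqrt (real l / real p))"
  proof -
    have "sqrt (real l) * sqrt (real p) = real p * sqrt (real l / real p)"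
      using p by (simp add: real_sqrt_divide field_simps)
    moreover have "16 * (real p * sqrt (real l / real p)) \<le> 34 * ((real p + 1) * sqrt (real l / real p))"
      by (intro mult_mono) auto
    ultimately show ?thesis by simp
  qed
  also have "16 * sqrt (real l) * sqrt (real n) + (real p + 1) * (34 * sqrt (real l / real p)) = (real p + 1) * K"
  proof -
    have "real p + 1 \<noteq> 0" by linarith
    then have "(real p + 1) * (16 * sqrt (real l) / (real p + 1) * sqrt (real n)) = 16 * sqrt (real l) * sqrt (real n)"
      by simp
    then show ?thesis unfolding K_def distrib_left[of "real p + 1"] by linarith
  qed
  finally have "16 * (sqrt (real l) * sqrt (real (n + p))) \<le> (real p + 1) * K" by simp
  then have "(16 * (sqrt (real l) * sqrt (real (n + p))))\<^sup>2 \<le> ((real p + 1) * K)\<^sup>2"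
    by (intro power_mono) auto
  then have bound: "256 * (real l * real (n + p)) \<le> (real p + 1)\<^sup>2 * K\<^sup>2"
    by (simp add: power_mult_distrib)
  have "(real l * real (n + p)) * (224 / 10)\<^sup>2 = 196 / 100 * (256 * (real l * real (n + p)))"
    by (simp add: power2_eq_square)
  also have "\<dots> \<le> 196 / 100 * ((real p + 1)\<^sup>2 * K\<^sup>2)"
    using bound by (rule mult_left_mono) simp
  also have "\<dots> = (real (p + 1))\<^sup>2 * (14 / 10 * K)\<^sup>2"
    by (simp add: power_mult_distrib power_divide add.commute)
  finally show "(real l * real (n + p)) * (224 / 10)\<^sup>2 \<le> (real (p + 1))\<^sup>2 * (14 / 10 * K)\<^sup>2" .
qed

text \<open>The ceiling bounds \<open>K\<close> by an even power; the further factor 3/2 of the odd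
  power makes room for the coefficient 14/10 and the summand 1.\<close>

lemma powr_bound_from_log:
  assumes q: "int q \<ge> \<lceil>1 / 2 * log (3 / 2) K\<rceil>" and K: "34 \<le> K"
  shows "K \<le> (3 / 2) ^ (2 * q)" and "1 + 14 / 10 * K \<le> (3 / 2) ^ (2 * q + 1)"
proof -
  have "1 / 2 * log (3 / 2) K \<le> real q" using q by (simp add: ceiling_le_iff)
  then have "log (3 / 2) K \<le> real (2 * q)" by simp
  then have "K \<le> (3 / 2) powr real (2 * q)" using K by (subst (asm) log_le_iff) auto
  then show *: "K \<le> (3 / 2) ^ (2 * q)" by (subst (asm) powr_realpow) auto
  have "1 + 14 / 10 * K \<le> 3 / 2 * K" using K by simp
  also have "\<dots> \<le> 3 / 2 * (3 / 2) ^ (2 * q)" using * by (rule mult_left_mono) simp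
  finally show "1 + 14 / 10 * K \<le> (3 / 2) ^ (2 * q + 1)" by simp
qed

theorem lemma4p1:
  fixes f :: "nat \<Rightarrow> real^'d \<Rightarrow> real"
    and D :: "(real^'d) set"
    and x :: "real^'d"
    and H :: "real^'d^'d"
    and N b m q :: nat
    and B :: "nat set"
    and M :: "'w measure"
    and \<Omega> U Z :: "'w \<Rightarrow> real^('l::{finite,linorder})^'d"
    and R :: "'w \<Rightarrow> real^('l::{finite,linorder})^('l::{finite,linorder})"
    and lam :: "'w \<Rightarrow> real"
  assumes twice_diff: "\<And>i. i \<in> {1..N} \<Longrightarrow> twice_differentiable (f i)"
    and A1: "hessian_lipschitz f N b D"
    and A2: "strongly_convex_gradient_lipschitz f N b D"
    and A3: "bounded_hessian f N D"
    and b: "1 \<le> b"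
    and iterate: "x \<in> D"
    and batch: "B \<in> batches N b"
    and H: "H = hessian (batch_fun f B) x"
    and prob: "prob_space M"
    and gauss: "std_gaussian_matrix M \<Omega>"
    and l_le_d: "CARD('l) \<le> CARD('d)"
    and QR: "\<And>\<omega>. \<omega> \<in> space M \<Longrightarrow> is_QR (power_iterate H (\<Omega> \<omega>) (2 * q + 1)) (U \<omega>) (R \<omega>)"
    and Z: "\<And>\<omega>. \<omega> \<in> space M \<Longrightarrow> Z \<omega> = H ** U \<omega>"
    and m: "m + 4 \<le> CARD('l)"
    and lam_pos: "\<And>\<omega>. \<omega> \<in> space M \<Longrightarrow> 0 < lam \<omega>"
    and lam_le: "\<And>\<omega>. \<omega> \<in> space M \<Longrightarrow>
      lam \<omega> \<le> min (sigma (m + 1) H) (1 / 2 * sigma_min (transpose (Z \<omega>) ** U \<omega>))"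
    and q: "int q \<ge> \<lceil>1 / 2 * log (3 / 2)
      (34 * sqrt (real CARD('l) / (real CARD('l) - real m))
        + 16 * sqrt (real CARD('l)) / (real CARD('l) - real m + 1) * sqrt (real CARD('d) - real m))\<rceil>"
  shows "\<exists>E \<in> sets M. measure M E \<ge> 1 - 6 * exp (real m - real CARD('l)) \<and>
    (\<forall>\<omega>\<in>E. spectral_norm (approx_hessian H (U \<omega>) (lam \<omega>) - H) \<le> 3 * sigma (m + 1) H)"
proof -
  have "twice_differentiable (batch_fun f B)"
    using batch twice_diff by (intro twice_differentiable_batch_fun) (auto simp: batches_def)
  then have sym: "transpose H = H" unfolding H by (rule symmetric_hessian)
  have pd: "0 < u \<bullet> (H *v u)" if "u \<noteq> 0" for u
    using A2 batch iterate that unfolding H strongly_convex_gradient_lipschitz_def by blast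
  obtain v :: "'d \<Rightarrow> real^'d" and s where on: "\<And>i j. v i \<bullet> v j = (if i = j then 1 else 0)"
    and ev: "\<And>i. H *v v i = s i *\<^sub>R v i"
    using symmetric_matrix_eigenbasis[OF sym] by metis
  have pos: "0 < s i" for i
  proof -
    have "v i \<bullet> v i = 1" using on[of i i] by simp
    moreover from this have "v i \<noteq> 0" by auto
    ultimately show ?thesis using pd[of "v i"] unfolding ev by simp
  qed
  have md: "m < CARD('d)" using m l_le_d by simp
  obtain I where I: "card I = m" "\<And>j. j \<notin> I \<Longrightarrow> s j \<le> sigma (m + 1) H" "sigma (m + 1) H \<in> range s"
    using sigma_threshold[OF on ev sym less_imp_le[OF pos] md] by metis
  have \<sigma>: "0 < sigma (m + 1) H" using I(3) pos by auto
  define V where "V = (\<chi> i. v i)"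
  have V: "orthogonal_matrix V" unfolding V_def using on by (rule orthogonal_matrix_eigenbasis)
  \<comment> \<open>The rows of \<open>V ** W\<close> are the coordinates of the sketch in the
    eigenbasis, which translates the random event into the assumption of the deterministic
    bound.\<close>
  have VW: "(V ** W) $ i \<bullet> c = v i \<bullet> (W *v c)" for W :: "real^('l::{finite,linorder})^'d" and i c
  proof -
    have "(V ** W) $ i \<bullet> c = ((V ** W) *v c) $ i"
      by (simp add: matrix_vector_mult_def inner_vec_def)
    also have "\<dots> = (V *v (W *v c)) $ i" by (simp add: matrix_vector_mul_assoc)
    also have "\<dots> = v i \<bullet> (W *v c)" by (simp add: V_def matrix_vector_mult_def inner_vec_def)
    finally show ?thesis .
  qed
  have Vy: "(V *v y) $ i = v i \<bullet> y" for y i by (simp add: V_def matrix_vector_mult_def inner_vec_def)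
  define p where "p = CARD('l) - m"
  define n where "n = CARD('d) - m"
  \<comment> \<open>The largest \<open>k\<close> with \<open>m + 2 * k <= CARD('l)\<close>.\<close>
  define k where "k = p div 2"
  have p: "4 \<le> p" and l: "CARD('l) = m + p" using m by (simp_all add: p_def)
  have rp: "real CARD('l) - real m = real p" and rn: "real CARD('d) - real m = real n"
    using l md by (simp_all add: n_def)
  have cn: "card (-I) = n" using I(1) by (simp add: n_def Compl_eq_Diff_UNIV card_Diff_subset)
  define K where "K = 34 * sqrt (real CARD('l) / real p) + 16 * sqrt (real CARD('l)) / (real p + 1) * sqrt (real n)"
  note K = sketch_constant_bound[OF p l, of n, folded K_def]
  have qK: "1 + 14 / 10 * K \<le> (3 / 2) ^ (2 * q + 1)"
    using q K(1) unfolding rp rn K_def[symmetric] by (rule powr_bound_from_log)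
  have k1: "1 \<le> k" and card: "card I + 2 * k \<le> CARD('l)" using p l I(1) by (simp_all add: k_def)
  have a: "0 < 14 / 10 * K" using K(1) by simp
  obtain E where E: "E \<in> sets M" and E_prob: "1 - chi_const k m * chi_const k n * (2 / (fact (k - 1) * 2 ^ k))
     / ((14 / 10 * K) ^ (2 * k) * (fact (2 * k) / (2 ^ k * fact k))) \<le> measure M E"
    and E_good: "\<And>\<omega> y. \<omega> \<in> E \<Longrightarrow> \<exists>c. (\<forall>i\<in>I. (V ** \<Omega> \<omega>) $ i \<bullet> c = y $ i) \<and>
      (\<Sum>j\<in>-I. ((V ** \<Omega> \<omega>) $ j \<bullet> c)\<^sup>2) \<le> (14 / 10 * K)\<^sup>2 * (\<Sum>i\<in>I. (y $ i)\<^sup>2)"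
    using right_inverse_event[OF prob gauss V k1 card a] unfolding I(1) cn by blast
  show ?thesis
  proof (intro bexI[of _ E] conjI ballI)
    have "chi_const k m * chi_const k n * (2 / (fact (k - 1) * 2 ^ k))
     / ((14 / 10 * K) ^ (2 * k) * (fact (2 * k) / (2 ^ k * fact k))) \<le> 6 * exp (- real p)"
      by (rule failure_probability_le[OF p k_def l a K(2)])
    moreover have "real m - real CARD('l) = - real p" using l by simp
    ultimately show "measure M E \<ge> 1 - 6 * exp (real m - real CARD('l))" using E_prob by simp
  next
    \<comment> \<open>On \<open>E\<close> the rest is deterministic and holds for whichever QR
      factors and admissible \<open>lam\<close> occur at this outcome.\<close>
    fix \<omega> assume \<omega>: "\<omega> \<in> E"
    then have \<omega>M: "\<omega> \<in> space M" using E sets.sets_into_space by blast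
    show "spectral_norm (approx_hessian H (U \<omega>) (lam \<omega>) - H) \<le> 3 * sigma (m + 1) H"
    proof (rule spectral_norm_approx_hessian_le[OF on ev sym less_imp_le[OF pos] I(2) \<sigma> QR[OF \<omega>M]])
      show "\<exists>c. (\<forall>i\<in>I. v i \<bullet> (\<Omega> \<omega> *v c) = v i \<bullet> y) \<and>
        (\<Sum>j\<in>-I. (v j \<bullet> (\<Omega> \<omega> *v c))\<^sup>2) \<le> (14 / 10 * K)\<^sup>2 * (\<Sum>i\<in>I. (v i \<bullet> y)\<^sup>2)" for y
        using E_good[OF \<omega>, of "V *v y"] unfolding VW Vy .
      show "lam \<omega> \<le> sigma (m + 1) H" using lam_le[OF \<omega>M] by simp
    qed (use a qK lam_pos[OF \<omega>M] in auto)
  qed (fact E)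
qed

end
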